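(* Let $(\mathbb{X},\perp)$ be a finitely disjoint $\perp$-restriction category with a Kleene wand $\circledast$ (so $(\mathbb{X},\circledast)$ is a $\perp$-itegory). Then $\mathsf{MAT}[(\mathbb{X},\perp)]$ is a traced extensive restriction category, where the trace operator $\mathsf{Tr}$ is defined on a matrix $F:(X)+(A)=(X,A)\to(X,B)=(X)+(B)$ by $$\mathsf{Tr}^{(X)}_{(A),(B)}(F)=\big[\,F_{2,2}\sqcup F_{2,1}(F_{1,1}\circledast F_{1,2})\,\big],$$ and is extended to matrices $F:(X_1,\dots,X_n)+(A_1,\dots,A_m)\to(X_1,\dots,X_n)+(B_1,\dots,B_p)$ as follows: for $n=1$, $\mathsf{Tr}(F)$ is the $m\times p$ matrix with entries $$\mathsf{Tr}(F)_{i,j}=F_{i+1,j+1}\sqcup F_{i+1,1}(F_{1,1}\circledast F_{1,j+1});$$ for $n\ge2$, inductively, $\mathsf{Tr}^{(X_1,\dots,X_n)}(F)=\mathsf{Tr}^{(X_2,\dots,X_n)}\big(\mathsf{Tr}^{(X_1)}(F)\big)$; (and $\mathsf{Tr}^{()}(F)=F$ for $n=0$). Furthermore, the functor $\mathcal{I}:\mathbb{X}\to\mathsf{MAT}[(\mathbb{X},\perp)]$, $\mathcal{I}(A)=(A)$, $\mathcal{I}(f)=[f]$, preserves Kleene wands: $\mathcal{I}(f\circledast g)=\mathcal{I}(f)\circledast\mathcal{I}(g)$, where the Kleene wand on $\mathsf{MAT}[(\mathbb{X},\perp)]$ (for $\perp_d$) is the one induced by the trace, $F\circledast G:=\mathsf{Tr}^X_{X,A}\big(\left[\begin{smallmatrix}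 F & G \\ F & G \end{smallmatrix}\right]\big)$ for $F:X\to X$, $G:X\to A$ in $\mathsf{MAT}[(\mathbb{X},\perp)]$ with $F\perp_dG$.
   Context: Composition is diagrammatic: $fg$ means first $f$, then $g$. A restriction category is a category with an operator sending each $f:A\to B$ to $\overline{f}:A\to A$ such that $\overline{f}f=f$; $\overline{f}\,\overline{g}=\overline{g}\,\overline{f}$ and $\overline{\overline{g}f}=\overline{g}\,\overline{f}$ for $f:A\to B$, $g:A\to C$; and $f\overline{g}=\overline{fg}f$ for $f:A\to B$, $g:B\to C$. For parallel $f,g$: $f\le g$ iff $\overline{f}g=f$. A map $f:A\to B$ is total if $\overline{f}=1_A$. Restriction zeroes: maps $0:A\to B$ with $f0=0=0f$ and $\overline{0}=0$. An interference relation $\perp$ on a restriction category with restriction zeroes is a family of relations between maps with the same domain such that: $1_A\perp 0$; $f\perp g\Rightarrow g\perp f$; $f\perp f\Rightarrow f=0$; $f'\perp g'$, $f\le f'$, $g\le g'$ imply $f\perp g$; $f\perp g\Rightarrow hfk\perp hgk'$ for all composable $h,k,k'$; $f\perp g\Rightarrow\overline{f}\perp\overline{g}$. A $\perp$-restriction category is a restriction category with restriction zeroes and a chosen interference relation $\perp$. The $\perp$-join $\bigsqcup_if_i$ of a family of parallel maps with $f_i\perp f_j$ for $i\neq j$ is their least upper bound for $\le$; it is strong if $f_i\perp h$ for all $i$ implies $\bigsqcup_if_i\perp h$. A finitely disjoint $\perp$-restriction category is one in which every finite pairwise $\perp$-disjoint family of parallel maps has a $\perp$-join, $h\bigsqcup_if_i=\bigsqcup_ihf_i$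 for all composable $h$, and every finite $\perp$-join is strong. A Kleene wand $\circledast$ on a $\perp$-restriction category with all binary $\perp$-joins assigns to each $f:X\to X$, $g:X\to A$ with $f\perp g$ a map $f\circledast g:X\to A$ such that: (1) if $f \perp g$, then $g\sqcup f(f\circledast g)=f\circledast g$; (2) $(f\circledast g)h=f\circledast gh$ for $f\perp g$, $h:A\to B$; (3) for $f:X\to Y$, $g:X\to A$, $k:Y\to X$ with $f\perp g$: $kf\circledast kg=k(fk\circledast g)$; (4) for $f,f':X\to X$, $g:X\to A$ with $f\perp f'$ and $f\sqcup f'\perp g$: $(f\circledast f')\perp(f\circledast g)$ and $(f\sqcup f')\circledast g=(f\circledast f')\circledast(f\circledast g)$. A $\perp$-itegory is a $\perp$-restriction category with all binary $\perp$-joins and a Kleene wand. A coCartesian restriction category is a restriction category with finite coproducts whose injections $\iota_j$ are total. With restriction zeroes, $\iota_j^\circ:A_1+\dots+A_n\to A_j$ is the unique map with $\iota_j\iota_j^\circ=1_{A_j}$ and $\iota_i\iota_j^\circ=0$ for $i\ne j$; $\nabla$ is the codiagonal. An extensive restriction category is a coCartesian restriction category with restriction zeroes such that for every $f:A\to B_1+\dots+B_n$ there is a (necessarily unique) map $\langle f\rangle:A\to A+\dots+A$ ($n$ copies) with $\overline{f}=\langle f\rangle\nabla$ and $\langle f\rangle(f+\dots+f)=f(\iota_1+\dots+\iota_n)$. A map $d:A\to A+\dots+A$ is a decision if $\langle d\rangle=d$. For $f:A\to B$, $g:A\to C$, $f\perp_d g$ iff there is a decision $d:A\to A+A$ with $d\iota_1^\circ=\overline{f}$,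 $d\iota_2^\circ=\overline{g}$; this is an interference relation with binary joins. A trace operator for the coproduct sends $f:X+A\to X+B$ to $\mathsf{Tr}^X_{A,B}(f):A\to B$ (associativity isomorphisms suppressed) such that: [Tightening] $\mathsf{Tr}^X((1_X+g)f(1_X+h))=g\,\mathsf{Tr}^X(f)\,h$; [Sliding] $\mathsf{Tr}^X(f(k+1_B))=\mathsf{Tr}^{X'}((k+1_A)f)$ for $f:X+A\to X'+B$, $k:X'\to X$; [Vanishing] $\mathsf{Tr}^{X+Y}(f)=\mathsf{Tr}^Y(\mathsf{Tr}^X(f))$ for $f:X+Y+A\to X+Y+B$; [Superposing] $\mathsf{Tr}^X(f+g)=\mathsf{Tr}^X(f)+g$; [Yanking] $\mathsf{Tr}^X_{X,X}(\sigma)=1_X$ for the symmetry $\sigma:X+X\to X+X$. A traced extensive restriction category is an extensive restriction category equipped with a trace operator. $\mathsf{MAT}[(\mathbb{X},\perp)]$: objects are finite lists $(A_1,\dots,A_n)$ of objects of $\mathbb{X}$, including the empty list $()$; a map $F:(A_1,\dots,A_n)\to(B_1,\dots,B_m)$ is an $n\times m$ matrix of maps $F_{i,j}:A_i\to B_j$ with $F_{i,j}\perp F_{i,j'}$ for all $i$ and all $j\ne j'$; identities are diagonal matrices of identities; composition with $G:(B_1,\dots,B_m)\to(C_1,\dots,C_p)$ is $(FG)_{i,k}=\bigsqcup_{j=1}^mF_{i,j}G_{j,k}$; $\overline{F}$ is the diagonal matrix with $\overline{F}_{i,i}=\bigsqcup_{j=1}^m\overline{F_{i,j}}$; coproducts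 are concatenation of lists, with injections the evident block matrices of identities and zeroes; restriction zero maps are matrices of zeroes. In $\mathsf{MAT}[(\mathbb{X},\perp)]$, $F\perp_dG$ iff $F_{i,j}\perp G_{i,k}$ for all $i,j,k$, and block matrices denote the evident concatenated matrices. *)

theory Defs
  imports "Jordan_Normal_Form.Matrix"
begin

section \<open>Restriction categories\<close>

text \<open>Composition is written in diagrammatic order.\<close>

record ('o, 'm) category =
  Obj :: "'o set"
  Arr :: "'m set"
  Dom :: "'m \<Rightarrow> 'o"
  Cod :: "'m \<Rightarrow> 'o"
  Ident :: "'o \<Rightarrow> 'm"
  Comp :: "'m \<Rightarrow> 'm \<Rightarrow> 'm"  (infixl "\<Zsemi>\<index>" 70)

definition Hom :: "('o, 'm, 'z) category_scheme \<Rightarrow> 'o \<Rightarrow> 'o \<Rightarrow> 'm set" where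
  "Hom C A B = {f \<in> Arr C. Dom C f = A \<and> Cod C f = B}"

locale category =
  fixes C :: "('o, 'm, 'z) category_scheme" (structure)
  assumes dom_obj: "f \<in> Arr C \<Longrightarrow> Dom C f \<in> Obj C"
    and cod_obj: "f \<in> Arr C \<Longrightarrow> Cod C f \<in> Obj C"
    and ident_hom: "A \<in> Obj C \<Longrightarrow> Ident C A \<in> Hom C A A"
    and comp_hom: "\<lbrakk>f \<in> Hom C A B; g \<in> Hom C B D\<rbrakk> \<Longrightarrow> f \<Zsemi> g \<in> Hom C A D"
    and ident_left: "f \<in> Hom C A B \<Longrightarrow> Ident C A \<Zsemi> f = f"
    and ident_right: "f \<in> Hom C A B \<Longrightarrow> f \<Zsemi> Ident C B = f"
    and comp_assoc: "\<lbrakk>f \<in> Hom C A B; g \<in> Hom C B D; h \<in> Hom C D E\<rbrakk>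
      \<Longrightarrow> (f \<Zsemi> g) \<Zsemi> h = f \<Zsemi> (g \<Zsemi> h)"

definition is_functor ::
  "('o, 'm, 'z) category_scheme \<Rightarrow> ('p, 'n, 'y) category_scheme
    \<Rightarrow> ('o \<Rightarrow> 'p) \<Rightarrow> ('m \<Rightarrow> 'n) \<Rightarrow> bool" where
  "is_functor C D Fo Fm \<longleftrightarrow>
     (\<forall>A \<in> Obj C. Fo A \<in> Obj D) \<and>
     (\<forall>A B. \<forall>f \<in> Hom C A B. Fm f \<in> Hom D (Fo A) (Fo B)) \<and>
     (\<forall>A \<in> Obj C. Fm (Ident C A) = Ident D (Fo A)) \<and>
     (\<forall>A B E. \<forall>f \<in> Hom C A B. \<forall>g \<in> Hom C B E.
        Fm (f \<Zsemi>\<^bsub>C\<^esub> g) = Fm f \<Zsemi>\<^bsub>D\<^esub> Fm g)"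

record ('o, 'm) rcategory = "('o, 'm) category" +
  Rst :: "'m \<Rightarrow> 'm"
  Zero :: "'o \<Rightarrow> 'o \<Rightarrow> 'm"

locale restriction_category = category C
  for C :: "('o, 'm, 'z) rcategory_scheme" (structure) +
  assumes rst_hom: "f \<in> Hom C A B \<Longrightarrow> Rst C f \<in> Hom C A A"
    and rst_comp_self: "f \<in> Hom C A B \<Longrightarrow> Rst C f \<Zsemi> f = f"
    and rst_commute: "\<lbrakk>f \<in> Hom C A B; g \<in> Hom C A D\<rbrakk>
      \<Longrightarrow> Rst C f \<Zsemi> Rst C g = Rst C g \<Zsemi> Rst C f"
    and rst_rst_comp: "\<lbrakk>f \<in> Hom C A B; g \<in> Hom C A D\<rbrakk>
      \<Longrightarrow> Rst C (Rst C g \<Zsemi> f) = Rst C g \<Zsemi> Rst C f"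
    and comp_rst: "\<lbrakk>f \<in> Hom C A B; g \<in> Hom C B D\<rbrakk>
      \<Longrightarrow> f \<Zsemi> Rst C g = Rst C (f \<Zsemi> g) \<Zsemi> f"

definition total :: "('o, 'm, 'z) rcategory_scheme \<Rightarrow> 'm \<Rightarrow> bool" where
  "total C f \<longleftrightarrow> f \<in> Arr C \<and> Rst C f = Ident C (Dom C f)"

definition rle :: "('o, 'm, 'z) rcategory_scheme \<Rightarrow> 'm \<Rightarrow> 'm \<Rightarrow> bool" where
  "rle C f g \<longleftrightarrow> f \<in> Arr C \<and> g \<in> Arr C \<and> Dom C f = Dom C g \<and> Cod C f = Cod C g
     \<and> Rst C f \<Zsemi>\<^bsub>C\<^esub> g = f"

locale restriction_category_with_zeroes = restriction_category C
  for C :: "('o, 'm, 'z) rcategory_scheme" (structure) +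
  assumes zero_hom: "\<lbrakk>A \<in> Obj C; B \<in> Obj C\<rbrakk> \<Longrightarrow> Zero C A B \<in> Hom C A B"
    and comp_zero: "\<lbrakk>f \<in> Hom C A B; D \<in> Obj C\<rbrakk> \<Longrightarrow> f \<Zsemi> Zero C B D = Zero C A D"
    and zero_comp: "\<lbrakk>f \<in> Hom C A B; D \<in> Obj C\<rbrakk> \<Longrightarrow> Zero C D A \<Zsemi> f = Zero C D B"
    and rst_zero: "\<lbrakk>A \<in> Obj C; B \<in> Obj C\<rbrakk> \<Longrightarrow> Rst C (Zero C A B) = Zero C A A"

section \<open>Interference relations, joins and Kleene wands\<close>

locale perp_restriction_category = restriction_category_with_zeroes C
  for C :: "('o, 'm, 'z) rcategory_scheme" (structure) +
  fixes perp :: "'m \<Rightarrow> 'm \<Rightarrow> bool"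
  assumes perp_arr: "perp f g \<Longrightarrow> f \<in> Arr C \<and> g \<in> Arr C \<and> Dom C f = Dom C g"
    and perp_ident_zero: "\<lbrakk>A \<in> Obj C; B \<in> Obj C\<rbrakk> \<Longrightarrow> perp (Ident C A) (Zero C A B)"
    and perp_sym: "perp f g \<Longrightarrow> perp g f"
    and perp_self: "perp f f \<Longrightarrow> f = Zero C (Dom C f) (Cod C f)"
    and perp_down: "\<lbrakk>perp f' g'; rle C f f'; rle C g g'\<rbrakk> \<Longrightarrow> perp f g"
    and perp_comp: "\<lbrakk>perp f g; h \<in> Hom C E A; f \<in> Hom C A B; g \<in> Hom C A D;
        k \<in> Hom C B B'; k' \<in> Hom C D D'\<rbrakk>
      \<Longrightarrow> perp (h \<Zsemi> f \<Zsemi> k) (h \<Zsemi> g \<Zsemi> k')"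
    and perp_rst: "perp f g \<Longrightarrow> perp (Rst C f) (Rst C g)"

definition is_join :: "('o, 'm, 'z) rcategory_scheme \<Rightarrow> 'o \<Rightarrow> 'o \<Rightarrow> 'm set \<Rightarrow> 'm \<Rightarrow> bool" where
  "is_join C A B S j \<longleftrightarrow> j \<in> Hom C A B \<and> (\<forall>f \<in> S. rle C f j) \<and>
     (\<forall>h \<in> Hom C A B. (\<forall>f \<in> S. rle C f h) \<longrightarrow> rle C j h)"

text \<open>The hom-set is an explicit argument so that the join of the empty family is determined.\<close>

definition Join :: "('o, 'm, 'z) rcategory_scheme \<Rightarrow> 'o \<Rightarrow> 'o \<Rightarrow> 'm set \<Rightarrow> 'm" where
  "Join C A B S = (THE j. is_join C A B S j)"

definition bjoin :: "('o, 'm, 'z) rcategory_scheme \<Rightarrow> 'm \<Rightarrow> 'm \<Rightarrow> 'm" where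
  "bjoin C f g = Join C (Dom C f) (Cod C f) {f, g}"

text \<open>Finite families are indexed by initial segments of the naturals.\<close>

definition disjoint_family_in ::
  "('o, 'm, 'z) rcategory_scheme \<Rightarrow> ('m \<Rightarrow> 'm \<Rightarrow> bool) \<Rightarrow> 'o \<Rightarrow> 'o \<Rightarrow> nat \<Rightarrow> (nat \<Rightarrow> 'm) \<Rightarrow> bool"
  where
  "disjoint_family_in C perp A B n f \<longleftrightarrow> A \<in> Obj C \<and> B \<in> Obj C \<and>
     (\<forall>i < n. f i \<in> Hom C A B) \<and> (\<forall>i < n. \<forall>j < n. i \<noteq> j \<longrightarrow> perp (f i) (f j))"

locale finitely_disjoint_perp_restriction_category = perp_restriction_category C perp
  for C :: "('o, 'm, 'z) rcategory_scheme" (structure) and perp +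
  assumes join_exists: "disjoint_family_in C perp A B n f
      \<Longrightarrow> \<exists>j. is_join C A B (f ` {..<n}) j"
    and comp_join: "\<lbrakk>disjoint_family_in C perp A B n f; h \<in> Hom C D A\<rbrakk>
      \<Longrightarrow> h \<Zsemi> Join C A B (f ` {..<n}) = Join C D B ((\<lambda>i. h \<Zsemi> f i) ` {..<n})"
    and join_strong: "\<lbrakk>disjoint_family_in C perp A B n f; h \<in> Hom C A D; \<forall>i < n. perp (f i) h\<rbrakk>
      \<Longrightarrow> perp (Join C A B (f ` {..<n})) h"

locale perp_itegory = perp_restriction_category C perp
  for C :: "('o, 'm, 'z) rcategory_scheme" (structure) and perp +
  fixes wand :: "'m \<Rightarrow> 'm \<Rightarrow> 'm"  (infixl "\<circledast>" 68)
  assumes bjoin_exists: "\<lbrakk>f \<in> Hom C A B; g \<in> Hom C A B; perp f g\<rbrakk>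
      \<Longrightarrow> \<exists>j. is_join C A B {f, g} j"
    and wand_hom: "\<lbrakk>f \<in> Hom C X X; g \<in> Hom C X A; perp f g\<rbrakk> \<Longrightarrow> f \<circledast> g \<in> Hom C X A"
    and wand_iterate: "\<lbrakk>f \<in> Hom C X X; g \<in> Hom C X A; perp f g\<rbrakk>
      \<Longrightarrow> bjoin C g (f \<Zsemi> (f \<circledast> g)) = f \<circledast> g"
    and wand_natural: "\<lbrakk>f \<in> Hom C X X; g \<in> Hom C X A; perp f g; h \<in> Hom C A B\<rbrakk>
      \<Longrightarrow> (f \<circledast> g) \<Zsemi> h = f \<circledast> (g \<Zsemi> h)"
    and wand_dinatural: "\<lbrakk>f \<in> Hom C X Y; g \<in> Hom C X A; k \<in> Hom C Y X; perp f g\<rbrakk>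
      \<Longrightarrow> (k \<Zsemi> f) \<circledast> (k \<Zsemi> g) = k \<Zsemi> ((f \<Zsemi> k) \<circledast> g)"
    and wand_diagonal_perp: "\<lbrakk>f \<in> Hom C X X; f' \<in> Hom C X X; g \<in> Hom C X A;
        perp f f'; perp (bjoin C f f') g\<rbrakk>
      \<Longrightarrow> perp (f \<circledast> f') (f \<circledast> g)"
    and wand_diagonal: "\<lbrakk>f \<in> Hom C X X; f' \<in> Hom C X X; g \<in> Hom C X A;
        perp f f'; perp (bjoin C f f') g\<rbrakk>
      \<Longrightarrow> bjoin C f f' \<circledast> g = (f \<circledast> f') \<circledast> (f \<circledast> g)"

section \<open>Extensive restriction categories\<close>

text \<open>A finite coproduct is chosen for every finite list of objects, with injections
  numbered from 0; the empty list gives the initial object.\<close>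

record ('o, 'm) ccategory = "('o, 'm) rcategory" +
  Sum :: "'o list \<Rightarrow> 'o"
  Inj :: "'o list \<Rightarrow> nat \<Rightarrow> 'm"

locale cocartesian_restriction_category = restriction_category C
  for C :: "('o, 'm, 'z) ccategory_scheme" (structure) +
  assumes sum_obj: "set As \<subseteq> Obj C \<Longrightarrow> Sum C As \<in> Obj C"
    and inj_hom: "\<lbrakk>set As \<subseteq> Obj C; i < length As\<rbrakk> \<Longrightarrow> Inj C As i \<in> Hom C (As ! i) (Sum C As)"
    and sum_universal: "\<lbrakk>set As \<subseteq> Obj C; B \<in> Obj C; length fs = length As;
        \<forall>i < length As. fs ! i \<in> Hom C (As ! i) B\<rbrakk>
      \<Longrightarrow> \<exists>!h. h \<in> Hom C (Sum C As) B \<and> (\<forall>i < length As. Inj C As i \<Zsemi> h = fs ! i)"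
    and inj_total: "\<lbrakk>set As \<subseteq> Obj C; i < length As\<rbrakk> \<Longrightarrow> total C (Inj C As i)"

definition Copair ::
  "('o, 'm, 'z) ccategory_scheme \<Rightarrow> 'o list \<Rightarrow> 'o \<Rightarrow> 'm list \<Rightarrow> 'm" where
  "Copair C As B fs = (THE h. h \<in> Hom C (Sum C As) B \<and>
     (\<forall>i < length As. Inj C As i \<Zsemi>\<^bsub>C\<^esub> h = fs ! i))"

definition SumMap :: "('o, 'm, 'z) ccategory_scheme \<Rightarrow> 'm list \<Rightarrow> 'm" where
  "SumMap C fs = Copair C (map (Dom C) fs) (Sum C (map (Cod C) fs))
     (map (\<lambda>i. fs ! i \<Zsemi>\<^bsub>C\<^esub> Inj C (map (Cod C) fs) i) [0..<length fs])"

definition Codiag :: "('o, 'm, 'z) ccategory_scheme \<Rightarrow> nat \<Rightarrow> 'o \<Rightarrow> 'm" where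
  "Codiag C n A = Copair C (replicate n A) A (replicate n (Ident C A))"

text \<open>The maps \<open>\<iota>\<^sub>j\<^sup>\<circ>\<close>.\<close>

definition Inj_inv :: "('o, 'm, 'z) ccategory_scheme \<Rightarrow> 'o list \<Rightarrow> nat \<Rightarrow> 'm" where
  "Inj_inv C As j = Copair C As (As ! j)
     (map (\<lambda>i. if i = j then Ident C (As ! j) else Zero C (As ! i) (As ! j)) [0..<length As])"

text \<open>\<open>is_bracket C A Bs f d\<close> says that \<open>d\<close> has the defining properties of
  \<open>\<langle>f\<rangle>\<close> for \<open>f : A \<rightarrow> B\<^sub>1 + \<dots> + B\<^sub>n\<close>.  The decomposition \<open>Bs\<close> has to be given, since
  it is not determined by the codomain of \<open>f\<close>.\<close>

definition is_bracket ::
  "('o, 'm, 'z) ccategory_scheme \<Rightarrow> 'o \<Rightarrow> 'o list \<Rightarrow> 'm \<Rightarrow> 'm \<Rightarrow> bool" where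
  "is_bracket C A Bs f d \<longleftrightarrow>
     d \<in> Hom C A (Sum C (replicate (length Bs) A)) \<and>
     Rst C f = d \<Zsemi>\<^bsub>C\<^esub> Codiag C (length Bs) A \<and>
     d \<Zsemi>\<^bsub>C\<^esub> SumMap C (replicate (length Bs) f) =
       f \<Zsemi>\<^bsub>C\<^esub> SumMap C (map (Inj C Bs) [0..<length Bs])"

definition bracket :: "('o, 'm, 'z) ccategory_scheme \<Rightarrow> 'o list \<Rightarrow> 'm \<Rightarrow> 'm" where
  "bracket C Bs f = (THE d. is_bracket C (Dom C f) Bs f d)"

locale extensive_restriction_category =
  cocartesian_restriction_category C + restriction_category_with_zeroes C
  for C :: "('o, 'm, 'z) ccategory_scheme" (structure) +
  assumes bracket_exists: "\<lbrakk>set Bs \<subseteq> Obj C; f \<in> Hom C A (Sum C Bs)\<rbrakk>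
      \<Longrightarrow> \<exists>!d. is_bracket C A Bs f d"

definition is_decision :: "('o, 'm, 'z) ccategory_scheme \<Rightarrow> nat \<Rightarrow> 'o \<Rightarrow> 'm \<Rightarrow> bool" where
  "is_decision C n A d \<longleftrightarrow>
     d \<in> Hom C A (Sum C (replicate n A)) \<and> bracket C (replicate n A) d = d"

definition perp_d :: "('o, 'm, 'z) ccategory_scheme \<Rightarrow> 'm \<Rightarrow> 'm \<Rightarrow> bool" where
  "perp_d C f g \<longleftrightarrow> f \<in> Arr C \<and> g \<in> Arr C \<and> Dom C f = Dom C g \<and>
     (\<exists>d. is_decision C 2 (Dom C f) d \<and>
        d \<Zsemi>\<^bsub>C\<^esub> Inj_inv C [Dom C f, Dom C f] 0 = Rst C f \<and>
        d \<Zsemi>\<^bsub>C\<^esub> Inj_inv C [Dom C f, Dom C f] 1 = Rst C g)"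

section \<open>Traces\<close>

abbreviation plus_obj :: "('o, 'm, 'z) ccategory_scheme \<Rightarrow> 'o \<Rightarrow> 'o \<Rightarrow> 'o"
    (infixr "\<oplus>\<^sub>o\<index>" 66) where
  "A \<oplus>\<^sub>o\<^bsub>C\<^esub> B \<equiv> Sum C [A, B]"

abbreviation plus_map :: "('o, 'm, 'z) ccategory_scheme \<Rightarrow> 'm \<Rightarrow> 'm \<Rightarrow> 'm"
    (infixr "\<oplus>\<^sub>m\<index>" 72) where
  "f \<oplus>\<^sub>m\<^bsub>C\<^esub> g \<equiv> SumMap C [f, g]"

text \<open>The associativity isomorphism \<open>(X + Y) + Z \<rightarrow> X + (Y + Z)\<close> and its inverse.\<close>

definition Assoc :: "('o, 'm, 'z) ccategory_scheme \<Rightarrow> 'o \<Rightarrow> 'o \<Rightarrow> 'o \<Rightarrow> 'm" where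
  "Assoc C X Y Z = (let W = Sum C [X, Sum C [Y, Z]]; i = Inj C [X, Sum C [Y, Z]] in
     Copair C [Sum C [X, Y], Z] W
       [Copair C [X, Y] W [i 0, Inj C [Y, Z] 0 \<Zsemi>\<^bsub>C\<^esub> i 1], Inj C [Y, Z] 1 \<Zsemi>\<^bsub>C\<^esub> i 1])"

definition Assoc_inv :: "('o, 'm, 'z) ccategory_scheme \<Rightarrow> 'o \<Rightarrow> 'o \<Rightarrow> 'o \<Rightarrow> 'm" where
  "Assoc_inv C X Y Z = (let W = Sum C [Sum C [X, Y], Z]; i = Inj C [Sum C [X, Y], Z] in
     Copair C [X, Sum C [Y, Z]] W
       [Inj C [X, Y] 0 \<Zsemi>\<^bsub>C\<^esub> i 0, Copair C [Y, Z] W [Inj C [X, Y] 1 \<Zsemi>\<^bsub>C\<^esub> i 0, i 1]])"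

definition Symm :: "('o, 'm, 'z) ccategory_scheme \<Rightarrow> 'o \<Rightarrow> 'o \<Rightarrow> 'm" where
  "Symm C X Y = Copair C [X, Y] (Sum C [Y, X]) [Inj C [Y, X] 1, Inj C [Y, X] 0]"

text \<open>\<open>Tr X A B f\<close> is the trace of \<open>f : X + A \<rightarrow> X + B\<close>.\<close>

locale traced_extensive_restriction_category = extensive_restriction_category C
  for C :: "('o, 'm, 'z) ccategory_scheme" (structure) +
  fixes Tr :: "'o \<Rightarrow> 'o \<Rightarrow> 'o \<Rightarrow> 'm \<Rightarrow> 'm"
  assumes trace_hom: "\<lbrakk>X \<in> Obj C; A \<in> Obj C; B \<in> Obj C; f \<in> Hom C (X \<oplus>\<^sub>o A) (X \<oplus>\<^sub>o B)\<rbrakk>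
      \<Longrightarrow> Tr X A B f \<in> Hom C A B"
    and tightening: "\<lbrakk>X \<in> Obj C; A \<in> Obj C; B \<in> Obj C; f \<in> Hom C (X \<oplus>\<^sub>o A) (X \<oplus>\<^sub>o B);
        g \<in> Hom C A' A; h \<in> Hom C B B'\<rbrakk>
      \<Longrightarrow> Tr X A' B' ((Ident C X \<oplus>\<^sub>m g) \<Zsemi> f \<Zsemi> (Ident C X \<oplus>\<^sub>m h)) = g \<Zsemi> Tr X A B f \<Zsemi> h"
    and sliding: "\<lbrakk>X \<in> Obj C; X' \<in> Obj C; A \<in> Obj C; B \<in> Obj C;
        f \<in> Hom C (X \<oplus>\<^sub>o A) (X' \<oplus>\<^sub>o B); k \<in> Hom C X' X\<rbrakk>
      \<Longrightarrow> Tr X A B (f \<Zsemi> (k \<oplus>\<^sub>m Ident C B)) = Tr X' A B ((k \<oplus>\<^sub>m Ident C A) \<Zsemi> f)"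
    and vanishing: "\<lbrakk>X \<in> Obj C; Y \<in> Obj C; A \<in> Obj C; B \<in> Obj C;
        f \<in> Hom C ((X \<oplus>\<^sub>o Y) \<oplus>\<^sub>o A) ((X \<oplus>\<^sub>o Y) \<oplus>\<^sub>o B)\<rbrakk>
      \<Longrightarrow> Tr (X \<oplus>\<^sub>o Y) A B f =
        Tr Y A B (Tr X (Y \<oplus>\<^sub>o A) (Y \<oplus>\<^sub>o B) (Assoc_inv C X Y A \<Zsemi> f \<Zsemi> Assoc C X Y B))"
    and superposing: "\<lbrakk>X \<in> Obj C; A \<in> Obj C; B \<in> Obj C; f \<in> Hom C (X \<oplus>\<^sub>o A) (X \<oplus>\<^sub>o B);
        g \<in> Hom C D E\<rbrakk>
      \<Longrightarrow> Tr X (A \<oplus>\<^sub>o D) (B \<oplus>\<^sub>o E) (Assoc_inv C X A D \<Zsemi> (f \<oplus>\<^sub>m g) \<Zsemi> Assoc C X B E) =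
        Tr X A B f \<oplus>\<^sub>m g"
    and yanking: "X \<in> Obj C \<Longrightarrow> Tr X X X (Symm C X X) = Ident C X"

section \<open>The matrix construction\<close>

text \<open>Matrix rows and columns are numbered from 0.  An arrow carries its source and target
  lists together with its matrix of components.\<close>

datatype ('o, 'm) marr = MArr (mdom: "'o list") (mcod: "'o list") (ment: "'m mat")

definition MAT_arr ::
  "('o, 'm, 'z) rcategory_scheme \<Rightarrow> ('m \<Rightarrow> 'm \<Rightarrow> bool) \<Rightarrow> ('o, 'm) marr \<Rightarrow> bool" where
  "MAT_arr C perp F \<longleftrightarrow>
     set (mdom F) \<subseteq> Obj C \<and> set (mcod F) \<subseteq> Obj C \<and>
     ment F \<in> carrier_mat (length (mdom F)) (length (mcod F)) \<and>
     (\<forall>i < length (mdom F). \<forall>j < length (mcod F).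
        ment F $$ (i, j) \<in> Hom C (mdom F ! i) (mcod F ! j)) \<and>
     (\<forall>i < length (mdom F). \<forall>j < length (mcod F). \<forall>j' < length (mcod F).
        j \<noteq> j' \<longrightarrow> perp (ment F $$ (i, j)) (ment F $$ (i, j')))"

definition MAT_ident :: "('o, 'm, 'z) rcategory_scheme \<Rightarrow> 'o list \<Rightarrow> ('o, 'm) marr" where
  "MAT_ident C As = MArr As As (mat (length As) (length As)
     (\<lambda>(i, j). if i = j then Ident C (As ! i) else Zero C (As ! i) (As ! j)))"

definition MAT_comp ::
  "('o, 'm, 'z) rcategory_scheme \<Rightarrow> ('o, 'm) marr \<Rightarrow> ('o, 'm) marr \<Rightarrow> ('o, 'm) marr" where
  "MAT_comp C F G = MArr (mdom F) (mcod G) (mat (length (mdom F)) (length (mcod G))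
     (\<lambda>(i, k). Join C (mdom F ! i) (mcod G ! k)
        ((\<lambda>j. ment F $$ (i, j) \<Zsemi>\<^bsub>C\<^esub> ment G $$ (j, k)) ` {..<length (mcod F)})))"

definition MAT_rst :: "('o, 'm, 'z) rcategory_scheme \<Rightarrow> ('o, 'm) marr \<Rightarrow> ('o, 'm) marr" where
  "MAT_rst C F = MArr (mdom F) (mdom F) (mat (length (mdom F)) (length (mdom F))
     (\<lambda>(i, i'). if i = i'
        then Join C (mdom F ! i) (mdom F ! i)
               ((\<lambda>j. Rst C (ment F $$ (i, j))) ` {..<length (mcod F)})
        else Zero C (mdom F ! i) (mdom F ! i')))"

definition MAT_zero ::
  "('o, 'm, 'z) rcategory_scheme \<Rightarrow> 'o list \<Rightarrow> 'o list \<Rightarrow> ('o, 'm) marr" where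
  "MAT_zero C As Bs = MArr As Bs (mat (length As) (length Bs)
     (\<lambda>(i, j). Zero C (As ! i) (Bs ! j)))"

definition MAT_inj ::
  "('o, 'm, 'z) rcategory_scheme \<Rightarrow> 'o list list \<Rightarrow> nat \<Rightarrow> ('o, 'm) marr" where
  "MAT_inj C Ass k = MArr (Ass ! k) (concat Ass) (mat (length (Ass ! k)) (length (concat Ass))
     (\<lambda>(i, j). if j = length (concat (take k Ass)) + i
        then Ident C (Ass ! k ! i)
        else Zero C (Ass ! k ! i) (concat Ass ! j)))"

definition MAT ::
  "('o, 'm, 'z) rcategory_scheme \<Rightarrow> ('m \<Rightarrow> 'm \<Rightarrow> bool) \<Rightarrow> ('o list, ('o, 'm) marr) ccategory" where
  "MAT C perp = \<lparr>
     Obj = lists (Obj C), Arr = Collect (MAT_arr C perp), Dom = mdom, Cod = mcod,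
     Ident = MAT_ident C, Comp = MAT_comp C, Rst = MAT_rst C, Zero = MAT_zero C,
     Sum = concat, Inj = MAT_inj C\<rparr>"

text \<open>Trace over a one-element list: eliminates the first row and the first column.\<close>

definition MAT_trace1 ::
  "('o, 'm, 'z) rcategory_scheme \<Rightarrow> ('m \<Rightarrow> 'm \<Rightarrow> 'm) \<Rightarrow> ('o, 'm) marr \<Rightarrow> ('o, 'm) marr" where
  "MAT_trace1 C wand F = MArr (tl (mdom F)) (tl (mcod F))
     (mat (length (mdom F) - 1) (length (mcod F) - 1)
       (\<lambda>(i, j). bjoin C (ment F $$ (i + 1, j + 1))
          (ment F $$ (i + 1, 0) \<Zsemi>\<^bsub>C\<^esub> wand (ment F $$ (0, 0)) (ment F $$ (0, j + 1)))))"

fun MAT_trace ::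
  "('o, 'm, 'z) rcategory_scheme \<Rightarrow> ('m \<Rightarrow> 'm \<Rightarrow> 'm)
    \<Rightarrow> 'o list \<Rightarrow> 'o list \<Rightarrow> 'o list \<Rightarrow> ('o, 'm) marr \<Rightarrow> ('o, 'm) marr" where
  "MAT_trace C wand [] As Bs F = F"
| "MAT_trace C wand (X # Xs) As Bs F = MAT_trace C wand Xs As Bs (MAT_trace1 C wand F)"

definition MAT_block ::
  "('o, 'm) marr \<Rightarrow> ('o, 'm) marr \<Rightarrow> ('o, 'm) marr \<Rightarrow> ('o, 'm) marr \<Rightarrow> ('o, 'm) marr" where
  "MAT_block F G H K = MArr (mdom F @ mdom H) (mcod F @ mcod G)
     (four_block_mat (ment F) (ment G) (ment H) (ment K))"

definition MAT_wand ::
  "('o, 'm, 'z) rcategory_scheme \<Rightarrow> ('m \<Rightarrow> 'm \<Rightarrow> 'm)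
    \<Rightarrow> ('o, 'm) marr \<Rightarrow> ('o, 'm) marr \<Rightarrow> ('o, 'm) marr" where
  "MAT_wand C wand F G = MAT_trace C wand (mdom F) (mdom F) (mcod G) (MAT_block F G F G)"

definition MAT_embed_obj :: "'o \<Rightarrow> 'o list" where
  "MAT_embed_obj A = [A]"

definition MAT_embed :: "('o, 'm, 'z) rcategory_scheme \<Rightarrow> 'm \<Rightarrow> ('o, 'm) marr" where
  "MAT_embed C f = MArr [Dom C f] [Cod C f] (mat 1 1 (\<lambda>_. f))"

end

theory Submission
  imports Defs
begin

text \<open>
  Taking the trace over one object is a Gaussian elimination step: it replaces every entry
  \<open>F i j\<close> by \<open>F i j \<squnion> F i x (F x x \<circledast> F x j)\<close>.  The wand is additive in its second argument, so
  elimination acts linearly on rows and columns, which gives tightening and superposing.  The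
  diagonal and dinaturality laws of the wand show that eliminating \<open>x\<close> and eliminating \<open>y\<close> commute.
  Hence the order of elimination is irrelevant, and sliding follows by eliminating one auxiliary
  matrix in two orders.  Vanishing holds because the trace over a list is an iterated elimination.

  After \<open>x\<close> has been eliminated, row \<open>x\<close> contains \<open>F x x \<circledast> F x j\<close>; so the eliminated rows of
  \<open>[F G]\<close> form the matrix \<open>F \<circledast> G\<close>, and its laws follow from those of the trace.
\<close>

section \<open>Joins in restriction categories\<close>

text \<open>Joins exist only for pairwise disjoint families, so no identity between joins can be
  manipulated before disjointness is known. A join is therefore carried as a relation between a
  finite disjoint set and its least upper bound (\<open>disjoint_join\<close>), and two expressions
  are proved equal by exhibiting both as joins of one set. Passing from families to sets is
  harmless: a value taken at two indices of a disjoint family is disjoint from itself, hence zero,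
  and zero never affects a join. Distributivity is assumed only for composition on the left; the
  version on the right has to be derived.

  That two eliminations commute is a computation with paths: once \<open>x\<close> and
  \<open>y\<close> are eliminated, an entry is the join of the direct entry and of paths sorted by
  the pivot where they enter and the pivot where they leave, a description that does not mention the
  order. Elimination acts on functions over an arbitrary index type, so that shifting, duplicating
  or skipping rows and columns is mere reindexing; the recursion of the trace and the auxiliary
  matrices are handled in this way.\<close>

context category
begin

lemma hom_dom: "f \<in> Hom C A B \<Longrightarrow> A \<in> Obj C"
  using dom_obj by (auto simp: Hom_def)

lemma hom_cod: "f \<in> Hom C A B \<Longrightarrow> B \<in> Obj C"
  using cod_obj by (auto simp: Hom_def)

end

context restriction_category
begin

lemma rst_ident: "A \<in> Obj C \<Longrightarrow> Rst C (Ident C A) = Ident C A"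
  using rst_comp_self ident_hom ident_right rst_hom by metis

lemma rst_rst: "f \<in> Hom C A B \<Longrightarrow> Rst C (Rst C f) = Rst C f"
  using rst_rst_comp[of "Ident C A" A A f B] rst_ident ident_hom ident_right rst_hom hom_dom
  by metis

lemma rleI: "\<lbrakk>f \<in> Hom C A B; g \<in> Hom C A B; Rst C f \<Zsemi> g = f\<rbrakk> \<Longrightarrow> rle C f g"
  by (auto simp: rle_def Hom_def)

lemma rle_eq: "rle C f g \<Longrightarrow> Rst C f \<Zsemi> g = f"
  by (auto simp: rle_def)

lemma rle_hom_iff: "rle C f g \<Longrightarrow> f \<in> Hom C A B \<longleftrightarrow> g \<in> Hom C A B"
  by (auto simp: rle_def Hom_def)

lemma rle_refl: "f \<in> Hom C A B \<Longrightarrow> rle C f f"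
  by (auto intro: rleI rst_comp_self)

lemma rle_trans:
  assumes "rle C f g" "rle C g h" shows "rle C f h"
proof -
  obtain A B where f: "f \<in> Hom C A B" using assms by (auto simp: rle_def Hom_def)
  then have g: "g \<in> Hom C A B" and h: "h \<in> Hom C A B" using assms rle_hom_iff by blast+
  have "Rst C f = Rst C f \<Zsemi> Rst C g"
    using rle_eq[OF assms(1)] rst_rst_comp[OF g f] by simp
  then have "Rst C f \<Zsemi> h = Rst C f \<Zsemi> (Rst C g \<Zsemi> h)"
    using comp_assoc[OF rst_hom[OF f] rst_hom[OF g] h] by simp
  then show ?thesis using rle_eq[OF assms(1)] rle_eq[OF assms(2)] rleI[OF f h] by simp
qed

text \<open>Below \<open>g\<close> a map is determined by its restriction. This later upgrades an
  inequality between joins to an equality by comparing restrictions only.\<close>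

lemma rle_eq_if_rst_eq:
  assumes "rle C f g" "Rst C f = Rst C g" shows "f = g"
  using assms rst_comp_self by (auto simp: rle_def Hom_def)

lemma rle_antisym:
  assumes "rle C f g" "rle C g f" shows "f = g"
proof (rule rle_eq_if_rst_eq[OF assms(1)])
  obtain A B where f: "f \<in> Hom C A B" using assms by (auto simp: rle_def Hom_def)
  then have g: "g \<in> Hom C A B" using assms rle_hom_iff by blast
  have "Rst C f = Rst C f \<Zsemi> Rst C g" "Rst C g = Rst C g \<Zsemi> Rst C f"
    using rle_eq[OF assms(1)] rle_eq[OF assms(2)] rst_rst_comp[OF g f] rst_rst_comp[OF f g]
    by simp_all
  then show "Rst C f = Rst C g" using rst_commute[OF f g] by simp
qed

lemma rle_rst:
  assumes "rle C f g" shows "rle C (Rst C f) (Rst C g)"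
proof -
  obtain A B where f: "f \<in> Hom C A B" using assms by (auto simp: rle_def Hom_def)
  then have g: "g \<in> Hom C A B" using assms rle_hom_iff by blast
  show ?thesis
    using rle_eq[OF assms] rst_rst_comp[OF g f] rst_rst[OF f]
    by (intro rleI[OF rst_hom[OF f] rst_hom[OF g]]) simp
qed

lemma rle_comp_right:
  assumes "rle C f g" "f \<in> Hom C A B" "k \<in> Hom C B D" shows "rle C (f \<Zsemi> k) (g \<Zsemi> k)"
proof -
  note f = assms(2) and k = assms(3)
  have g: "g \<in> Hom C A B" using assms(1) f rle_hom_iff by blast
  have fk: "f \<Zsemi> k = Rst C f \<Zsemi> (g \<Zsemi> k)"
    using comp_assoc[OF rst_hom[OF f] g k] rle_eq[OF assms(1)] by simp
  have gk: "g \<Zsemi> k \<in> Hom C A D" using g k by (rule comp_hom)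
  have "Rst C (f \<Zsemi> k) \<Zsemi> (g \<Zsemi> k) = (Rst C f \<Zsemi> Rst C (g \<Zsemi> k)) \<Zsemi> (g \<Zsemi> k)"
    using fk rst_rst_comp[OF gk f] by simp
  also have "\<dots> = f \<Zsemi> k"
    using comp_assoc[OF rst_hom[OF f] rst_hom[OF gk] gk] rst_comp_self[OF gk] fk by simp
  finally show ?thesis using f gk k by (blast intro: rleI comp_hom)
qed

lemma rst_comp_rle: "\<lbrakk>f \<in> Hom C A B; g \<in> Hom C A D\<rbrakk> \<Longrightarrow> rle C (Rst C g \<Zsemi> f) f"
  by (rule rleI[of _ A B])
    (simp_all add: rst_rst_comp comp_hom[OF rst_hom] comp_assoc[OF rst_hom rst_hom] rst_comp_self)

text \<open>The endomaps below an identity are exactly the restriction idempotents, so anything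
  below a restriction idempotent is again one.\<close>

lemma rle_ident_iff:
  "e \<in> Hom C A A \<Longrightarrow> rle C e (Ident C A) \<longleftrightarrow> Rst C e = e"
  using ident_right[OF rst_hom, of e A A] rle_eq rleI ident_hom hom_dom by metis

lemma is_join_unique: "\<lbrakk>is_join C A B S j; is_join C A B S k\<rbrakk> \<Longrightarrow> j = k"
  by (auto simp: is_join_def intro!: rle_antisym)

lemma Join_eq: "is_join C A B S j \<Longrightarrow> Join C A B S = j"
  unfolding Join_def by (blast intro: is_join_unique)

lemma is_join_single: "f \<in> Hom C A B \<Longrightarrow> is_join C A B {f} f"
  by (auto simp: is_join_def rle_refl)

text \<open>Both sets have the same upper bounds among the parallel maps, and being a least upper
  bound depends on nothing else.\<close>

lemma is_join_flatten:
  assumes "\<And>i. i \<in> I \<Longrightarrow> is_join C A B (S i) (j i)"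
  shows "is_join C A B (\<Union>i\<in>I. S i) k \<longleftrightarrow> is_join C A B (j ` I) k"
proof -
  define U V where "U h \<longleftrightarrow> (\<forall>f \<in> (\<Union>i\<in>I. S i). rle C f h)" and "V h \<longleftrightarrow> (\<forall>f \<in> j ` I. rle C f h)" for h
  have "U h \<longleftrightarrow> V h" if h: "h \<in> Hom C A B" for h
  proof
    show "V h" if "U h"
      using that assms h unfolding U_def V_def is_join_def by blast
    show "U h" if V: "V h"
      unfolding U_def
    proof
      fix f assume "f \<in> (\<Union>i\<in>I. S i)"
      then obtain i where i: "i \<in> I" "f \<in> S i" by blast
      then have "rle C f (j i)" using assms unfolding is_join_def by blast
      moreover have "rle C (j i) h" using V i unfolding V_def by blast
      ultimately show "rle C f h" by (rule rle_trans)
    qed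
  qed
  then show ?thesis unfolding is_join_def U_def[symmetric] V_def[symmetric] by blast
qed

end

context restriction_category_with_zeroes
begin

lemma zero_rle: "f \<in> Hom C A B \<Longrightarrow> rle C (Zero C A B) f"
  by (rule rleI[of _ A B]) (auto simp: rst_zero zero_comp zero_hom hom_dom hom_cod)

lemma rle_zero: "\<lbrakk>rle C f (Zero C A B); A \<in> Obj C; B \<in> Obj C\<rbrakk> \<Longrightarrow> f = Zero C A B"
  using rle_antisym rle_hom_iff zero_hom zero_rle by blast

lemma is_join_empty: "\<lbrakk>A \<in> Obj C; B \<in> Obj C\<rbrakk> \<Longrightarrow> is_join C A B {} (Zero C A B)"
  by (auto simp: is_join_def zero_hom zero_rle)

text \<open>Zero lies below every parallel map and so never changes the upper bounds. Products with
  sparse matrices are evaluated by deleting their zero terms in this way.\<close>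

lemma is_join_remove_zeroes:
  assumes "S - {Zero C A B} = T - {Zero C A B}"
  shows "is_join C A B S j \<longleftrightarrow> is_join C A B T j"
proof -
  have "(\<forall>f \<in> S. rle C f h) \<longleftrightarrow> (\<forall>f \<in> T. rle C f h)" if "h \<in> Hom C A B" for h
    using assms zero_rle[OF that] by blast
  then show ?thesis by (auto simp: is_join_def)
qed

end

section \<open>Interference relations and joins of finite disjoint sets\<close>

context perp_restriction_category
begin

lemma perp_comp_right:
  assumes "perp f g" "f \<in> Hom C A B" "g \<in> Hom C A D" "k \<in> Hom C B B'" "k' \<in> Hom C D D'"
  shows "perp (f \<Zsemi> k) (g \<Zsemi> k')"
  using perp_comp[OF assms(1) ident_hom assms(2-5)] ident_left[OF assms(2)] ident_left[OF assms(3)]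
    hom_dom[OF assms(2)] by simp

lemma perp_comp_left:
  assumes "perp f g" "f \<in> Hom C A B" "g \<in> Hom C A D" "h \<in> Hom C E A"
  shows "perp (h \<Zsemi> f) (h \<Zsemi> g)"
  using perp_comp[OF assms(1,4,2,3) ident_hom ident_hom] ident_right comp_hom assms hom_cod by metis

lemma perp_comp1: "\<lbrakk>perp f g; f \<in> Hom C A B; g \<in> Hom C A D; k \<in> Hom C B B'\<rbrakk> \<Longrightarrow> perp (f \<Zsemi> k) g"
  using perp_comp_right[of f g A B D k B' "Ident C D" D] ident_hom ident_right hom_cod by metis

lemma perp_comp2: "\<lbrakk>perp f g; f \<in> Hom C A B; g \<in> Hom C A D; k \<in> Hom C D D'\<rbrakk> \<Longrightarrow> perp f (g \<Zsemi> k)"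
  using perp_comp1 perp_sym by blast

lemma perp_zero_right:
  assumes f: "f \<in> Hom C A B" and D: "D \<in> Obj C" shows "perp f (Zero C A D)"
  using perp_comp1[OF perp_ident_zero[OF hom_dom[OF f] D] ident_hom zero_hom f]
    ident_left[OF f] hom_dom[OF f] D by simp

lemma perp_zero_left: "\<lbrakk>f \<in> Hom C A B; D \<in> Obj C\<rbrakk> \<Longrightarrow> perp (Zero C A D) f"
  by (blast intro: perp_sym perp_zero_right)

text \<open>Since \<open>f = Rst C f \<Zsemi> f\<close>, closure under postcomposition reverses the
  axiom \<open>perp_rst\<close>.\<close>

lemma perp_rst_iff:
  assumes f: "f \<in> Hom C A B" and g: "g \<in> Hom C A D"
  shows "perp (Rst C f) (Rst C g) \<longleftrightarrow> perp f g"
  using perp_rst perp_comp_right[OF _ rst_hom[OF f] rst_hom[OF g] f g]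
    rst_comp_self[OF f] rst_comp_self[OF g] by auto

lemma perp_hom_rst1: "\<lbrakk>perp f g; f \<in> Hom C A B; g \<in> Hom C A D\<rbrakk> \<Longrightarrow> perp (Rst C f) g"
  using perp_rst_iff rst_hom rst_rst by metis

lemma perp_hom_rst2: "\<lbrakk>perp f g; f \<in> Hom C A B; g \<in> Hom C A D\<rbrakk> \<Longrightarrow> perp f (Rst C g)"
  using perp_hom_rst1 perp_sym by blast

text \<open>\<open>Rst C f \<Zsemi> Rst C g\<close> lies below both restrictions and is therefore
  disjoint from itself, which forces it to be zero. This is what kills the cross terms when a row of
  a matrix is composed with restrictions of its other entries.\<close>

lemma perp_rst_comp_zero:
  assumes "perp f g" and f: "f \<in> Hom C A B" and g: "g \<in> Hom C A D"
  shows "Rst C f \<Zsemi> g = Zero C A D"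
proof -
  have 1: "rle C (Rst C f \<Zsemi> g) g" using rst_comp_rle f g by blast
  have "rle C (Rst C f \<Zsemi> Rst C g) (Rst C f)"
    using rst_comp_rle[OF rst_hom[OF f] g] rst_commute[OF f g] by simp
  moreover have "rle C (Rst C f \<Zsemi> Rst C g) (Rst C g)"
    using rst_comp_rle[OF rst_hom[OF g] f] by simp
  ultimately have "perp (Rst C f \<Zsemi> Rst C g) (Rst C f \<Zsemi> Rst C g)"
    using perp_rst[OF assms(1)] perp_down by blast
  then have "Rst C f \<Zsemi> Rst C g = Zero C A A"
    using perp_self comp_hom[OF rst_hom[OF f] rst_hom[OF g]] by (fastforce simp: Hom_def)
  then have "Rst C f \<Zsemi> g = Zero C A A \<Zsemi> g"
    using comp_assoc[OF rst_hom[OF f] rst_hom[OF g] g] rst_comp_self[OF g] by simp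
  then show ?thesis using zero_comp[OF g] hom_dom[OF f] by simp
qed

definition disjoint_join :: "'o \<Rightarrow> 'o \<Rightarrow> 'm set \<Rightarrow> 'm \<Rightarrow> bool" where
  "disjoint_join A B S j \<longleftrightarrow> finite S \<and> S \<subseteq> Hom C A B \<and> pairwise perp S \<and> is_join C A B S j"

lemma disjoint_join_hom: "disjoint_join A B S j \<Longrightarrow> j \<in> Hom C A B"
  by (simp add: disjoint_join_def is_join_def)

lemma disjoint_join_rle: "disjoint_join A B S j \<Longrightarrow> f \<in> S \<Longrightarrow> rle C f j"
  by (simp add: disjoint_join_def is_join_def)

lemma disjoint_join_unique: "\<lbrakk>disjoint_join A B S j; disjoint_join A B S k\<rbrakk> \<Longrightarrow> j = k"
  using is_join_unique by (auto simp: disjoint_join_def)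

lemma disjoint_join_Join: "disjoint_join A B S j \<Longrightarrow> Join C A B S = j"
  using Join_eq by (auto simp: disjoint_join_def)

lemma disjoint_join_single: "f \<in> Hom C A B \<Longrightarrow> disjoint_join A B {f} f"
  by (auto simp: disjoint_join_def is_join_single pairwise_def)

end

section \<open>Distributivity, restriction and strength of disjoint joins\<close>

context finitely_disjoint_perp_restriction_category
begin

text \<open>The join axioms speak of families indexed by an initial segment of the naturals. An
  injective enumeration turns disjointness of distinct members into disjointness at distinct
  indices, so the axioms transfer to finite sets.\<close>

lemma disjoint_set_family:
  assumes "finite S" "S \<subseteq> Hom C A B" "pairwise perp S" "A \<in> Obj C" "B \<in> Obj C"
  obtains n f where "disjoint_family_in C perp A B n f" "S = f ` {..<n}"
proof -
  obtain f where f: "bij_betw f {..<card S} S"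
    using assms(1) ex_bij_betw_nat_finite by (metis atLeast0LessThan)
  have "disjoint_family_in C perp A B (card S) f"
    using f assms unfolding disjoint_family_in_def pairwise_def bij_betw_def inj_on_def by blast
  then show thesis using that f by (metis bij_betw_imp_surj_on)
qed

lemma disjoint_join_exists:
  assumes "finite S" "S \<subseteq> Hom C A B" "pairwise perp S" "A \<in> Obj C" "B \<in> Obj C"
  shows "disjoint_join A B S (Join C A B S)"
  using assms join_exists Join_eq disjoint_set_family[OF assms]
  unfolding disjoint_join_def by metis

lemma disjoint_join_comp_left:
  assumes S: "disjoint_join A B S j" and h: "h \<in> Hom C D A"
  shows "disjoint_join D B ((\<lambda>f. h \<Zsemi> f) ` S) (h \<Zsemi> j)"
proof -
  have S': "finite S" "S \<subseteq> Hom C A B" "pairwise perp S" "A \<in> Obj C" "B \<in> Obj C"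
    using S hom_dom hom_cod unfolding disjoint_join_def is_join_def by blast+
  obtain n f where f: "disjoint_family_in C perp A B n f" "S = f ` {..<n}"
    using disjoint_set_family[OF S'] .
  have "disjoint_join D B ((\<lambda>f. h \<Zsemi> f) ` S) (Join C D B ((\<lambda>f. h \<Zsemi> f) ` S))"
  proof (rule disjoint_join_exists)
    show "pairwise perp ((\<lambda>f. h \<Zsemi> f) ` S)"
      using S'(2,3) perp_comp_left[OF _ _ _ h] unfolding pairwise_image unfolding pairwise_def
      by (meson subsetD)
  qed (use S' h comp_hom hom_dom in auto)
  then show ?thesis
    using comp_join[OF f(1) h] f(2) disjoint_join_Join[OF S] by (simp add: image_image)
qed

lemma disjoint_join_strong:
  assumes S: "disjoint_join A B S j" and h: "h \<in> Hom C A D" and "\<And>f. f \<in> S \<Longrightarrow> perp f h"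
  shows "perp j h"
proof -
  have S': "finite S" "S \<subseteq> Hom C A B" "pairwise perp S" "A \<in> Obj C" "B \<in> Obj C"
    using S hom_dom hom_cod unfolding disjoint_join_def is_join_def by blast+
  obtain n f where f: "disjoint_family_in C perp A B n f" "S = f ` {..<n}"
    using disjoint_set_family[OF S'] .
  then show ?thesis
    using join_strong[OF f(1) h] disjoint_join_Join[OF S] assms(3) by auto
qed

text \<open>The join \<open>e\<close> of the restrictions lies below \<open>Rst C j\<close>.
  Conversely each member is \<open>Rst C f \<Zsemi> j\<close> and so lies below
  \<open>e \<Zsemi> j\<close>; hence \<open>j\<close> lies below \<open>e \<Zsemi> j\<close>, and
  taking restrictions puts \<open>Rst C j\<close> below \<open>e\<close>.\<close>

lemma disjoint_join_rst:
  assumes S: "disjoint_join A B S j"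
  shows "disjoint_join A A (Rst C ` S) (Rst C j)"
proof -
  have S': "finite S" "S \<subseteq> Hom C A B" "pairwise perp S" and j: "j \<in> Hom C A B"
    and A: "A \<in> Obj C"
    using S hom_dom unfolding disjoint_join_def is_join_def by blast+
  define e where "e = Join C A A (Rst C ` S)"
  have e: "disjoint_join A A (Rst C ` S) e" unfolding e_def
  proof (rule disjoint_join_exists)
    show "pairwise perp (Rst C ` S)"
      using S'(3) perp_rst unfolding pairwise_image unfolding pairwise_def by blast
  qed (use S' A rst_hom in auto)
  have eh: "e \<in> Hom C A A" using e by (rule disjoint_join_hom)
  have le: "rle C e (Rst C j)"
    using e disjoint_join_rle[OF S] rle_rst rst_hom[OF j]
    unfolding disjoint_join_def is_join_def by auto
  \<comment> \<open>Being below an identity makes \<open>e\<close> a restriction idempotent, which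
    is what allows the restriction of \<open>e \<Zsemi> j\<close> to be computed.\<close>
  have "rle C (Rst C j) (Ident C A)"
    using rle_ident_iff[OF rst_hom[OF j]] rst_rst[OF j] by simp
  then have re: "Rst C e = e" using rle_trans[OF le] rle_ident_iff[OF eh] by simp
  have "rle C f (e \<Zsemi> j)" if "f \<in> S" for f
  proof -
    have f: "f \<in> Hom C A B" using that S' by blast
    have "rle C (Rst C f \<Zsemi> j) (e \<Zsemi> j)"
      using rle_comp_right[OF disjoint_join_rle[OF e] rst_hom[OF f] j] that by blast
    then show ?thesis using rle_eq[OF disjoint_join_rle[OF S that]] by simp
  qed
  then have "rle C j (e \<Zsemi> j)"
    using S comp_hom[OF eh j] unfolding disjoint_join_def is_join_def by blast
  then have "rle C (Rst C j) (e \<Zsemi> Rst C j)"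
    using rle_rst[of j "e \<Zsemi> j"] rst_rst_comp[OF j eh] re by simp
  moreover have "rle C (e \<Zsemi> Rst C j) e"
    using rst_comp_rle[OF eh j] rst_commute[OF eh j] re by simp
  ultimately have "e = Rst C j" using le rle_antisym rle_trans by blast
  then show ?thesis using e by simp
qed

text \<open>The join \<open>z\<close> of the composites lies below \<open>j \<Zsemi> k\<close>, so
  equality of restrictions is enough. For that, \<open>Rst C (j \<Zsemi> k)\<close> is composed with
  the join of the restrictions of the members: by left distributivity this gives the join of the
  restrictions of the composites.\<close>

lemma disjoint_join_comp_right:
  assumes S: "disjoint_join A B S j" and k: "k \<in> Hom C B D"
  shows "disjoint_join A D ((\<lambda>f. f \<Zsemi> k) ` S) (j \<Zsemi> k)"
proof -
  let ?T = "(\<lambda>f. f \<Zsemi> k) ` S"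
  have S': "finite S" "S \<subseteq> Hom C A B" "pairwise perp S" and j: "j \<in> Hom C A B"
    and A: "A \<in> Obj C"
    using S hom_dom unfolding disjoint_join_def is_join_def by blast+
  have jk: "j \<Zsemi> k \<in> Hom C A D" using j k by (rule comp_hom)
  define z where "z = Join C A D ?T"
  have z: "disjoint_join A D ?T z" unfolding z_def
  proof (rule disjoint_join_exists)
    show "pairwise perp ?T"
      using S'(2,3) perp_comp_right[OF _ _ _ k k] unfolding pairwise_image unfolding pairwise_def
      by (meson subsetD)
  qed (use S' A k comp_hom hom_cod in auto)
  have "rle C (f \<Zsemi> k) (j \<Zsemi> k)" if "f \<in> S" for f
    using rle_comp_right[OF disjoint_join_rle[OF S that] _ k] that S'(2) by blast
  then have le: "rle C z (j \<Zsemi> k)"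
    using z jk unfolding disjoint_join_def is_join_def by blast
  have "Rst C (j \<Zsemi> k) \<Zsemi> Rst C f = Rst C (f \<Zsemi> k)" if "f \<in> S" for f
  proof -
    have f: "f \<in> Hom C A B" using that S' by blast
    have "Rst C (j \<Zsemi> k) \<Zsemi> Rst C f = Rst C (Rst C f \<Zsemi> (j \<Zsemi> k))"
      using rst_commute[OF jk f] rst_rst_comp[OF jk f] by simp
    also have "Rst C f \<Zsemi> (j \<Zsemi> k) = f \<Zsemi> k"
      using comp_assoc[OF rst_hom[OF f] j k] rle_eq[OF disjoint_join_rle[OF S that]] by simp
    finally show ?thesis .
  qed
  then have im: "(\<lambda>f. Rst C (j \<Zsemi> k) \<Zsemi> f) ` Rst C ` S = Rst C ` ?T"
    by (auto simp: image_image)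
  have "Rst C j \<Zsemi> (j \<Zsemi> k) = j \<Zsemi> k"
    using comp_assoc[OF rst_hom[OF j] j k] rst_comp_self[OF j] by simp
  then have "Rst C (j \<Zsemi> k) \<Zsemi> Rst C j = Rst C (j \<Zsemi> k)"
    using rst_rst_comp[OF jk j] rst_commute[OF jk j] by simp
  then have "disjoint_join A A (Rst C ` ?T) (Rst C (j \<Zsemi> k))"
    using disjoint_join_comp_left[OF disjoint_join_rst[OF S] rst_hom[OF jk]] im by simp
  then have "Rst C z = Rst C (j \<Zsemi> k)"
    using disjoint_join_rst[OF z] disjoint_join_unique by blast
  then show ?thesis using rle_eq_if_rst_eq[OF le] z by simp
qed

text \<open>Members of different blocks lie below the disjoint maps \<open>f i\<close> and
  \<open>f k\<close>, hence are disjoint by downward closure, and the flattened set is again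
  disjoint.\<close>

lemma disjoint_join_UN:
  assumes "finite I" "A \<in> Obj C" "B \<in> Obj C"
    and S: "\<And>i. i \<in> I \<Longrightarrow> disjoint_join A B (S i) (f i)"
    and f: "\<And>i k. \<lbrakk>i \<in> I; k \<in> I; i \<noteq> k\<rbrakk> \<Longrightarrow> perp (f i) (f k)"
  shows "disjoint_join A B (\<Union>i\<in>I. S i) (Join C A B (f ` I))"
proof -
  have "is_join C A B (f ` I) (Join C A B (f ` I))"
  proof -
    have "pairwise perp (f ` I)" using f unfolding pairwise_def by blast
    moreover have "f ` I \<subseteq> Hom C A B" using disjoint_join_hom[OF S] by blast
    ultimately show ?thesis
      using disjoint_join_exists[of "f ` I" A B] assms(1-3) unfolding disjoint_join_def by blast
  qed
  then have "is_join C A B (\<Union>i\<in>I. S i) (Join C A B (f ` I))"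
    using is_join_flatten[of I A B S f] S unfolding disjoint_join_def by blast
  moreover have "perp a b" if "i \<in> I" "k \<in> I" "a \<in> S i" "b \<in> S k" "a \<noteq> b" for i k a b
  proof (cases "i = k")
    case True
    then show ?thesis using S that unfolding disjoint_join_def pairwise_def by blast
  next
    case False
    then show ?thesis using perp_down f disjoint_join_rle[OF S] that by blast
  qed
  ultimately show ?thesis
    using S \<open>finite I\<close> unfolding disjoint_join_def pairwise_def by blast
qed

lemma disjoint_join_bjoin:
  assumes S: "disjoint_join A B S f" and T: "disjoint_join A B T g" and "perp f g"
  shows "disjoint_join A B (S \<union> T) (bjoin C f g)"
proof -
  have f: "f \<in> Hom C A B" using S by (rule disjoint_join_hom)
  \<comment> \<open>The binary case is the indexed one over \<open>bool\<close>.\<close>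
  have "disjoint_join A B (\<Union>b\<in>UNIV. if b then S else T)
      (Join C A B ((\<lambda>b. if b then f else g) ` UNIV))"
    using assms f hom_dom hom_cod perp_sym by (intro disjoint_join_UN) (auto split: if_splits)
  then show ?thesis using f by (simp add: UNIV_bool bjoin_def Hom_def Un_commute insert_commute)
qed

section \<open>Joins of families over an arbitrary finite index set\<close>

definition perp_family :: "'o \<Rightarrow> 'o \<Rightarrow> 'i set \<Rightarrow> ('i \<Rightarrow> 'm) \<Rightarrow> bool" where
  "perp_family A B I f \<longleftrightarrow> A \<in> Obj C \<and> B \<in> Obj C \<and> finite I \<and> (\<forall>i\<in>I. f i \<in> Hom C A B) \<and>
     (\<forall>i\<in>I. \<forall>k\<in>I. i \<noteq> k \<longrightarrow> perp (f i) (f k))"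

lemma perp_familyI:
  assumes "A \<in> Obj C" "B \<in> Obj C" "finite I" "\<And>i. i \<in> I \<Longrightarrow> f i \<in> Hom C A B"
    "\<And>i k. \<lbrakk>i \<in> I; k \<in> I; i \<noteq> k\<rbrakk> \<Longrightarrow> perp (f i) (f k)"
  shows "perp_family A B I f"
  using assms by (auto simp: perp_family_def)

lemma perp_family_Join:
  assumes "perp_family A B I f" shows "disjoint_join A B (f ` I) (Join C A B (f ` I))"
  using assms unfolding perp_family_def by (intro disjoint_join_exists) (auto simp: pairwise_def)

lemma Join_hom: "perp_family A B I f \<Longrightarrow> Join C A B (f ` I) \<in> Hom C A B"
  using perp_family_Join disjoint_join_hom by blast

lemma comp_Join:
  assumes "perp_family A B I f" "h \<in> Hom C D A"
  shows "h \<Zsemi> Join C A B (f ` I) = Join C D B ((\<lambda>i. h \<Zsemi> f i) ` I)"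
  using disjoint_join_Join[OF disjoint_join_comp_left[OF perp_family_Join[OF assms(1)] assms(2)]]
      by (simp add: image_image)

lemma Join_comp:
  assumes "perp_family A B I f" "k \<in> Hom C B D"
  shows "Join C A B (f ` I) \<Zsemi> k = Join C A D ((\<lambda>i. f i \<Zsemi> k) ` I)"
  using disjoint_join_Join[OF disjoint_join_comp_right[OF perp_family_Join[OF assms(1)] assms(2)]]
      by (simp add: image_image)

lemma rst_Join:
  assumes "perp_family A B I f"
  shows "Rst C (Join C A B (f ` I)) = Join C A A ((\<lambda>i. Rst C (f i)) ` I)"
  using disjoint_join_Join[OF disjoint_join_rst[OF perp_family_Join[OF assms]]] by (simp add: image_image)

lemma perp_family_comp_left: "\<lbrakk>perp_family A B I f; h \<in> Hom C D A\<rbrakk> \<Longrightarrow> perp_family D B I (\<lambda>i. h \<Zsemi> f i)"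
  by (rule perp_familyI) (auto simp: perp_family_def intro: comp_hom perp_comp_left hom_dom)

lemma perp_family_comp_right: "\<lbrakk>perp_family A B I f; k \<in> Hom C B D\<rbrakk> \<Longrightarrow> perp_family A D I (\<lambda>i. f i \<Zsemi> k)"
  by (rule perp_familyI) (auto simp: perp_family_def intro: comp_hom perp_comp_right hom_cod)

lemma perp_family_rst: "perp_family A B I f \<Longrightarrow> perp_family A A I (\<lambda>i. Rst C (f i))"
  unfolding perp_family_def using rst_hom perp_rst by blast

lemma perp_Join_left:
  "\<lbrakk>perp_family A B I f; h \<in> Hom C A D; \<And>i. i \<in> I \<Longrightarrow> perp (f i) h\<rbrakk> \<Longrightarrow> perp (Join C A B (f ` I)) h"
  using disjoint_join_strong[OF perp_family_Join] by blast

lemma perp_Join_Join: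
  assumes "perp_family A B I f" "perp_family A D K g" "\<And>i k. \<lbrakk>i \<in> I; k \<in> K\<rbrakk> \<Longrightarrow> perp (f i) (g k)"
  shows "perp (Join C A B (f ` I)) (Join C A D (g ` K))"
proof -
  have "perp (Join C A D (g ` K)) (f i)" if "i \<in> I" for i
    using assms that perp_sym by (intro perp_Join_left[OF assms(2)]) (auto simp: perp_family_def)
  then show ?thesis
    using perp_sym by (intro perp_Join_left[OF assms(1) Join_hom[OF assms(2)]]) blast
qed

lemma Join_rle: "\<lbrakk>perp_family A B I f; i \<in> I\<rbrakk> \<Longrightarrow> rle C (f i) (Join C A B (f ` I))"
  using disjoint_join_rle[OF perp_family_Join] by blast

lemma Join_Join:
  assumes "perp_family A B I (\<lambda>i. Join C A B (f i ` K i))" "\<And>i. i \<in> I \<Longrightarrow> perp_family A B (K i) (f i)"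
  shows "Join C A B ((\<lambda>i. Join C A B (f i ` K i)) ` I) = Join C A B (\<Union>i\<in>I. f i ` K i)"
proof -
  have "disjoint_join A B (\<Union>i\<in>I. f i ` K i) (Join C A B ((\<lambda>i. Join C A B (f i ` K i)) ` I))"
    using assms(1) unfolding perp_family_def
    by (intro disjoint_join_UN perp_family_Join[OF assms(2)]) auto
  then show ?thesis by (simp add: disjoint_join_Join)
qed

text \<open>Deleting zeroes leaves at most one term. Products with identity, injection and diagonal
  matrices are evaluated by this.\<close>

lemma Join_delta:
  assumes "i \<in> I" "f i \<in> Hom C A B" "\<And>k. \<lbrakk>k \<in> I; k \<noteq> i\<rbrakk> \<Longrightarrow> f k = Zero C A B"
  shows "Join C A B (f ` I) = f i"
proof -
  have "f ` I \<subseteq> {f i, Zero C A B}"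
    by (intro image_subsetI) (metis assms(3) insertI1 insertI2)
  then have "f ` I - {Zero C A B} = {f i} - {Zero C A B}" using assms(1) by blast
  then show ?thesis
    using is_join_remove_zeroes[of "f ` I" A B "{f i}" "f i"] is_join_single[OF assms(2)]
    by (intro Join_eq) simp
qed

lemma Join_all_zero:
  assumes "A \<in> Obj C" "B \<in> Obj C" "\<And>i. i \<in> I \<Longrightarrow> f i = Zero C A B"
  shows "Join C A B (f ` I) = Zero C A B"
proof -
  have "f ` I - {Zero C A B} = {} - {Zero C A B}" using assms(3) by blast
  then show ?thesis
    using is_join_remove_zeroes[of "f ` I" A B "{}"] is_join_empty[OF assms(1,2)]
    by (intro Join_eq) simp
qed

lemma Join_cong_zeroes:
  assumes "disjoint_join A B S j" "S - {Zero C A B} = T - {Zero C A B}"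
  shows "Join C A B T = j"
  using is_join_remove_zeroes[OF assms(2)] assms(1) unfolding disjoint_join_def
  by (intro Join_eq) simp

lemma Join_support:
  assumes "perp_family A B I f" "K \<subseteq> I" "\<And>i. i \<in> I - K \<Longrightarrow> f i = Zero C A B"
  shows "Join C A B (f ` I) = Join C A B (f ` K)"
proof -
  have "f ` I - {Zero C A B} = f ` K - {Zero C A B}" using assms(2,3) by blast
  from Join_cong_zeroes[OF perp_family_Join[OF assms(1)] this] show ?thesis by (rule sym)
qed

lemma perp_family_subset: "\<lbrakk>perp_family A B I f; K \<subseteq> I\<rbrakk> \<Longrightarrow> perp_family A B K f"
  unfolding perp_family_def using finite_subset by blast

section \<open>Binary joins\<close>

lemma bjoin_hom: "\<lbrakk>f \<in> Hom C A B; g \<in> Hom C A B; perp f g\<rbrakk> \<Longrightarrow> bjoin C f g \<in> Hom C A B"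
  using disjoint_join_bjoin disjoint_join_single disjoint_join_hom by blast

lemma bjoin_rle1: "\<lbrakk>f \<in> Hom C A B; g \<in> Hom C A B; perp f g\<rbrakk> \<Longrightarrow> rle C f (bjoin C f g)"
  using disjoint_join_rle[OF disjoint_join_bjoin[OF disjoint_join_single disjoint_join_single]] by blast

lemma bjoin_rle2: "\<lbrakk>f \<in> Hom C A B; g \<in> Hom C A B; perp f g\<rbrakk> \<Longrightarrow> rle C g (bjoin C f g)"
  using disjoint_join_rle[OF disjoint_join_bjoin[OF disjoint_join_single disjoint_join_single]] by blast

lemma perp_bjoin_left:
  assumes "f \<in> Hom C A B" "g \<in> Hom C A B" "perp f g" "h \<in> Hom C A D" "perp f h" "perp g h"
  shows "perp (bjoin C f g) h"
  using disjoint_join_strong[OF disjoint_join_bjoin[OF disjoint_join_single disjoint_join_single]]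
    assms by blast

lemma perp_bjoin_right:
  assumes "f \<in> Hom C A B" "g \<in> Hom C A B" "perp f g" "h \<in> Hom C A D" "perp h f" "perp h g"
  shows "perp h (bjoin C f g)"
  using perp_bjoin_left[OF assms(1-4)] assms(5,6) perp_sym by blast

lemma bjoin_zero_right:
  assumes "f \<in> Hom C A B" shows "bjoin C f (Zero C A B) = f"
  using is_join_remove_zeroes[of "{f, Zero C A B}" A B "{f}" f] is_join_single[OF assms] Join_eq assms
  by (auto simp: bjoin_def Hom_def)

lemma bjoin_zero_left:
  assumes "f \<in> Hom C A B" shows "bjoin C (Zero C A B) f = f"
  using is_join_remove_zeroes[of "{Zero C A B, f}" A B "{f}" f] is_join_single[OF assms] Join_eq
    zero_hom[OF hom_dom[OF assms] hom_cod[OF assms]]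
  by (auto simp: bjoin_def Hom_def)

lemma bjoin_eqI: "disjoint_join A B {f, g} j \<Longrightarrow> bjoin C f g = j"
  using disjoint_join_Join[of A B "{f, g}" j] by (auto simp: bjoin_def disjoint_join_def Hom_def)

lemma disjoint_join_pair:
  "\<lbrakk>f \<in> Hom C A B; g \<in> Hom C A B; perp f g\<rbrakk> \<Longrightarrow> disjoint_join A B {f, g} (bjoin C f g)"
  using disjoint_join_bjoin[OF disjoint_join_single disjoint_join_single, of f A B g]
      by (simp add: insert_commute)

lemma comp_bjoin:
  assumes "f \<in> Hom C A B" "g \<in> Hom C A B" "perp f g" "h \<in> Hom C D A"
  shows "h \<Zsemi> bjoin C f g = bjoin C (h \<Zsemi> f) (h \<Zsemi> g)"
  using disjoint_join_comp_left[OF disjoint_join_pair[OF assms(1-3)] assms(4)]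
  by (simp add: bjoin_eqI)

lemma bjoin_comp:
  assumes "f \<in> Hom C A B" "g \<in> Hom C A B" "perp f g" "k \<in> Hom C B D"
  shows "bjoin C f g \<Zsemi> k = bjoin C (f \<Zsemi> k) (g \<Zsemi> k)"
  using disjoint_join_comp_right[OF disjoint_join_pair[OF assms(1-3)] assms(4)]
  by (simp add: bjoin_eqI)

lemma perp_bjoin_bjoin:
  assumes "f \<in> Hom C A B" "g \<in> Hom C A B" "perp f g" "f' \<in> Hom C A D" "g' \<in> Hom C A D" "perp f' g'"
    and "perp f f'" "perp f g'" "perp g f'" "perp g g'"
  shows "perp (bjoin C f g) (bjoin C f' g')"
  using assms by (intro perp_bjoin_left[OF assms(1-3) bjoin_hom] perp_bjoin_right)

text \<open>Both sides are joins of the union of the two images, grouped by family on the left and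
  by index on the right.\<close>

lemma Join_bjoin:
  assumes f: "perp_family A B I f" and g: "perp_family A B I g"
    and fg: "\<And>i k. \<lbrakk>i \<in> I; k \<in> I\<rbrakk> \<Longrightarrow> perp (f i) (g k)"
  shows "bjoin C (Join C A B (f ` I)) (Join C A B (g ` I)) = Join C A B ((\<lambda>i. bjoin C (f i) (g i)) ` I)"
    and "perp_family A B I (\<lambda>i. bjoin C (f i) (g i))"
proof -
  have h: "f i \<in> Hom C A B" "g i \<in> Hom C A B" if "i \<in> I" for i
    using f g that by (auto simp: perp_family_def)
  have p: "perp (f i) (f k)" "perp (g i) (g k)" if "i \<in> I" "k \<in> I" "i \<noteq> k" for i k
    using f g that by (auto simp: perp_family_def)
  show d: "perp_family A B I (\<lambda>i. bjoin C (f i) (g i))"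
  proof (rule perp_familyI)
    fix i k assume ik: "i \<in> I" "k \<in> I" "i \<noteq> k"
    show "perp (bjoin C (f i) (g i)) (bjoin C (f k) (g k))"
      using ik h p[OF ik] fg perp_sym by (blast intro: perp_bjoin_bjoin)
  qed (use f h fg bjoin_hom in \<open>auto simp: perp_family_def\<close>)
  have "disjoint_join A B (f ` I \<union> g ` I) (bjoin C (Join C A B (f ` I)) (Join C A B (g ` I)))"
    by (intro disjoint_join_bjoin perp_family_Join f g perp_Join_Join fg)
  moreover have "disjoint_join A B (\<Union>i\<in>I. {f i, g i}) (Join C A B ((\<lambda>i. bjoin C (f i) (g i)) ` I))"
    using d h fg by (intro disjoint_join_UN disjoint_join_pair) (auto simp: perp_family_def)
  moreover have "(\<Union>i\<in>I. {f i, g i}) = f ` I \<union> g ` I" by auto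
  ultimately show "bjoin C (Join C A B (f ` I)) (Join C A B (g ` I)) =
      Join C A B ((\<lambda>i. bjoin C (f i) (g i)) ` I)"
    by (metis disjoint_join_unique)
qed

lemma Join_insert:
  assumes f: "perp_family A B (insert i I) f" "i \<notin> I"
  shows "Join C A B (f ` insert i I) = bjoin C (f i) (Join C A B (f ` I))"
proof -
  have I: "perp_family A B I f" using f perp_family_subset by blast
  have "perp (f i) (Join C A B (f ` I))"
    using f by (intro perp_sym[OF perp_Join_left[OF I]]) (auto simp: perp_family_def)
  then have "disjoint_join A B ({f i} \<union> f ` I) (bjoin C (f i) (Join C A B (f ` I)))"
    using f by (intro disjoint_join_bjoin perp_family_Join[OF I] disjoint_join_single) (auto simp:
        perp_family_def)
  then show ?thesis by (simp add: disjoint_join_Join)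
qed

text \<open>Both sides join the set of all four maps. The grouping is the one needed in
  \<open>eliminates_solution\<close>, where \<open>l\<close> and \<open>n\<close> factor through the
  same pivot entry.\<close>

lemma bjoin_rearrange:
  assumes h: "k \<in> Hom C A B" "l \<in> Hom C A B" "m \<in> Hom C A B" "n \<in> Hom C A B"
    and p: "perp k l" "perp k m" "perp k n" "perp l m" "perp l n" "perp m n"
  shows "bjoin C (bjoin C k l) (bjoin C m n) = bjoin C k (bjoin C (bjoin C l n) m)"
proof -
  have nm: "perp n m" and lm: "perp m l" using p perp_sym by blast+
  have "disjoint_join A B ({k, l} \<union> {m, n}) (bjoin C (bjoin C k l) (bjoin C m n))"
    by (rule disjoint_join_bjoin[OF disjoint_join_pair[OF h(1,2) p(1)] disjoint_join_pair[OF h(3,4) p(6)]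
          perp_bjoin_bjoin[OF h(1,2) p(1) h(3,4) p(6) p(2-5)]])
  moreover have "disjoint_join A B ({k} \<union> ({l, n} \<union> {m})) (bjoin C k (bjoin C (bjoin C l n) m))"
  proof (intro disjoint_join_bjoin disjoint_join_single disjoint_join_pair h p)
    show ln: "perp (bjoin C l n) m" by (rule perp_bjoin_left[OF h(2,4) p(5) h(3) p(4) nm])
    show "perp k (bjoin C (bjoin C l n) m)"
      by (rule perp_bjoin_right[OF bjoin_hom[OF h(2,4) p(5)] h(3) ln h(1)
            perp_bjoin_right[OF h(2,4) p(5) h(1) p(1,3)] p(2)])
  qed
  moreover have "{k, l} \<union> {m, n} = {k} \<union> ({l, n} \<union> {m})" by blast
  ultimately show ?thesis by (metis disjoint_join_unique)
qed

text \<open>Rows and columns have separate index sets because elimination discards the pivot column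
  but keeps the pivot row. \<open>R\<close> and \<open>Q\<close> label rows and columns by
  objects.\<close>

definition row_disjoint ::
  "('i \<Rightarrow> 'o) \<Rightarrow> ('j \<Rightarrow> 'o) \<Rightarrow> 'i set \<Rightarrow> 'j set \<Rightarrow> ('i \<Rightarrow> 'j \<Rightarrow> 'm) \<Rightarrow> bool" where
  "row_disjoint R Q I J F \<longleftrightarrow> (\<forall>i\<in>I. \<forall>j\<in>J. F i j \<in> Hom C (R i) (Q j)) \<and>
     (\<forall>i\<in>I. \<forall>j\<in>J. \<forall>j'\<in>J. j \<noteq> j' \<longrightarrow> perp (F i j) (F i j'))"

lemma row_disjoint_hom: "\<lbrakk>row_disjoint R Q I J F; i \<in> I; j \<in> J\<rbrakk> \<Longrightarrow> F i j \<in> Hom C (R i) (Q j)"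
  by (auto simp: row_disjoint_def)

lemma row_disjoint_perp:
  "\<lbrakk>row_disjoint R Q I J F; i \<in> I; j \<in> J; j' \<in> J; j \<noteq> j'\<rbrakk> \<Longrightarrow> perp (F i j) (F i j')"
  by (auto simp: row_disjoint_def)

lemma row_disjoint_subset:
  "\<lbrakk>row_disjoint R Q I J F; I' \<subseteq> I; J' \<subseteq> J\<rbrakk> \<Longrightarrow> row_disjoint R Q I' J' F"
  unfolding row_disjoint_def by blast

lemma perp_family_row:
  assumes F: "row_disjoint R Q I J F" and i: "i \<in> I" and T: "T \<subseteq> J" "finite T"
    and W: "\<And>y. y \<in> T \<Longrightarrow> W y \<in> Hom C (Q y) B" and B: "B \<in> Obj C" "R i \<in> Obj C"
  shows "perp_family (R i) B T (\<lambda>y. F i y \<Zsemi> W y)"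
proof (rule perp_familyI)
  fix y z assume "y \<in> T" "z \<in> T" "y \<noteq> z"
  then show "perp (F i y \<Zsemi> W y) (F i z \<Zsemi> W z)"
    using T perp_comp_right[OF row_disjoint_perp[OF F i] row_disjoint_hom[OF F i] row_disjoint_hom[OF F i] W
        W]
    by blast
qed (use T B comp_hom[OF row_disjoint_hom[OF F i] W] in auto)

text \<open>An entry outside the columns \<open>T\<close> is disjoint from every term of the
  product, hence from their join, because joins are strong.\<close>

lemma perp_row_Join:
  assumes F: "row_disjoint R Q I J F" and i: "i \<in> I" and T: "T \<subseteq> J" "finite T"
    and W: "\<And>y. y \<in> T \<Longrightarrow> W y \<in> Hom C (Q y) B" and B: "B \<in> Obj C"
    and z: "z \<in> J" "z \<notin> T"
  shows "perp (F i z) (Join C (R i) B ((\<lambda>y. F i y \<Zsemi> W y) ` T))"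
proof -
  have zh: "F i z \<in> Hom C (R i) (Q z)" using row_disjoint_hom[OF F i z(1)] .
  have "perp (F i y \<Zsemi> W y) (F i z)" if "y \<in> T" for y
    using that T z perp_comp1[OF row_disjoint_perp[OF F i] row_disjoint_hom[OF F i] zh W] by blast
  then show ?thesis
    using perp_sym[OF perp_Join_left[OF perp_family_row[OF F i T W B hom_dom[OF zh]] zh]] by blast
qed

end

section \<open>Kleene wands and elimination\<close>

locale finitely_disjoint_itegory =
  finitely_disjoint_perp_restriction_category C perp + perp_itegory C perp wand
  for C :: "('o, 'm, 'z) rcategory_scheme" (structure) and perp and wand (infixl "\<circledast>" 68)
begin

section \<open>Zero, disjointness and additivity of the wand in its second argument\<close>

lemma wand_zero_right:
  assumes f: "f \<in> Hom C X X" and A: "A \<in> Obj C" shows "f \<circledast> Zero C X A = Zero C X A"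
proof -
  note z = zero_hom[OF hom_dom[OF f] A] and p = perp_zero_right[OF f A]
  show ?thesis
    using wand_natural[OF f z p zero_hom[OF A A]] comp_zero[OF wand_hom[OF f z p] A] comp_zero[OF z A]
    by simp
qed

text \<open>The axiom on disjointness of wands requires one of the two second arguments to be an
  endomap. The restrictions of \<open>x\<close> and \<open>y\<close> are endomaps, so it applies to
  them; naturality then restores \<open>x\<close> and \<open>y\<close>.\<close>

lemma wand_perp:
  assumes f: "f \<in> Hom C X X" and x: "x \<in> Hom C X A" and y: "y \<in> Hom C X B"
    and "perp f x" "perp f y" "perp x y"
  shows "perp (f \<circledast> x) (f \<circledast> y)"
proof -
  have p: "perp f (Rst C x)" "perp f (Rst C y)" "perp (Rst C x) (Rst C y)"
    using assms perp_hom_rst2 perp_rst by blast+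
  note xy = rst_hom[OF x] rst_hom[OF y]
  have "perp (f \<circledast> Rst C x) (f \<circledast> Rst C y)"
    by (rule wand_diagonal_perp[OF f xy p(1) perp_bjoin_left[OF f xy(1) p(1) xy(2) p(2,3)]])
  then have "perp ((f \<circledast> Rst C x) \<Zsemi> x) ((f \<circledast> Rst C y) \<Zsemi> y)"
    by (rule perp_comp_right[OF _ wand_hom[OF f xy(1) p(1)] wand_hom[OF f xy(2) p(2)] x y])
  then show ?thesis
    using wand_natural[OF f xy(1) p(1) x] wand_natural[OF f xy(2) p(2) y]
      rst_comp_self[OF x] rst_comp_self[OF y] by simp
qed

text \<open>Additivity in the second argument is not an axiom; it follows from naturality
  because \<open>x\<close> factors through its own restriction.\<close>

lemma wand_disjoint_join:
  assumes f: "f \<in> Hom C X X" and S: "disjoint_join X A S x" and p: "perp f x"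
  shows "disjoint_join X A ((\<lambda>s. f \<circledast> s) ` S) (f \<circledast> x)"
proof -
  have x: "x \<in> Hom C X A" using S by (rule disjoint_join_hom)
  have pe: "perp f (Rst C x)" using perp_hom_rst2[OF p f x] .
  note e = rst_hom[OF x]
  \<comment> \<open>As \<open>s\<close> lies below \<open>x\<close>, it is fixed by
    \<open>Rst C x\<close>, and naturality turns composition with \<open>s\<close> into the wand at
    \<open>s\<close>. Left distributivity over \<open>S\<close> then gives the claim.\<close>
  have "(f \<circledast> Rst C x) \<Zsemi> s = f \<circledast> s" if "s \<in> S" for s
  proof -
    have s: "s \<in> Hom C X A" using that S by (auto simp: disjoint_join_def)
    have "Rst C x \<Zsemi> s = Rst C x \<Zsemi> (Rst C s \<Zsemi> x)"
      using rle_eq[OF disjoint_join_rle[OF S that]] by simp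
    also have "\<dots> = Rst C s \<Zsemi> (Rst C x \<Zsemi> x)"
      using comp_assoc[OF e rst_hom[OF s] x] comp_assoc[OF rst_hom[OF s] e x] rst_commute[OF x s]
      by simp
    also have "\<dots> = s" using rst_comp_self[OF x] rle_eq[OF disjoint_join_rle[OF S that]] by simp
    finally show ?thesis using wand_natural[OF f e pe s] by simp
  qed
  then have "(\<lambda>s. (f \<circledast> Rst C x) \<Zsemi> s) ` S = (\<lambda>s. f \<circledast> s) ` S" by (rule image_cong[OF refl])
  then show ?thesis
    using disjoint_join_comp_left[OF S wand_hom[OF f e pe]] wand_natural[OF f e pe x]
      rst_comp_self[OF x] by simp
qed

lemma wand_bjoin:
  assumes f: "f \<in> Hom C X X" and x: "x \<in> Hom C X A" and y: "y \<in> Hom C X A"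
    and p: "perp f x" "perp f y" "perp x y"
  shows "f \<circledast> bjoin C x y = bjoin C (f \<circledast> x) (f \<circledast> y)"
  using wand_disjoint_join[OF f disjoint_join_pair[OF x y p(3)] perp_bjoin_right[OF x y p(3) f p(1,2)]]
  by (simp add: bjoin_eqI)

lemma wand_Join:
  assumes f: "f \<in> Hom C X X" and g: "perp_family X A I g" and p: "\<And>i. i \<in> I \<Longrightarrow> perp f (g i)"
  shows "f \<circledast> Join C X A (g ` I) = Join C X A ((\<lambda>i. f \<circledast> g i) ` I)"
proof -
  have "perp f (Join C X A (g ` I))" using perp_Join_left[OF g f] p perp_sym by blast
  from disjoint_join_Join[OF wand_disjoint_join[OF f perp_family_Join[OF g] this]]
  show ?thesis by (simp add: image_image)
qed

text \<open>Eliminating \<open>X\<close> and then \<open>Y\<close> from the rows \<open>(a, b, c)\<close>, \<open>(d, e, f)\<close>, \<open>(g, h, k)\<close>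
  gives a join that is visibly invariant under exchanging the roles of \<open>X\<close> and \<open>Y\<close>.\<close>

lemma eliminate_twice:
  assumes a: "a \<in> Hom C X X" and b: "b \<in> Hom C X Y" and c: "c \<in> Hom C X Q"
    and d: "d \<in> Hom C Y X" and e: "e \<in> Hom C Y Y" and f: "f \<in> Hom C Y Q"
    and g: "g \<in> Hom C P X" and h: "h \<in> Hom C P Y" and k: "k \<in> Hom C P Q"
    and ab: "perp a b" and ac: "perp a c" and bc: "perp b c"
    and de: "perp d e" and df: "perp d f" and ef: "perp e f"
    and gh: "perp g h" and gk: "perp g k" and hk: "perp h k"
    and u: "u = a \<circledast> b" and t: "t = a \<circledast> c" and v: "v = e \<circledast> d" and w: "w = e \<circledast> f"
    and p: "p = (v \<Zsemi> u) \<circledast> (v \<Zsemi> t)" and q: "q = (u \<Zsemi> v) \<circledast> (u \<Zsemi> w)"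
  shows "disjoint_join P Q {k, g \<Zsemi> t, h \<Zsemi> w, h \<Zsemi> p, g \<Zsemi> q, h \<Zsemi> (v \<Zsemi> q), g \<Zsemi> (u \<Zsemi> p)}
    (bjoin C (bjoin C k (g \<Zsemi> (a \<circledast> c))) (bjoin C h (g \<Zsemi> (a \<circledast> b)) \<Zsemi>
      (bjoin C e (d \<Zsemi> (a \<circledast> b)) \<circledast> bjoin C f (d \<Zsemi> (a \<circledast> c)))))"
proof -
  have ed: "perp e d" using de perp_sym by blast
  have uh: "u \<in> Hom C X Y" and th: "t \<in> Hom C X Q" and vh: "v \<in> Hom C Y X" and wh: "w \<in> Hom C Y Q"
    unfolding u t v w by (intro wand_hom a b c d e f ab ac ed ef)+
  have ut: "perp u t" unfolding u t by (rule wand_perp[OF a b c ab ac bc])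
  have vw: "perp v w" unfolding v w by (rule wand_perp[OF e d f ed ef df])
  note du = comp_hom[OF d uh] and dt = comp_hom[OF d th] and vu = comp_hom[OF vh uh]
    and vt = comp_hom[OF vh th] and uv = comp_hom[OF uh vh] and uw = comp_hom[OF uh wh]
    and gt = comp_hom[OF g th] and gu = comp_hom[OF g uh]
  have e_du: "perp e (d \<Zsemi> u)" and e_dt: "perp e (d \<Zsemi> t)"
    by (rule perp_comp2[OF ed e d uh], rule perp_comp2[OF ed e d th])
  have du_f: "perp (d \<Zsemi> u) f" by (rule perp_comp1[OF df d f uh])
  have f_dt: "perp f (d \<Zsemi> t)" by (rule perp_sym, rule perp_comp1[OF df d f th])
  have du_dt: "perp (d \<Zsemi> u) (d \<Zsemi> t)" by (rule perp_comp_left[OF ut uh th d])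
  have e_fdt: "perp e (bjoin C f (d \<Zsemi> t))"
    by (rule perp_bjoin_right[OF f dt f_dt e ef e_dt])
  have vu_w: "perp (v \<Zsemi> u) w" by (rule perp_comp1[OF vw vh wh uh])
  have vu_vt: "perp (v \<Zsemi> u) (v \<Zsemi> t)" by (rule perp_comp_left[OF ut uh th vh])
  have w_vt: "perp w (v \<Zsemi> t)" by (rule perp_sym, rule perp_comp1[OF vw vh wh th])
  \<comment> \<open>In terms of paths, \<open>u\<close> and \<open>v\<close> lead from
    \<open>X\<close> to \<open>Y\<close> and back, while \<open>t\<close> and \<open>w\<close> leave
    from \<open>X\<close> and from \<open>Y\<close>. Then \<open>r\<close> and \<open>p\<close>
    collect the paths that start at \<open>Y\<close> and leave by \<open>w\<close> and by
    \<open>t\<close>; \<open>q\<close> collects those that start at \<open>X\<close> and leave by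
    \<open>w\<close>.\<close>
  define r where "r = (v \<Zsemi> u) \<circledast> w"
  have rh: "r \<in> Hom C Y Q" unfolding r_def by (intro wand_hom vu wh vu_w)
  have ph: "p \<in> Hom C Y Q" unfolding p by (intro wand_hom vu vt vu_vt)
  \<comment> \<open>Dinaturality enters here: \<open>q\<close> arises from \<open>p\<close> by
    exchanging the roles of \<open>X\<close> and \<open>Y\<close>, and it becomes a passage along
    \<open>u\<close> followed by \<open>r\<close>.\<close>
  have q': "q = u \<Zsemi> r" unfolding q r_def by (rule wand_dinatural[OF vh wh uh vw])
  have qh: "q \<in> Hom C X Q" unfolding q' by (rule comp_hom[OF uh rh])
  have rp: "perp r p" unfolding r_def p by (rule wand_perp[OF vu wh vt vu_w vu_vt w_vt])
  \<comment> \<open>One unfolding of \<open>r\<close> exposes \<open>v \<Zsemi> q\<close>, so that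
    only maps from the symmetric list remain.\<close>
  have r: "r = bjoin C w (v \<Zsemi> q)"
    using wand_iterate[OF vu wh vu_w] comp_assoc[OF vh uh rh] by (simp add: r_def[symmetric] q')
  have w_vq: "perp w (v \<Zsemi> q)" by (rule perp_sym, rule perp_comp1[OF vw vh wh qh])
  \<comment> \<open>The diagonal law separates the loop at \<open>e\<close> from the loop through
    \<open>X\<close>; naturality then pulls \<open>u\<close> and \<open>t\<close> out of the inner
    wands and leaves \<open>v = e \<circledast> d\<close> behind.\<close>
  have W: "bjoin C e (d \<Zsemi> u) \<circledast> bjoin C f (d \<Zsemi> t) = bjoin C r p" (is "?W = _")
  proof -
    have "?W = (e \<circledast> (d \<Zsemi> u)) \<circledast> (e \<circledast> bjoin C f (d \<Zsemi> t))"
      by (rule wand_diagonal[OF e du bjoin_hom[OF f dt f_dt] e_du perp_bjoin_left[OF e du e_du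
            bjoin_hom[OF f dt f_dt] e_fdt perp_bjoin_right[OF f dt f_dt du du_f du_dt]]])
    also have "e \<circledast> (d \<Zsemi> u) = v \<Zsemi> u" unfolding v by (rule wand_natural[OF e d ed uh, symmetric])
    also have "e \<circledast> bjoin C f (d \<Zsemi> t) = bjoin C w (e \<circledast> (d \<Zsemi> t))"
      unfolding w by (rule wand_bjoin[OF e f dt ef e_dt f_dt])
    also have "e \<circledast> (d \<Zsemi> t) = v \<Zsemi> t" unfolding v by (rule wand_natural[OF e d ed th, symmetric])
    also have "(v \<Zsemi> u) \<circledast> bjoin C w (v \<Zsemi> t) = bjoin C r p"
      unfolding r_def p by (rule wand_bjoin[OF vu wh vt vu_w vu_vt w_vt])
    finally show ?thesis .
  qed
  have Wh: "bjoin C r p \<in> Hom C Y Q" by (intro bjoin_hom rh ph rp)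
  have dW: "disjoint_join Y Q {w, v \<Zsemi> q, p} (bjoin C r p)"
    using disjoint_join_bjoin[OF disjoint_join_pair[OF wh comp_hom[OF vh qh] w_vq]
        disjoint_join_single[OF ph]] rp by (simp add: r[symmetric] insert_commute)
  have hgu: "perp h (g \<Zsemi> u)" by (rule perp_sym, rule perp_comp1[OF gh g h uh])
  have hW: "disjoint_join P Q {h \<Zsemi> w, h \<Zsemi> (v \<Zsemi> q), h \<Zsemi> p} (h \<Zsemi> bjoin C r p)"
    using disjoint_join_comp_left[OF dW h] by simp
  have "disjoint_join P Q {g \<Zsemi> u \<Zsemi> r, g \<Zsemi> u \<Zsemi> p} (g \<Zsemi> u \<Zsemi> bjoin C r p)"
    using disjoint_join_comp_left[OF disjoint_join_pair[OF rh ph rp] gu] by simp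
  then have gW: "disjoint_join P Q {g \<Zsemi> q, g \<Zsemi> (u \<Zsemi> p)} (g \<Zsemi> u \<Zsemi> bjoin C r p)"
    using comp_assoc[OF g uh rh] comp_assoc[OF g uh ph] by (simp add: q')
  have kgt: "perp k (g \<Zsemi> t)" by (rule perp_sym, rule perp_comp1[OF gk g k th])
  have 1: "bjoin C h (g \<Zsemi> u) \<Zsemi> bjoin C r p = bjoin C (h \<Zsemi> bjoin C r p) (g \<Zsemi> u \<Zsemi> bjoin C r p)"
    by (rule bjoin_comp[OF h gu hgu Wh])
  have 2: "perp (bjoin C k (g \<Zsemi> t)) (bjoin C h (g \<Zsemi> u) \<Zsemi> bjoin C r p)"
  proof (rule perp_comp2[OF _ bjoin_hom[OF k gt kgt] bjoin_hom[OF h gu hgu] Wh])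
    show "perp (bjoin C k (g \<Zsemi> t)) (bjoin C h (g \<Zsemi> u))"
    proof (rule perp_bjoin_bjoin[OF k gt kgt h gu hgu])
      show "perp k h" using hk perp_sym by blast
      show "perp k (g \<Zsemi> u)" by (rule perp_sym, rule perp_comp1[OF gk g k uh])
      show "perp (g \<Zsemi> t) h" by (rule perp_comp1[OF gh g h th])
      show "perp (g \<Zsemi> t) (g \<Zsemi> u)" by (rule perp_sym, rule perp_comp_left[OF ut uh th g])
    qed
  qed
  have "disjoint_join P Q ({k, g \<Zsemi> t} \<union> ({h \<Zsemi> w, h \<Zsemi> (v \<Zsemi> q), h \<Zsemi> p} \<union> {g \<Zsemi> q, g \<Zsemi> (u \<Zsemi> p)}))
    (bjoin C (bjoin C k (g \<Zsemi> t)) (bjoin C h (g \<Zsemi> u) \<Zsemi> bjoin C r p))"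
    using 2 unfolding 1
    by (intro disjoint_join_bjoin disjoint_join_pair k gt kgt hW gW perp_comp_right[OF hgu h gu Wh Wh])
  moreover have "{k, g \<Zsemi> t} \<union> ({h \<Zsemi> w, h \<Zsemi> (v \<Zsemi> q), h \<Zsemi> p} \<union> {g \<Zsemi> q, g \<Zsemi> (u \<Zsemi> p)}) =
    {k, g \<Zsemi> t, h \<Zsemi> w, h \<Zsemi> p, g \<Zsemi> q, h \<Zsemi> (v \<Zsemi> q), g \<Zsemi> (u \<Zsemi> p)}" by blast
  ultimately show ?thesis using W by (simp add: u t)
qed

section \<open>Elimination of pivots from a row-disjoint matrix\<close>

definition eliminate :: "'i \<Rightarrow> ('i \<Rightarrow> 'i \<Rightarrow> 'm) \<Rightarrow> 'i \<Rightarrow> 'i \<Rightarrow> 'm" where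
  "eliminate x F i j = bjoin C (F i j) (F i x \<Zsemi> (F x x \<circledast> F x j))"

text \<open>Eliminated rows are kept: afterwards row \<open>x\<close> contains the solution \<open>F x x \<circledast> F x j\<close>.\<close>

definition eliminates :: "'i list \<Rightarrow> ('i \<Rightarrow> 'i \<Rightarrow> 'm) \<Rightarrow> 'i \<Rightarrow> 'i \<Rightarrow> 'm" where
  "eliminates xs F = fold eliminate xs F"

lemma eliminates_Nil [simp]: "eliminates [] F = F"
  and eliminates_Cons [simp]: "eliminates (x # xs) F = eliminates xs (eliminate x F)"
  and eliminates_append: "eliminates (xs @ ys) F = eliminates ys (eliminates xs F)"
  by (simp_all add: eliminates_def)

text \<open>A pivot serves both as a row and as a column, so the two renamings have to agree there;
  elsewhere they may shift, skip or identify rows and columns independently.\<close>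

lemma eliminates_reindex:
  "(\<And>x. x \<in> set xs \<Longrightarrow> \<rho> x = \<kappa> x) \<Longrightarrow>
    eliminates xs (\<lambda>i j. F (\<rho> i) (\<kappa> j)) = (\<lambda>i j. eliminates (map \<rho> xs) F (\<rho> i) (\<kappa> j))"
proof (induction xs arbitrary: F)
  case (Cons x xs)
  have "eliminate x (\<lambda>i j. F (\<rho> i) (\<kappa> j)) = (\<lambda>i j. eliminate (\<rho> x) F (\<rho> i) (\<kappa> j))"
    using Cons.prems by (intro ext) (simp add: eliminate_def)
  then show ?case using Cons by simp
qed simp

lemma eliminates_cong:
  assumes "\<And>i j. \<lbrakk>i \<in> I; j \<in> J\<rbrakk> \<Longrightarrow> F i j = G i j" "set xs \<subseteq> I" "set xs \<subseteq> J" "i \<in> I" "j \<in> J"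
  shows "eliminates xs F i j = eliminates xs G i j"
  using assms
proof (induction xs arbitrary: F G)
  case (Cons x xs)
  have "eliminate x F i j = eliminate x G i j" if "i \<in> I" "j \<in> J" for i j
    using that Cons.prems(1-3) by (simp add: eliminate_def)
  from Cons.IH[OF this] Cons.prems(2-) show ?case by simp
qed simp

text \<open>Column \<open>x\<close> is dropped because \<open>F x x \<circledast> F x x\<close> is
  not governed by the axioms: its arguments are not disjoint in general. In the other columns the
  terms through the pivot are disjoint by \<open>wand_perp\<close>, and the mixed terms because the
  pivot entry \<open>F i x\<close> is disjoint from the rest of its row.\<close>

lemma row_disjoint_eliminate:
  assumes F: "row_disjoint R Q I J F" and x: "x \<in> I" "x \<in> J" "R x = Q x"
  shows "row_disjoint R Q I (J - {x}) (eliminate x F)"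
proof -
  have xx: "F x x \<in> Hom C (R x) (R x)" using row_disjoint_hom[OF F x(1,2)] x by simp
  have xj: "F x j \<in> Hom C (R x) (Q j)" "perp (F x x) (F x j)" if "j \<in> J" "j \<noteq> x" for j
    using F x that by (auto simp: row_disjoint_def)
  have w: "F x x \<circledast> F x j \<in> Hom C (R x) (Q j)" if "j \<in> J" "j \<noteq> x" for j
    using wand_hom[OF xx xj] that by blast
  have ix: "F i x \<in> Hom C (R i) (R x)" if "i \<in> I" for i
    using row_disjoint_hom[OF F that x(2)] x by simp
  have ij: "F i j \<in> Hom C (R i) (Q j)" if "i \<in> I" "j \<in> J" for i j
    using row_disjoint_hom[OF F that] .
  have p: "perp (F i j) (F i x \<Zsemi> (F x x \<circledast> F x k))"
    if "i \<in> I" "j \<in> J" "j \<noteq> x" "k \<in> J" "k \<noteq> x" for i j k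
    using perp_comp2[OF row_disjoint_perp[OF F] ij ix w] that x by blast
  have "perp (eliminate x F i j) (eliminate x F i k)"
    if i: "i \<in> I" and j: "j \<in> J" "j \<noteq> x" and k: "k \<in> J" "k \<noteq> x" and "j \<noteq> k" for i j k
    unfolding eliminate_def
  proof (rule perp_bjoin_bjoin)
    show "perp (F i x \<Zsemi> (F x x \<circledast> F x j)) (F i x \<Zsemi> (F x x \<circledast> F x k))"
      using perp_comp_left[OF wand_perp[OF xx xj(1)[OF j] xj(1)[OF k] xj(2)[OF j] xj(2)[OF k]]
          w[OF j] w[OF k] ix[OF i]] row_disjoint_perp[OF F x(1) j(1) k(1) \<open>j \<noteq> k\<close>] .
  qed (use i j k \<open>j \<noteq> k\<close> p ij row_disjoint_perp[OF F] comp_hom[OF ix w] perp_sym in auto)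
  moreover have "eliminate x F i j \<in> Hom C (R i) (Q j)" if "i \<in> I" "j \<in> J" "j \<noteq> x" for i j
    unfolding eliminate_def using bjoin_hom[OF ij comp_hom[OF ix w] p] that by blast
  ultimately show ?thesis by (auto simp: row_disjoint_def)
qed

lemma row_disjoint_eliminates:
  assumes "row_disjoint R Q I J F" "set xs \<subseteq> I" "set xs \<subseteq> J" "distinct xs"
    "\<And>x. x \<in> set xs \<Longrightarrow> R x = Q x"
  shows "row_disjoint R Q I (J - set xs) (eliminates xs F)"
  using assms
proof (induction xs arbitrary: F J)
  case (Cons x xs)
  have "J - {x} - set xs = J - set (x # xs)" by auto
  then show ?case
    using Cons.IH[OF row_disjoint_eliminate[OF Cons.prems(1)], of x] Cons.prems(2-) by auto
qed simp

text \<open>In the pivot row the defining formula is the left side of the iteration axiom, so the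
  entry collapses to the wand.\<close>

lemma eliminate_row_self:
  assumes F: "row_disjoint R Q I J F" and x: "x \<in> I" "x \<in> J" "R x = Q x" "j \<in> J" "j \<noteq> x"
  shows "eliminate x F x j = F x x \<circledast> F x j"
  using wand_iterate[of "F x x" "R x" "F x j" "Q j"] row_disjoint_hom[OF F x(1)] x
    row_disjoint_perp[OF F x(1)] by (auto simp: eliminate_def)

text \<open>The matrix form of the iteration axiom: after elimination, column \<open>j\<close>
  solves the linear system with the original coefficients. In the induction, eliminating
  \<open>x\<close> expresses each row through row \<open>x\<close>, and the terms passing through
  \<open>F i x\<close> regroup to \<open>F i x\<close> composed with the solution in row
  \<open>x\<close>.\<close>

lemma eliminates_solution:
  assumes "row_disjoint R Q I J F" "set xs \<subseteq> I" "set xs \<subseteq> J" "distinct xs"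
    "\<And>x. x \<in> set xs \<Longrightarrow> R x = Q x" "i \<in> I" "j \<in> J" "j \<notin> set xs"
  shows "eliminates xs F i j =
    bjoin C (F i j) (Join C (R i) (Q j) ((\<lambda>x. F i x \<Zsemi> eliminates xs F x j) ` set xs))"
  using assms
proof (induction xs arbitrary: F J i)
  case Nil
  have h: "F i j \<in> Hom C (R i) (Q j)" using row_disjoint_hom[OF Nil(1,6,7)] .
  show ?case
    using Join_eq[OF is_join_empty[OF hom_dom[OF h] hom_cod[OF h]]] bjoin_zero_right[OF h] by simp
next
  case (Cons x xs)
  let ?F = "eliminate x F"
  define W where "W y = eliminates xs ?F y j" for y
  \<comment> \<open>\<open>P\<close> and \<open>P'\<close> are the contributions of the remaining
    pivots: to row \<open>i\<close> with the original coefficients, and to row \<open>x\<close> with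
    the coefficients after the elimination of \<open>x\<close>.\<close>
  define P where "P = Join C (R i) (Q j) ((\<lambda>y. F i y \<Zsemi> W y) ` set xs)"
  define P' where "P' = Join C (R x) (Q j) ((\<lambda>y. ?F x y \<Zsemi> W y) ` set xs)"
  note F = Cons.prems(1)
  have x: "x \<in> I" "x \<in> J" "R x = Q x" and j: "j \<in> J" "j \<noteq> x" "j \<notin> set xs"
    and xs: "set xs \<subseteq> J" "x \<notin> set xs" "set xs \<subseteq> J - {x}" "set xs \<subseteq> I" "j \<in> J - {x}"
    using Cons.prems by auto
  note i = \<open>i \<in> I\<close>
  have F1: "row_disjoint R Q I (J - {x}) ?F" using row_disjoint_eliminate[OF F x] .
  have IH: "W r = bjoin C (?F r j) (Join C (R r) (Q j) ((\<lambda>y. ?F r y \<Zsemi> W y) ` set xs))"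
    if "r \<in> I" for r
    unfolding W_def using Cons.IH[OF F1, of r] Cons.prems(2-) that by auto
  have Wh: "W y \<in> Hom C (Q y) (Q j)" if "y \<in> set xs" for y
  proof -
    have "W y \<in> Hom C (R y) (Q j)" unfolding W_def
      by (rule row_disjoint_hom[OF row_disjoint_eliminates[OF F1, of xs]]) (use Cons.prems that in auto)
    then show ?thesis using Cons.prems(5) that by simp
  qed
  have kh: "F i j \<in> Hom C (R i) (Q j)" and gh: "F i x \<in> Hom C (R i) (R x)"
    and th: "?F x j \<in> Hom C (R x) (Q j)" and gk: "perp (F i x) (F i j)" "perp (F i j) (F i x)"
    using row_disjoint_hom[OF F i j(1)] row_disjoint_hom[OF F i x(2)] row_disjoint_hom[OF F1 x(1), of j]
      row_disjoint_perp[OF F i] x j by auto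
  note B = hom_cod[OF kh] and Ri = hom_dom[OF kh] and Rx = hom_cod[OF gh]
  have Fiz: "?F i z = bjoin C (F i z) (F i x \<Zsemi> ?F x z)" if "z \<in> J" "z \<noteq> x" for z
    unfolding eliminate_row_self[OF F x that] by (simp add: eliminate_def)
  have Fij: "?F i j = bjoin C (F i j) (F i x \<Zsemi> ?F x j)"
    and Fiy: "\<And>y. y \<in> set xs \<Longrightarrow> ?F i y = bjoin C (F i y) (F i x \<Zsemi> ?F x y)"
    using Fiz j xs by auto
  have dP: "perp_family (R i) (Q j) (set xs) (\<lambda>y. F i y \<Zsemi> W y)"
    by (rule perp_family_row[OF F i xs(1) finite_set Wh B Ri])
  have dP': "perp_family (R x) (Q j) (set xs) (\<lambda>y. ?F x y \<Zsemi> W y)"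
    by (rule perp_family_row[OF F1 x(1) xs(3) finite_set Wh B Rx])
  note gP' = perp_family_comp_left[OF dP' gh]
  have Ph: "P \<in> Hom C (R i) (Q j)" and P'h: "P' \<in> Hom C (R x) (Q j)"
    unfolding P_def P'_def using Join_hom dP dP' by blast+
  have kP: "perp (F i j) P"
    unfolding P_def by (rule perp_row_Join[OF F i xs(1) finite_set Wh B j(1,3)])
  have xP: "perp (F i x) P"
    unfolding P_def by (rule perp_row_Join[OF F i xs(1) finite_set Wh B x(2) xs(2)])
  have tP': "perp (?F x j) P'"
    unfolding P'_def by (rule perp_row_Join[OF F1 x(1) xs(3) finite_set Wh B xs(5) j(3)])
  have eq: "?F i y \<Zsemi> W y = bjoin C (F i y \<Zsemi> W y) (F i x \<Zsemi> (?F x y \<Zsemi> W y))"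
    and ixy: "perp (F i y) (F i x)" if y: "y \<in> set xs" for y
  proof -
    have yh: "F i y \<in> Hom C (R i) (Q y)" "?F x y \<in> Hom C (R x) (Q y)" "perp (F i y) (F i x)"
    proof -
      have "y \<in> J" "y \<noteq> x" "y \<in> J - {x}" using y xs by auto
      then show "F i y \<in> Hom C (R i) (Q y)" "?F x y \<in> Hom C (R x) (Q y)" "perp (F i y) (F i x)"
        using row_disjoint_hom[OF F i] row_disjoint_hom[OF F1 x(1)] row_disjoint_perp[OF F i] x(2) by blast+
    qed
    show "?F i y \<Zsemi> W y = bjoin C (F i y \<Zsemi> W y) (F i x \<Zsemi> (?F x y \<Zsemi> W y))" "perp (F i y) (F i x)"
      using bjoin_comp[OF yh(1) comp_hom[OF gh yh(2)] perp_comp2[OF yh(3,1) gh yh(2)] Wh[OF y]]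
        comp_assoc[OF gh yh(2) Wh[OF y]] yh(3) by (simp_all add: Fiy[OF y])
  qed
  have pp: "perp (F i y \<Zsemi> W y) (F i x \<Zsemi> (?F x z \<Zsemi> W z))" if "y \<in> set xs" "z \<in> set xs" for y z
    using perp_comp_right[OF ixy[OF that(1)] row_disjoint_hom[OF F i] gh Wh[OF that(1)]
        comp_hom[OF row_disjoint_hom[OF F1 x(1)] Wh[OF that(2)]]] that xs by blast
  have "Join C (R i) (Q j) ((\<lambda>y. ?F i y \<Zsemi> W y) ` set xs) = bjoin C P (F i x \<Zsemi> P')"
  proof -
    have "(\<lambda>y. ?F i y \<Zsemi> W y) ` set xs =
        (\<lambda>y. bjoin C (F i y \<Zsemi> W y) (F i x \<Zsemi> (?F x y \<Zsemi> W y))) ` set xs"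
      by (rule image_cong[OF refl eq])
    then show ?thesis
      unfolding P_def P'_def comp_Join[OF dP' gh] by (simp add: Join_bjoin(1)[OF dP gP' pp])
  qed
  then have "W i = bjoin C (bjoin C (F i j) (F i x \<Zsemi> ?F x j)) (bjoin C P (F i x \<Zsemi> P'))"
    using IH[OF i] Fij by simp
  \<comment> \<open>The terms factoring through \<open>F i x\<close> are brought together, so that
    factoring it out leaves exactly the induction hypothesis for row \<open>x\<close>.\<close>
  also have "\<dots> = bjoin C (F i j) (bjoin C (bjoin C (F i x \<Zsemi> ?F x j) (F i x \<Zsemi> P')) P)"
    by (rule bjoin_rearrange[OF kh comp_hom[OF gh th] Ph comp_hom[OF gh P'h]
          perp_comp2[OF gk(2) kh gh th] kP perp_comp2[OF gk(2) kh gh P'h] perp_comp1[OF xP gh Ph th]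
          perp_comp_left[OF tP' th P'h gh] perp_sym[OF perp_comp1[OF xP gh Ph P'h]]])
  also have "bjoin C (F i x \<Zsemi> ?F x j) (F i x \<Zsemi> P') = F i x \<Zsemi> W x"
    using comp_bjoin[OF th P'h tP' gh] IH[OF x(1)] by (simp add: P'_def)
  also have "bjoin C (F i x \<Zsemi> W x) P = Join C (R i) (Q j) ((\<lambda>y. F i y \<Zsemi> W y) ` set (x # xs))"
  proof -
    have Wx: "W x \<in> Hom C (Q x) (Q j)"
      using IH[OF x(1)] bjoin_hom[OF th P'h tP'] x(3) by (simp add: P'_def)
    have "perp_family (R i) (Q j) (insert x (set xs)) (\<lambda>y. F i y \<Zsemi> W y)"
      by (rule perp_family_row[OF F i]) (use xs x Wh Wx B Ri in auto)
    from Join_insert[OF this xs(2)] show ?thesis by (simp add: P_def)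
  qed
  finally show ?case by (simp add: W_def)
qed

text \<open>No entry of row \<open>i\<close> leads to a pivot, so in the linear system for that row
  everything but the direct entry vanishes.\<close>

lemma eliminates_zero_row:
  assumes F: "row_disjoint R Q I J F" "set xs \<subseteq> I" "set xs \<subseteq> J" "distinct xs"
      "\<And>x. x \<in> set xs \<Longrightarrow> R x = Q x" "i \<in> I" "j \<in> J" "j \<notin> set xs"
    and z: "\<And>x. x \<in> set xs \<Longrightarrow> F i x = Zero C (R i) (Q x)"
  shows "eliminates xs F i j = F i j"
proof -
  have h: "F i j \<in> Hom C (R i) (Q j)" using row_disjoint_hom[OF F(1,6,7)] .
  have "F i x \<Zsemi> eliminates xs F x j = Zero C (R i) (Q j)" if x: "x \<in> set xs" for x
  proof -
    have "eliminates xs F x j \<in> Hom C (R x) (Q j)"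
      using row_disjoint_hom[OF row_disjoint_eliminates[OF F(1-5)]] F x by blast
    then show ?thesis using zero_comp hom_dom[OF h] z[OF x] F(5)[OF x] by simp
  qed
  from Join_all_zero[OF hom_dom[OF h] hom_cod[OF h], of "set xs", OF this]
  show ?thesis using eliminates_solution[OF F] bjoin_zero_right[OF h] by simp
qed

text \<open>When the pivot block vanishes, the pivot rows are already their own solution and
  elimination reduces to one matrix product. Sliding and yanking are computed from this.\<close>

lemma eliminates_zero_block:
  assumes F: "row_disjoint R Q I J F" "set xs \<subseteq> I" "set xs \<subseteq> J" "distinct xs"
      "\<And>x. x \<in> set xs \<Longrightarrow> R x = Q x" "i \<in> I" "j \<in> J" "j \<notin> set xs"
    and z: "\<And>x y. \<lbrakk>x \<in> set xs; y \<in> set xs\<rbrakk> \<Longrightarrow> F x y = Zero C (R x) (Q y)"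
  shows "eliminates xs F i j =
    bjoin C (F i j) (Join C (R i) (Q j) ((\<lambda>x. F i x \<Zsemi> F x j) ` set xs))"
proof -
  have "eliminates xs F x j = F x j" if x: "x \<in> set xs" for x
  proof (rule eliminates_zero_row[OF F(1-5)])
    show "x \<in> I" using F(2) x by blast
    show "F x y = Zero C (R x) (Q y)" if "y \<in> set xs" for y using z x that by blast
  qed (use F in auto)
  then have "(\<lambda>x. F i x \<Zsemi> eliminates xs F x j) ` set xs = (\<lambda>x. F i x \<Zsemi> F x j) ` set xs"
    by (intro image_cong) auto
  then show ?thesis using eliminates_solution[OF F] by simp
qed

text \<open>Since the wand of zero is zero, each step leaves column \<open>j\<close> untouched; in
  particular its pivot entries are still zero at the next step.\<close>

lemma eliminates_zero_column:
  assumes "row_disjoint R Q I J F" "set xs \<subseteq> I" "set xs \<subseteq> J" "distinct xs"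
    "\<And>x. x \<in> set xs \<Longrightarrow> R x = Q x" "i \<in> I" "j \<in> J" "j \<notin> set xs"
    "\<And>x. x \<in> set xs \<Longrightarrow> F x j = Zero C (R x) (Q j)"
  shows "eliminates xs F i j = F i j"
  using assms
proof (induction xs arbitrary: F J)
  case (Cons x xs)
  note F = Cons.prems(1)
  have x: "x \<in> I" "x \<in> J" "R x = Q x" and z: "F x j = Zero C (R x) (Q j)" and j: "j \<in> J"
    using Cons.prems by auto
  have xx: "F x x \<in> Hom C (R x) (R x)" using row_disjoint_hom[OF F x(1,2)] x(3) by simp
  have *: "eliminate x F r j = F r j" if r: "r \<in> I" for r
  proof -
    have h: "F r j \<in> Hom C (R r) (Q j)" "F r x \<in> Hom C (R r) (R x)"
      using row_disjoint_hom[OF F r] x j by auto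
    then show ?thesis
      using wand_zero_right[OF xx hom_cod[OF h(1)]] comp_zero[OF h(2) hom_cod[OF h(1)]]
      by (simp add: eliminate_def z bjoin_zero_right)
  qed
  have "eliminates xs (eliminate x F) i j = eliminate x F i j"
  proof (rule Cons.IH[OF row_disjoint_eliminate[OF F x]])
    show "eliminate x F y j = Zero C (R y) (Q j)" if "y \<in> set xs" for y
    proof -
      have "y \<in> I" "F y j = Zero C (R y) (Q j)" using that Cons.prems(2,9) by auto
      then show ?thesis using * by simp
    qed
  qed (use Cons.prems(2-8) in auto)
  then show ?case using *[OF \<open>i \<in> I\<close>] by simp
qed simp

section \<open>Independence of the order of elimination\<close>

lemma eliminate_commute:
  assumes F: "row_disjoint R Q I J F" and x: "x \<in> I" "x \<in> J" "R x = Q x"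
    and y: "y \<in> I" "y \<in> J" "R y = Q y" and "x \<noteq> y" and i: "i \<in> I" and j: "j \<in> J" "j \<noteq> x" "j \<noteq> y"
  shows "eliminate y (eliminate x F) i j = eliminate x (eliminate y F) i j"
proof -
  have h: "F r x \<in> Hom C (R r) (R x)" "F r y \<in> Hom C (R r) (R y)" "F r j \<in> Hom C (R r) (Q j)"
    if "r \<in> I" for r
    using row_disjoint_hom[OF F that] x y j by auto
  have p: "perp (F r x) (F r y)" "perp (F r x) (F r j)" "perp (F r y) (F r j)" "perp (F r y) (F r x)"
    if "r \<in> I" for r
    using row_disjoint_perp[OF F that] x y j \<open>x \<noteq> y\<close> by auto
  note hx = h[OF x(1)] and hy = h[OF y(1)] and hi = h[OF i]
  note px = p[OF x(1)] and py = p[OF y(1)] and pi = p[OF i]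
  \<comment> \<open>The two instances differ by exchanging \<open>x\<close> and \<open>y\<close>;
    they present both sides as joins of the same seven terms.\<close>
  show ?thesis
    using eliminate_twice[OF hx hy hi px(1,2,3) py(1,2,3) pi(1,2,3) refl refl refl refl refl refl]
      eliminate_twice[OF hy(2,1,3) hx(2,1,3) hi(2,1,3) py(4,3,2) px(4,3,2) pi(4,3,2)
        refl refl refl refl refl refl]
    unfolding eliminate_def by (elim disjoint_join_unique) (simp add: insert_commute)
qed

lemma eliminates_rotate:
  assumes "row_disjoint R Q I J F" "set (x # ys) \<subseteq> I" "set (x # ys) \<subseteq> J" "distinct (x # ys)"
    "\<And>z. z \<in> set (x # ys) \<Longrightarrow> R z = Q z" "i \<in> I" "j \<in> J" "j \<notin> set (x # ys)"
  shows "eliminates (x # ys) F i j = eliminates (ys @ [x]) F i j"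
  using assms
proof (induction ys arbitrary: F J)
  case (Cons y ys)
  note F = Cons.prems(1)
  have x: "x \<in> I" "x \<in> J" "R x = Q x" and y: "y \<in> I" "y \<in> J" "R y = Q y" and xy: "x \<noteq> y"
    using Cons.prems by auto
  have "eliminates (x # y # ys) F i j = eliminates ys (eliminate x (eliminate y F)) i j"
    unfolding eliminates_Cons
  \<comment> \<open>The two orders are known to agree only off the columns \<open>x\<close> and
    \<open>y\<close>. That suffices, because the remaining pivots and \<open>j\<close> avoid these
    columns.\<close>
  proof (rule eliminates_cong[where I = I and J = "J - {x, y}"])
    show "eliminate y (eliminate x F) r c = eliminate x (eliminate y F) r c"
      if "r \<in> I" "c \<in> J - {x, y}" for r c
      using eliminate_commute[OF F x y xy] that by auto
  qed (use Cons.prems in auto)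
  also have "\<dots> = eliminates (x # ys) (eliminate y F) i j" by simp
  also have "\<dots> = eliminates (ys @ [x]) (eliminate y F) i j"
    by (rule Cons.IH[OF row_disjoint_eliminate[OF F y]]) (use Cons.prems in auto)
  finally show ?case by simp
qed simp

lemma eliminates_swap:
  assumes "row_disjoint R Q I J F" "set (xs @ ys) \<subseteq> I" "set (xs @ ys) \<subseteq> J" "distinct (xs @ ys)"
    "\<And>z. z \<in> set (xs @ ys) \<Longrightarrow> R z = Q z" "i \<in> I" "j \<in> J" "j \<notin> set (xs @ ys)"
  shows "eliminates (xs @ ys) F i j = eliminates (ys @ xs) F i j"
  using assms
proof (induction xs arbitrary: ys)
  case (Cons x xs)
  have "eliminates ((x # xs) @ ys) F i j = eliminates ((xs @ ys) @ [x]) F i j"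
    unfolding append_Cons by (rule eliminates_rotate[OF Cons.prems(1)]) (use Cons.prems in auto)
  also have "\<dots> = eliminates (xs @ (ys @ [x])) F i j" by simp
  also have "\<dots> = eliminates ((ys @ [x]) @ xs) F i j"
    by (rule Cons.IH[OF Cons.prems(1)]) (use Cons.prems in auto)
  finally show ?case by simp
qed simp

text \<open>An elimination step is linear in a row that is not a pivot row: the row occurs as a
  summand and, through its pivot entry, as a left factor. Hence a combination of rows with
  coefficients \<open>g\<close> on the left stays the same combination. This is the source of
  tightening on the domain side.\<close>

lemma eliminates_left_linear:
  assumes "row_disjoint R Q I J F" "set xs \<subseteq> I" "set xs \<subseteq> J" "distinct xs"
    "\<And>x. x \<in> set xs \<Longrightarrow> R x = Q x" "j \<in> J" "j \<notin> set xs"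
    and L: "finite L" "L \<subseteq> I" "P \<in> Obj C" "\<And>l. l \<in> L \<Longrightarrow> g l \<in> Hom C P (R l)"
      "\<And>l l'. \<lbrakk>l \<in> L; l' \<in> L; l \<noteq> l'\<rbrakk> \<Longrightarrow> perp (g l) (g l')"
    and "\<And>x j. \<lbrakk>x \<in> set xs; j \<in> J\<rbrakk> \<Longrightarrow> F' x j = F x j"
    and "\<And>j. j \<in> J \<Longrightarrow> F' r j = Join C P (Q j) ((\<lambda>l. g l \<Zsemi> F l j) ` L)"
  shows "eliminates xs F' r j = Join C P (Q j) ((\<lambda>l. g l \<Zsemi> eliminates xs F l j) ` L)"
  using assms(1-7) assms(13-)
proof (induction xs arbitrary: F F' J)
  case (Cons x xs)
  note F = Cons.prems(1)
  have x: "x \<in> I" "x \<in> J" "R x = Q x" using Cons.prems by auto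
  have xx: "F x x \<in> Hom C (R x) (R x)" using row_disjoint_hom[OF F x(1,2)] x(3) by simp
  have "eliminate x F' r c = Join C P (Q c) ((\<lambda>l. g l \<Zsemi> eliminate x F l c) ` L)"
    if c: "c \<in> J - {x}" for c
  proof -
    have xc: "F x c \<in> Hom C (R x) (Q c)" "perp (F x x) (F x c)"
      using row_disjoint_hom[OF F x(1)] row_disjoint_perp[OF F x(1,2)] c by auto
    define w where "w = F x x \<circledast> F x c"
    have w: "w \<in> Hom C (R x) (Q c)" unfolding w_def by (rule wand_hom[OF xx xc])
    have lh: "F l c \<in> Hom C (R l) (Q c)" "F l x \<in> Hom C (R l) (R x)" "perp (F l c) (F l x)"
      if "l \<in> L" for l
      using row_disjoint_hom[OF F, of l] row_disjoint_perp[OF F, of l c x] that L(2) x c by auto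
    have gp: "perp (g l \<Zsemi> a) (g l' \<Zsemi> b)"
        if "l \<in> L" "l' \<in> L" "l \<noteq> l'" "a \<in> Hom C (R l) A" "b \<in> Hom C (R l') B"
      for l l' a b A B
      using perp_comp_right[OF L(5) L(4) L(4)] that by blast
    have d1: "perp_family P (Q c) L (\<lambda>l. g l \<Zsemi> F l c)"
      using L(1,3) hom_cod[OF w] comp_hom[OF L(4) lh(1)] gp[OF _ _ _ lh(1) lh(1)]
          by (intro perp_familyI) auto
    have d2: "perp_family P (R x) L (\<lambda>l. g l \<Zsemi> F l x)"
      using L(1,3) hom_dom[OF w] comp_hom[OF L(4) lh(2)] gp[OF _ _ _ lh(2) lh(2)]
          by (intro perp_familyI) auto
    \<comment> \<open>For equal indices disjointness comes from row \<open>l\<close> of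
      \<open>F\<close>, for different ones from the coefficients \<open>g\<close>.\<close>
    have pp: "perp (g l \<Zsemi> F l c) (g l' \<Zsemi> F l' x \<Zsemi> w)" if l: "l \<in> L" and l': "l' \<in> L" for l l'
    proof (cases "l = l'")
      case True
      show ?thesis
        using perp_comp_left[OF perp_comp2[OF lh(3,1,2)[OF l] w] lh(1)[OF l] comp_hom[OF lh(2)[OF l] w]
            L(4)[OF l]]
          comp_assoc[OF L(4)[OF l] lh(2)[OF l] w] True by simp
    next
      case False
      show ?thesis
        using gp[OF l l' False lh(1)[OF l] comp_hom[OF lh(2)[OF l'] w]]
          comp_assoc[OF L(4)[OF l'] lh(2)[OF l'] w] by simp
    qed
    have "eliminate x F' r c = bjoin C (F' r c) (F' r x \<Zsemi> w)"
      using Cons.prems(8)[of x] x c by (simp add: eliminate_def w_def)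
    also have "\<dots> = Join C P (Q c) ((\<lambda>l. bjoin C (g l \<Zsemi> F l c) (g l \<Zsemi> F l x \<Zsemi> w)) ` L)"
      using Cons.prems(9) x(2,3) c Join_comp[OF d2 w] Join_bjoin(1)[OF d1 perp_family_comp_right[OF d2 w]
          pp]
      by simp
    also have "(\<lambda>l. bjoin C (g l \<Zsemi> F l c) (g l \<Zsemi> F l x \<Zsemi> w)) ` L = (\<lambda>l. g l \<Zsemi> eliminate x F l c) ` L"
    proof (rule image_cong[OF refl])
      fix l assume l: "l \<in> L"
      show "bjoin C (g l \<Zsemi> F l c) (g l \<Zsemi> F l x \<Zsemi> w) = g l \<Zsemi> eliminate x F l c"
        using comp_bjoin[OF lh(1)[OF l] comp_hom[OF lh(2)[OF l] w] perp_comp2[OF lh(3,1,2)[OF l] w] L(4)[OF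
            l]]
          comp_assoc[OF L(4)[OF l] lh(2)[OF l] w] by (simp add: eliminate_def w_def)
    qed
    finally show ?thesis .
  qed
  note row = this
  have "eliminates xs (eliminate x F') r j =
      Join C P (Q j) ((\<lambda>l. g l \<Zsemi> eliminates xs (eliminate x F) l j) ` L)"
  proof (rule Cons.IH[OF row_disjoint_eliminate[OF F x]])
    show "eliminate x F' y c = eliminate x F y c" if "y \<in> set xs" "c \<in> J - {x}" for y c
      using Cons.prems(8) that x(2) by (simp add: eliminate_def)
  qed (use Cons.prems(2-7) row in auto)
  then show ?case by simp
qed simp

text \<open>The combined column also appears inside the wand, as its second argument, so additivity
  and naturality of the wand are used besides distributivity. This is the source of tightening on
  the codomain side.\<close>

lemma eliminates_right_linear:
  assumes "row_disjoint R Q I J F" "set xs \<subseteq> I" "set xs \<subseteq> J" "distinct xs"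
    "\<And>x. x \<in> set xs \<Longrightarrow> R x = Q x" "i \<in> I"
    and L: "finite L" "D \<in> Obj C" "\<And>l. l \<in> L \<Longrightarrow> h l \<in> Hom C (Q l) D" "L \<inter> set xs = {}" "L \<subseteq> J"
    and "\<And>i x. \<lbrakk>i \<in> I; x \<in> set xs\<rbrakk> \<Longrightarrow> F' i x = F i x"
    and "\<And>i. i \<in> I \<Longrightarrow> F' i q = Join C (R i) D ((\<lambda>l. F i l \<Zsemi> h l) ` L)"
  shows "eliminates xs F' i q = Join C (R i) D ((\<lambda>l. eliminates xs F i l \<Zsemi> h l) ` L)"
  using assms(1-6) assms(10-)
proof (induction xs arbitrary: F F' J)
  case (Cons x xs)
  note F = Cons.prems(1)
  have x: "x \<in> I" "x \<in> J" "R x = Q x" using Cons.prems by auto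
  have xL: "x \<notin> L" and LJ: "L \<subseteq> J" using Cons.prems(7,8) by auto
  have xx: "F x x \<in> Hom C (R x) (R x)" using row_disjoint_hom[OF F x(1,2)] x(3) by simp
  have lh: "F r l \<in> Hom C (R r) (Q l)" "perp (F r x) (F r l)" if "r \<in> I" "l \<in> L" for r l
    using row_disjoint_hom[OF F, of r l] row_disjoint_perp[OF F, of r x l] that LJ x xL by auto
  have d: "perp_family (R r) D L (\<lambda>l. F r l \<Zsemi> h l)" if r: "r \<in> I" for r
    by (rule perp_family_row[OF F r LJ L(1,3,2) hom_dom[OF row_disjoint_hom[OF F r x(2)]]])
  define w where "w l = F x x \<circledast> F x l" for l
  have w: "w l \<in> Hom C (R x) (Q l)" if "l \<in> L" for l
    unfolding w_def using wand_hom[OF xx lh] x(1) that by blast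
  have wh: "F x x \<circledast> (F x l \<Zsemi> h l) = w l \<Zsemi> h l" if "l \<in> L" for l
    unfolding w_def using wand_natural[OF xx lh L(3)] x(1) that by simp
  have px: "perp (F x x) (F x l \<Zsemi> h l)" if "l \<in> L" for l
    using perp_comp2[OF lh(2) xx lh(1) L(3)] that x(1) by blast
  have dw: "perp_family (R x) D L (\<lambda>l. w l \<Zsemi> h l)"
  proof (rule perp_familyI)
    fix l l' assume ll: "l \<in> L" "l' \<in> L" "l \<noteq> l'"
    have "perp (w l) (w l')" unfolding w_def
      using wand_perp[OF xx lh(1) lh(1) lh(2) lh(2)] row_disjoint_perp[OF F x(1)] ll x(1) LJ by blast
    then show "perp (w l \<Zsemi> h l) (w l' \<Zsemi> h l')"
      using perp_comp_right[OF _ w w L(3) L(3)] ll by blast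
  qed (use L hom_dom[OF xx] comp_hom[OF w L(3)] in auto)
  have row: "eliminate x F' r q = Join C (R r) D ((\<lambda>l. eliminate x F r l \<Zsemi> h l) ` L)"
    if r: "r \<in> I" for r
  proof -
    have rx: "F r x \<in> Hom C (R r) (R x)" using row_disjoint_hom[OF F r x(2)] x(3) by simp
    \<comment> \<open>Additivity splits the wand at the combined column into wands at the single
      columns, and naturality then moves each \<open>h l\<close> outside.\<close>
    have "F x x \<circledast> F' x q = Join C (R x) D ((\<lambda>l. F x x \<circledast> (F x l \<Zsemi> h l)) ` L)"
      using Cons.prems(10)[OF x(1)] wand_Join[OF xx d[OF x(1)] px] by simp
    also have "(\<lambda>l. F x x \<circledast> (F x l \<Zsemi> h l)) ` L = (\<lambda>l. w l \<Zsemi> h l) ` L"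
      by (rule image_cong[OF refl wh])
    finally have "F' r x \<Zsemi> (F' x x \<circledast> F' x q) = Join C (R r) D ((\<lambda>l. F r x \<Zsemi> (w l \<Zsemi> h l)) ` L)"
      using comp_Join[OF dw rx] Cons.prems(9) r x(1) by simp
    then have "eliminate x F' r q =
        bjoin C (Join C (R r) D ((\<lambda>l. F r l \<Zsemi> h l) ` L)) (Join C (R r) D ((\<lambda>l. F r x \<Zsemi> (w l \<Zsemi> h l)) ` L))"
      using Cons.prems(10)[OF r] by (simp add: eliminate_def)
    also have "\<dots> = Join C (R r) D ((\<lambda>l. bjoin C (F r l \<Zsemi> h l) (F r x \<Zsemi> (w l \<Zsemi> h l))) ` L)"
    proof (rule Join_bjoin(1)[OF d[OF r] perp_family_comp_left[OF dw rx]])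
      fix l l' assume l: "l \<in> L" and l': "l' \<in> L"
      show "perp (F r l \<Zsemi> h l) (F r x \<Zsemi> (w l' \<Zsemi> h l'))"
        using perp_comp_right[OF perp_sym[OF lh(2)[OF r l]] lh(1)[OF r l] rx L(3)[OF l] comp_hom[OF w[OF l']
            L(3)[OF l']]] .
    qed
    also have "(\<lambda>l. bjoin C (F r l \<Zsemi> h l) (F r x \<Zsemi> (w l \<Zsemi> h l))) ` L = (\<lambda>l. eliminate x F r l \<Zsemi> h l) ` L"
    proof (rule image_cong[OF refl])
      fix l assume l: "l \<in> L"
      show "bjoin C (F r l \<Zsemi> h l) (F r x \<Zsemi> (w l \<Zsemi> h l)) = eliminate x F r l \<Zsemi> h l"
        using bjoin_comp[OF lh(1)[OF r l] comp_hom[OF rx w[OF l]]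
            perp_comp2[OF perp_sym[OF lh(2)[OF r l]] lh(1)[OF r l] rx w[OF l]] L(3)[OF l]]
          comp_assoc[OF rx w[OF l] L(3)[OF l]] by (simp add: eliminate_def w_def)
    qed
    finally show ?thesis .
  qed
  have "eliminates xs (eliminate x F') i q =
      Join C (R i) D ((\<lambda>l. eliminates xs (eliminate x F) i l \<Zsemi> h l) ` L)"
  proof (rule Cons.IH[OF row_disjoint_eliminate[OF F x]])
    show "eliminate x F' r y = eliminate x F r y" if "r \<in> I" "y \<in> set xs" for r y
      using Cons.prems(9) that x(1) by (simp add: eliminate_def)
  qed (use Cons.prems(2-8) row in auto)
  then show ?case by simp
qed simp

end

section \<open>The matrix category\<close>

abbreviation ent :: "('o, 'm) marr \<Rightarrow> nat \<Rightarrow> nat \<Rightarrow> 'm" where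
  "ent F i j \<equiv> ment F $$ (i, j)"

definition mk_arr :: "'o list \<Rightarrow> 'o list \<Rightarrow> (nat \<Rightarrow> nat \<Rightarrow> 'm) \<Rightarrow> ('o, 'm) marr" where
  "mk_arr A B f = MArr A B (mat (length A) (length B) (\<lambda>(i, j). f i j))"

lemma mk_arr_simps [simp]:
  "mdom (mk_arr A B f) = A" "mcod (mk_arr A B f) = B"
  "\<lbrakk>i < length A; j < length B\<rbrakk> \<Longrightarrow> ent (mk_arr A B f) i j = f i j"
  by (simp_all add: mk_arr_def)

lemma MAT_simps [simp]:
  "Obj (MAT C perp) = lists (Obj C)" "Arr (MAT C perp) = Collect (MAT_arr C perp)"
  "Dom (MAT C perp) = mdom" "Cod (MAT C perp) = mcod" "Ident (MAT C perp) = MAT_ident C"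
  "Comp (MAT C perp) = MAT_comp C" "Rst (MAT C perp) = MAT_rst C" "Zero (MAT C perp) = MAT_zero C"
  "Sum (MAT C perp) = concat" "Inj (MAT C perp) = MAT_inj C"
  by (simp_all add: MAT_def)

section \<open>Arrows of the matrix category and their entries\<close>

context finitely_disjoint_perp_restriction_category
begin

abbreviation M :: "('o list, ('o, 'm) marr) ccategory" where
  "M \<equiv> MAT C perp"

lemma hom_MAT_iff:
  "F \<in> Hom M A B \<longleftrightarrow> set A \<subseteq> Obj C \<and> set B \<subseteq> Obj C \<and> mdom F = A \<and> mcod F = B \<and>
    ment F \<in> carrier_mat (length A) (length B) \<and>
    row_disjoint ((!) A) ((!) B) {..<length A} {..<length B} (ent F)"
  by (auto simp: Hom_def MAT_arr_def row_disjoint_def)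

lemma hom_MAT_D:
  assumes "F \<in> Hom M A B"
  shows "set A \<subseteq> Obj C" "set B \<subseteq> Obj C" "mdom F = A" "mcod F = B"
    "row_disjoint ((!) A) ((!) B) {..<length A} {..<length B} (ent F)"
    "\<And>i. i < length A \<Longrightarrow> A ! i \<in> Obj C" "\<And>j. j < length B \<Longrightarrow> B ! j \<in> Obj C"
  using assms by (auto simp: hom_MAT_iff)

lemma ent_hom: "\<lbrakk>F \<in> Hom M A B; i < length A; j < length B\<rbrakk> \<Longrightarrow> ent F i j \<in> Hom C (A ! i) (B ! j)"
  by (auto simp: hom_MAT_iff row_disjoint_def)

lemma ent_perp:
  "\<lbrakk>F \<in> Hom M A B; i < length A; j < length B; j' < length B; j \<noteq> j'\<rbrakk> \<Longrightarrow> perp (ent F i j) (ent F i j')"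
  by (auto simp: hom_MAT_iff row_disjoint_def)

lemma mk_arr_hom:
  assumes "set A \<subseteq> Obj C" "set B \<subseteq> Obj C"
    "\<And>i j. \<lbrakk>i < length A; j < length B\<rbrakk> \<Longrightarrow> f i j \<in> Hom C (A ! i) (B ! j)"
    "\<And>i j j'. \<lbrakk>i < length A; j < length B; j' < length B; j \<noteq> j'\<rbrakk> \<Longrightarrow> perp (f i j) (f i j')"
  shows "mk_arr A B f \<in> Hom M A B"
  using assms by (auto simp: hom_MAT_iff row_disjoint_def) (simp add: mk_arr_def)

lemma MAT_eqI:
  assumes "F \<in> Hom M A B" "G \<in> Hom M A B"
    "\<And>i j. \<lbrakk>i < length A; j < length B\<rbrakk> \<Longrightarrow> ent F i j = ent G i j"
  shows "F = G"
proof -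
  have "ment F = ment G" using assms by (intro eq_matI) (auto simp: hom_MAT_iff)
  then show ?thesis using assms by (auto simp: hom_MAT_iff intro: marr.expand)
qed

lemma MAT_ident_mk:
  "MAT_ident C A = mk_arr A A (\<lambda>i j. if i = j then Ident C (A ! i) else Zero C (A ! i) (A ! j))"
  by (simp add: MAT_ident_def mk_arr_def)

lemma MAT_zero_mk: "MAT_zero C A B = mk_arr A B (\<lambda>i j. Zero C (A ! i) (B ! j))"
  by (simp add: MAT_zero_def mk_arr_def)

definition rst_row :: "('o, 'm) marr \<Rightarrow> nat \<Rightarrow> 'm" where
  "rst_row F i = Join C (mdom F ! i) (mdom F ! i) ((\<lambda>j. Rst C (ent F i j)) ` {..<length (mcod F)})"

lemma MAT_rst_mk:
  "MAT_rst C F = mk_arr (mdom F) (mdom F)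
    (\<lambda>i i'. if i = i' then rst_row F i else Zero C (mdom F ! i) (mdom F ! i'))"
  unfolding MAT_rst_def mk_arr_def rst_row_def ..

lemma MAT_comp_mk:
  "MAT_comp C F G = mk_arr (mdom F) (mcod G) (\<lambda>i k. Join C (mdom F ! i) (mcod G ! k)
        ((\<lambda>j. ent F i j \<Zsemi> ent G j k) ` {..<length (mcod F)}))"
  by (simp add: MAT_comp_def mk_arr_def)

lemma ent_ident [simp]:
  "\<lbrakk>i < length A; j < length A\<rbrakk> \<Longrightarrow>
    ent (MAT_ident C A) i j = (if i = j then Ident C (A ! i) else Zero C (A ! i) (A ! j))"
  by (simp add: MAT_ident_mk)

lemma ent_zero [simp]:
  "\<lbrakk>i < length A; j < length B\<rbrakk> \<Longrightarrow> ent (MAT_zero C A B) i j = Zero C (A ! i) (B ! j)"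
  by (simp add: MAT_zero_mk)

lemma ent_rst:
  "\<lbrakk>F \<in> Hom M A B; i < length A; j < length A\<rbrakk> \<Longrightarrow>
    ent (MAT_rst C F) i j = (if i = j then rst_row F i else Zero C (A ! i) (A ! j))"
  using hom_MAT_D(3)[of F A B] by (simp add: MAT_rst_mk)

lemma ent_comp:
  "\<lbrakk>F \<in> Hom M A B; G \<in> Hom M B D; i < length A; k < length D\<rbrakk> \<Longrightarrow>
    ent (MAT_comp C F G) i k = Join C (A ! i) (D ! k) ((\<lambda>j. ent F i j \<Zsemi> ent G j k) ` {..<length B})"
  using hom_MAT_D(3,4)[of F A B] hom_MAT_D(4)[of G B D] by (simp add: MAT_comp_mk)

text \<open>If each row has at most one entry that is not zero, its disjointness reduces to
  disjointness from zero.\<close>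

lemma mk_arr_hom_monomial:
  assumes "set A \<subseteq> Obj C" "set B \<subseteq> Obj C" "\<And>i j. \<lbrakk>i < length A; j < length B\<rbrakk> \<Longrightarrow>
      f i j \<in> Hom C (A ! i) (B ! j)"
    "\<And>i j j'. \<lbrakk>i < length A; j < length B; j' < length B; j \<noteq> j'\<rbrakk>
      \<Longrightarrow> f i j = Zero C (A ! i) (B ! j) \<or> f i j' = Zero C (A ! i) (B ! j')"
  shows "mk_arr A B f \<in> Hom M A B"
proof (rule mk_arr_hom[OF assms(1-3)])
  fix i j j' assume *: "i < length A" "j < length B" "j' < length B" "j \<noteq> j'"
  have "B ! j \<in> Obj C" "B ! j' \<in> Obj C" using * assms(2) by auto
  then show "perp (f i j) (f i j')"
    using assms(4)[OF *] perp_zero_left[OF assms(3)[OF *(1,3)]] perp_zero_right[OF assms(3)[OF *(1,2)]]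
    by auto
qed

lemma MAT_ident_hom: "set A \<subseteq> Obj C \<Longrightarrow> MAT_ident C A \<in> Hom M A A"
  unfolding MAT_ident_mk by (rule mk_arr_hom_monomial) (auto intro!: ident_hom zero_hom)

lemma MAT_zero_hom: "\<lbrakk>set A \<subseteq> Obj C; set B \<subseteq> Obj C\<rbrakk> \<Longrightarrow> MAT_zero C A B \<in> Hom M A B"
  unfolding MAT_zero_mk by (rule mk_arr_hom_monomial) (auto intro!: zero_hom)

lemma perp_family_ent_rst:
  assumes F: "F \<in> Hom M A B" and i: "i < length A"
  shows "perp_family (A ! i) (A ! i) {..<length B} (\<lambda>j. Rst C (ent F i j))"
  using assms ent_hom[OF F i] ent_perp[OF F i] hom_MAT_D(6)[OF F i]
  by (intro perp_familyI) (auto intro: rst_hom perp_rst)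

lemma rst_row_eq:
  "F \<in> Hom M A B \<Longrightarrow> rst_row F i = Join C (A ! i) (A ! i) ((\<lambda>j. Rst C (ent F i j)) ` {..<length B})"
  using hom_MAT_D(3,4)[of F A B] by (simp add: rst_row_def)

lemma rst_row_hom: "\<lbrakk>F \<in> Hom M A B; i < length A\<rbrakk> \<Longrightarrow> rst_row F i \<in> Hom C (A ! i) (A ! i)"
  using Join_hom[OF perp_family_ent_rst] by (simp add: rst_row_eq)

lemma rst_rst_row:
  assumes F: "F \<in> Hom M A B" and i: "i < length A"
  shows "Rst C (rst_row F i) = rst_row F i"
  using rst_Join[OF perp_family_ent_rst[OF F i]] rst_rst[OF ent_hom[OF F i]] by (simp add: rst_row_eq[OF F])

lemma MAT_rst_hom:
  assumes F: "F \<in> Hom M A B" shows "MAT_rst C F \<in> Hom M A A"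
  unfolding MAT_rst_mk hom_MAT_D(3)[OF F]
  by (rule mk_arr_hom_monomial) (use hom_MAT_D[OF F] rst_row_hom[OF F] zero_hom in auto)

lemma perp_family_comp:
  assumes F: "F \<in> Hom M A B" and G: "G \<in> Hom M B D" and i: "i < length A" and k: "k < length D"
  shows "perp_family (A ! i) (D ! k) {..<length B} (\<lambda>j. ent F i j \<Zsemi> ent G j k)"
  by (rule perp_family_row[OF hom_MAT_D(5)[OF F]])
    (use i k hom_MAT_D(6)[OF F] hom_MAT_D(7)[OF G] ent_hom[OF G] in auto)

lemma MAT_comp_hom:
  assumes F: "F \<in> Hom M A B" and G: "G \<in> Hom M B D"
  shows "MAT_comp C F G \<in> Hom M A D"
  unfolding MAT_comp_mk hom_MAT_D(3,4)[OF F] hom_MAT_D(4)[OF G]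
proof (rule mk_arr_hom)
  fix i k k' assume i: "i < length A" and k: "k < length D" "k' < length D" "k \<noteq> k'"
  show "perp (Join C (A ! i) (D ! k) ((\<lambda>j. ent F i j \<Zsemi> ent G j k) ` {..<length B}))
      (Join C (A ! i) (D ! k') ((\<lambda>j. ent F i j \<Zsemi> ent G j k') ` {..<length B}))"
  proof (rule perp_Join_Join[OF perp_family_comp[OF F G i k(1)] perp_family_comp[OF F G i k(2)]])
    fix j j' assume j: "j \<in> {..<length B}" "j' \<in> {..<length B}"
    show "perp (ent F i j \<Zsemi> ent G j k) (ent F i j' \<Zsemi> ent G j' k')"
    \<comment> \<open>For equal middle indices the row of \<open>G\<close> supplies disjointness,
      for different ones the row of \<open>F\<close>.\<close>
    proof (cases "j = j'")
      case True
      then show ?thesis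
        using perp_comp_left[OF ent_perp[OF G _ k] ent_hom[OF G] ent_hom[OF G] ent_hom[OF F i]] j k by auto
    next
      case False
      then show ?thesis
        using perp_comp_right[OF ent_perp[OF F i] ent_hom[OF F i] ent_hom[OF F i] ent_hom[OF G] ent_hom[OF
            G]] j k
        by auto
    qed
  qed
qed (use hom_MAT_D[OF F] hom_MAT_D[OF G] Join_hom[OF perp_family_comp[OF F G]] in auto)

section \<open>Category laws for matrices\<close>

lemma MAT_ident_left:
  assumes F: "F \<in> Hom M A B" shows "MAT_comp C (MAT_ident C A) F = F"
proof -
  have I: "MAT_ident C A \<in> Hom M A A" using MAT_ident_hom hom_MAT_D[OF F] by blast
  show ?thesis
  proof (rule MAT_eqI[OF MAT_comp_hom[OF I F] F])
    fix i j assume ij: "i < length A" "j < length B"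
    have *: "Ident C (A ! i) \<Zsemi> ent F i j = ent F i j" using ident_left[OF ent_hom[OF F ij]] .
    have "ent (MAT_comp C (MAT_ident C A) F) i j = ent (MAT_ident C A) i i \<Zsemi> ent F i j"
      unfolding ent_comp[OF I F ij]
      by (rule Join_delta) (use ij * ent_hom[OF F] zero_comp hom_MAT_D(6)[OF F] in auto)
    then show "ent (MAT_comp C (MAT_ident C A) F) i j = ent F i j" using ij * by simp
  qed
qed

lemma MAT_ident_right:
  assumes F: "F \<in> Hom M A B" shows "MAT_comp C F (MAT_ident C B) = F"
proof -
  have I: "MAT_ident C B \<in> Hom M B B" using MAT_ident_hom hom_MAT_D[OF F] by blast
  show ?thesis
  proof (rule MAT_eqI[OF MAT_comp_hom[OF F I] F])
    fix i j assume ij: "i < length A" "j < length B"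
    have *: "ent F i j \<Zsemi> Ident C (B ! j) = ent F i j" using ident_right[OF ent_hom[OF F ij]] .
    have "ent (MAT_comp C F (MAT_ident C B)) i j = ent F i j \<Zsemi> ent (MAT_ident C B) j j"
      unfolding ent_comp[OF F I ij]
      by (rule Join_delta) (use ij * ent_hom[OF F] comp_zero hom_MAT_D(7)[OF F] in auto)
    then show "ent (MAT_comp C F (MAT_ident C B)) i j = ent F i j" using ij * by simp
  qed
qed

lemma perp_family_cong: "\<lbrakk>perp_family A B I f; \<And>i. i \<in> I \<Longrightarrow> g i = f i\<rbrakk> \<Longrightarrow> perp_family A B I g"
  by (simp add: perp_family_def)

text \<open>Both sides flatten to the join of all triple products over the pairs
  \<open>(j, k)\<close>; the two double joins differ only in the order in which the union is
  taken.\<close>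

lemma MAT_comp_assoc:
  assumes F: "F \<in> Hom M A B" and G: "G \<in> Hom M B D" and H: "H \<in> Hom M D E"
  shows "MAT_comp C (MAT_comp C F G) H = MAT_comp C F (MAT_comp C G H)"
proof -
  note FG = MAT_comp_hom[OF F G] and GH = MAT_comp_hom[OF G H]
  show ?thesis
  proof (rule MAT_eqI[OF MAT_comp_hom[OF FG H] MAT_comp_hom[OF F GH]])
    fix i l assume i: "i < length A" and l: "l < length E"
    have 1: "ent (MAT_comp C F G) i k \<Zsemi> ent H k l =
        Join C (A ! i) (E ! l) ((\<lambda>j. ent F i j \<Zsemi> ent G j k \<Zsemi> ent H k l) ` {..<length B})"
      if "k < length D" for k
      using Join_comp[OF perp_family_comp[OF F G i that] ent_hom[OF H that l]] ent_comp[OF F G i that]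
          by simp
    have 2: "ent F i j \<Zsemi> ent (MAT_comp C G H) j l =
        Join C (A ! i) (E ! l) ((\<lambda>k. ent F i j \<Zsemi> ent G j k \<Zsemi> ent H k l) ` {..<length D})"
      if j: "j < length B" for j
    proof -
      have "(\<lambda>k. ent F i j \<Zsemi> (ent G j k \<Zsemi> ent H k l)) ` {..<length D} =
          (\<lambda>k. ent F i j \<Zsemi> ent G j k \<Zsemi> ent H k l) ` {..<length D}"
        using comp_assoc[OF ent_hom[OF F i j] ent_hom[OF G j] ent_hom[OF H _ l]]
        by (intro image_cong) auto
      then show ?thesis
        using comp_Join[OF perp_family_comp[OF G H j l] ent_hom[OF F i j]] ent_comp[OF G H j l] by simp
    qed
    \<comment> \<open>The outer families are disjoint because their members are the terms of a
      product one of whose factors is itself a product already known to be an arrow.\<close>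
    have d1: "perp_family (A ! i) (E ! l) {..<length D}
        (\<lambda>k. Join C (A ! i) (E ! l) ((\<lambda>j. ent F i j \<Zsemi> ent G j k \<Zsemi> ent H k l) ` {..<length B}))"
      by (rule perp_family_cong[OF perp_family_comp[OF FG H i l]]) (simp add: 1)
    have d2: "perp_family (A ! i) (E ! l) {..<length B}
        (\<lambda>j. Join C (A ! i) (E ! l) ((\<lambda>k. ent F i j \<Zsemi> ent G j k \<Zsemi> ent H k l) ` {..<length D}))"
      by (rule perp_family_cong[OF perp_family_comp[OF F GH i l]]) (simp add: 2)
    have e1: "perp_family (A ! i) (E ! l) {..<length B} (\<lambda>j. ent F i j \<Zsemi> ent G j k \<Zsemi> ent H k l)"
      if "k \<in> {..<length D}" for k
      using perp_family_comp_right[OF perp_family_comp[OF F G i] ent_hom[OF H _ l]] that by simp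
    have e2: "perp_family (A ! i) (E ! l) {..<length D} (\<lambda>k. ent F i j \<Zsemi> ent G j k \<Zsemi> ent H k l)"
      if j: "j \<in> {..<length B}" for j
      by (rule perp_family_cong[OF perp_family_comp_left[OF perp_family_comp[OF G H _ l] ent_hom[OF F i]],
          of j])
        (use j comp_assoc[OF ent_hom[OF F i] ent_hom[OF G] ent_hom[OF H _ l]] in auto)
    have "ent (MAT_comp C (MAT_comp C F G) H) i l = Join C (A ! i) (E ! l)
        (\<Union>k\<in>{..<length D}. (\<lambda>j. ent F i j \<Zsemi> ent G j k \<Zsemi> ent H k l) ` {..<length B})"
      using ent_comp[OF FG H i l] 1 Join_Join[OF d1 e1] by simp
    also have "(\<Union>k\<in>{..<length D}. (\<lambda>j. ent F i j \<Zsemi> ent G j k \<Zsemi> ent H k l) ` {..<length B}) =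
        (\<Union>j\<in>{..<length B}. (\<lambda>k. ent F i j \<Zsemi> ent G j k \<Zsemi> ent H k l) ` {..<length D})" by blast
    also have "Join C (A ! i) (E ! l) \<dots> = ent (MAT_comp C F (MAT_comp C G H)) i l"
      using ent_comp[OF F GH i l] 2 Join_Join[OF d2 e2] by simp
    finally show "ent (MAT_comp C (MAT_comp C F G) H) i l = ent (MAT_comp C F (MAT_comp C G H)) i l" .
  qed
qed

section \<open>Restriction and zeroes for matrices\<close>

lemma ent_rst_comp:
  assumes F: "F \<in> Hom M A B" and G: "G \<in> Hom M A D" and i: "i < length A" and k: "k < length D"
  shows "ent (MAT_comp C (MAT_rst C F) G) i k = rst_row F i \<Zsemi> ent G i k"
proof -
  have "ent (MAT_comp C (MAT_rst C F) G) i k = ent (MAT_rst C F) i i \<Zsemi> ent G i k"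
    unfolding ent_comp[OF MAT_rst_hom[OF F] G i k]
    by (rule Join_delta) (use i k ent_rst[OF F] comp_hom[OF rst_row_hom[OF F] ent_hom[OF G]]
        zero_comp[OF ent_hom[OF G]] hom_MAT_D(6)[OF F] in auto)
  then show ?thesis using ent_rst[OF F i i] by simp
qed

lemma ent_comp_rst:
  assumes F: "F \<in> Hom M A B" and G: "G \<in> Hom M B D" and i: "i < length A" and j: "j < length B"
  shows "ent (MAT_comp C F (MAT_rst C G)) i j = ent F i j \<Zsemi> rst_row G j"
proof -
  have "ent (MAT_comp C F (MAT_rst C G)) i j = ent F i j \<Zsemi> ent (MAT_rst C G) j j"
    unfolding ent_comp[OF F MAT_rst_hom[OF G] i j]
    by (rule Join_delta) (use i j ent_rst[OF G] comp_hom[OF ent_hom[OF F] rst_row_hom[OF G]]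
        comp_zero[OF ent_hom[OF F]] hom_MAT_D(6)[OF G] in auto)
  then show ?thesis using ent_rst[OF G j j] by simp
qed

lemma rst_row_comp:
  assumes F: "F \<in> Hom M A B" and i: "i < length A" and g: "g \<in> Hom C (A ! i) D"
  shows "rst_row F i \<Zsemi> g = Join C (A ! i) D ((\<lambda>j. Rst C (ent F i j) \<Zsemi> g) ` {..<length B})"
  using Join_comp[OF perp_family_ent_rst[OF F i] g] by (simp add: rst_row_eq[OF F])

text \<open>The restrictions of the other entries of row \<open>i\<close> annihilate
  \<open>ent F i j\<close>, being disjoint from it, so only its own restriction acts.\<close>

lemma MAT_rst_comp_self:
  assumes F: "F \<in> Hom M A B" shows "MAT_comp C (MAT_rst C F) F = F"
proof (rule MAT_eqI[OF MAT_comp_hom[OF MAT_rst_hom[OF F] F] F])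
  fix i j assume ij: "i < length A" "j < length B"
  note h = ent_hom[OF F ij]
  have "rst_row F i \<Zsemi> ent F i j = Rst C (ent F i j) \<Zsemi> ent F i j"
    unfolding rst_row_comp[OF F ij(1) h]
    by (rule Join_delta) (use ij comp_hom[OF rst_hom[OF h] h]
        perp_rst_comp_zero[OF ent_perp[OF F ij(1)] ent_hom[OF F ij(1)] h] in auto)
  then show "ent (MAT_comp C (MAT_rst C F) F) i j = ent F i j"
    using ent_rst_comp[OF F F ij] rst_comp_self[OF h] by simp
qed

lemma MAT_rst_commute:
  assumes F: "F \<in> Hom M A B" and G: "G \<in> Hom M A D"
  shows "MAT_comp C (MAT_rst C F) (MAT_rst C G) = MAT_comp C (MAT_rst C G) (MAT_rst C F)"
proof (rule MAT_eqI[OF MAT_comp_hom[OF MAT_rst_hom[OF F] MAT_rst_hom[OF G]]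
        MAT_comp_hom[OF MAT_rst_hom[OF G] MAT_rst_hom[OF F]]])
  fix i j assume ij: "i < length A" "j < length A"
  show "ent (MAT_comp C (MAT_rst C F) (MAT_rst C G)) i j = ent (MAT_comp C (MAT_rst C G) (MAT_rst C F)) i j"
    using ij ent_rst_comp[OF F MAT_rst_hom[OF G] ij] ent_rst_comp[OF G MAT_rst_hom[OF F] ij]
      ent_rst[OF F ij] ent_rst[OF G ij] rst_commute[OF rst_row_hom[OF F ij(1)] rst_row_hom[OF G ij(1)]]
      rst_rst_row[OF F ij(1)] rst_rst_row[OF G ij(1)] hom_MAT_D(6)[OF F]
      comp_zero[OF rst_row_hom[OF F ij(1)]] comp_zero[OF rst_row_hom[OF G ij(1)]] by auto
qed

lemma MAT_rst_rst_comp: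
  assumes F: "F \<in> Hom M A B" and G: "G \<in> Hom M A D"
  shows "MAT_rst C (MAT_comp C (MAT_rst C G) F) = MAT_comp C (MAT_rst C G) (MAT_rst C F)"
proof -
  note H = MAT_comp_hom[OF MAT_rst_hom[OF G] F]
  show ?thesis
  proof (rule MAT_eqI[OF MAT_rst_hom[OF H] MAT_comp_hom[OF MAT_rst_hom[OF G] MAT_rst_hom[OF F]]])
    fix i j assume ij: "i < length A" "j < length A"
    note g = rst_row_hom[OF G ij(1)]
    have "Rst C (rst_row G i \<Zsemi> ent F i k) = rst_row G i \<Zsemi> Rst C (ent F i k)" if "k < length B" for k
      using rst_rst_comp[OF ent_hom[OF F ij(1) that] g] rst_rst_row[OF G ij(1)] by simp
    then have "rst_row (MAT_comp C (MAT_rst C G) F) i = rst_row G i \<Zsemi> rst_row F i"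
      using comp_Join[OF perp_family_ent_rst[OF F ij(1)] g] ent_rst_comp[OF G F ij(1)]
      by (simp add: rst_row_eq[OF H] rst_row_eq[OF F])
    then show "ent (MAT_rst C (MAT_comp C (MAT_rst C G) F)) i j =
        ent (MAT_comp C (MAT_rst C G) (MAT_rst C F)) i j"
      using ij ent_rst[OF H ij] ent_rst_comp[OF G MAT_rst_hom[OF F] ij] ent_rst[OF F ij]
        comp_zero[OF g] hom_MAT_D(6)[OF F] by auto
  qed
qed

text \<open>In row \<open>i\<close>, a path through a middle index \<open>l\<close> other than
  \<open>j\<close> is disjoint from \<open>ent F i j\<close>, so its restriction annihilates that
  entry. What remains is the same axiom for single maps.\<close>

lemma MAT_comp_rst:
  assumes F: "F \<in> Hom M A B" and G: "G \<in> Hom M B D"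
  shows "MAT_comp C F (MAT_rst C G) = MAT_comp C (MAT_rst C (MAT_comp C F G)) F"
proof -
  note FG = MAT_comp_hom[OF F G]
  show ?thesis
  proof (rule MAT_eqI[OF MAT_comp_hom[OF F MAT_rst_hom[OF G]] MAT_comp_hom[OF MAT_rst_hom[OF FG] F]])
    fix i j assume ij: "i < length A" "j < length B"
    note f = ent_hom[OF F ij]
    have "Rst C (ent (MAT_comp C F G) i k) \<Zsemi> ent F i j = ent F i j \<Zsemi> Rst C (ent G j k)"
      if k: "k < length D" for k
    proof -
      have h: "ent F i l \<Zsemi> ent G l k \<in> Hom C (A ! i) (D ! k)" if "l < length B" for l
        using comp_hom[OF ent_hom[OF F ij(1) that] ent_hom[OF G that k]] .
      have "Rst C (ent (MAT_comp C F G) i k) \<Zsemi> ent F i j =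
          Join C (A ! i) (B ! j) ((\<lambda>l. Rst C (ent F i l \<Zsemi> ent G l k) \<Zsemi> ent F i j) ` {..<length B})"
        using rst_Join[OF perp_family_comp[OF F G ij(1) k]] ent_comp[OF F G ij(1) k]
          Join_comp[OF perp_family_rst[OF perp_family_comp[OF F G ij(1) k]] f] by simp
      also have "\<dots> = Rst C (ent F i j \<Zsemi> ent G j k) \<Zsemi> ent F i j"
      proof (rule Join_delta)
        fix l assume l: "l \<in> {..<length B}" "l \<noteq> j"
        have "perp (ent F i l \<Zsemi> ent G l k) (ent F i j)"
          using perp_comp1[OF ent_perp[OF F ij(1)] ent_hom[OF F ij(1)] f ent_hom[OF G _ k]] l ij by auto
        then show "Rst C (ent F i l \<Zsemi> ent G l k) \<Zsemi> ent F i j = Zero C (A ! i) (B ! j)"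
          using perp_rst_comp_zero[OF _ h f] l by simp
      qed (use ij comp_hom[OF rst_hom[OF h] f] in auto)
      finally show ?thesis using comp_rst[OF f ent_hom[OF G ij(2) k]] by simp
    qed
    then have "rst_row (MAT_comp C F G) i \<Zsemi> ent F i j = ent F i j \<Zsemi> rst_row G j"
      using rst_row_comp[OF FG ij(1) f] comp_Join[OF perp_family_ent_rst[OF G ij(2)] f]
      by (simp add: rst_row_eq[OF G])
    then show "ent (MAT_comp C F (MAT_rst C G)) i j = ent (MAT_comp C (MAT_rst C (MAT_comp C F G)) F) i j"
      using ent_comp_rst[OF F G ij] ent_rst_comp[OF FG F ij] by simp
  qed
qed

lemma MAT_comp_zero:
  assumes F: "F \<in> Hom M A B" and D: "set D \<subseteq> Obj C"
  shows "MAT_comp C F (MAT_zero C B D) = MAT_zero C A D"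
proof -
  have Z: "MAT_zero C B D \<in> Hom M B D" "MAT_zero C A D \<in> Hom M A D"
    using MAT_zero_hom hom_MAT_D(1,2)[OF F] D by blast+
  show ?thesis
    by (rule MAT_eqI[OF MAT_comp_hom[OF F Z(1)] Z(2)], unfold ent_comp[OF F Z(1)])
      (use hom_MAT_D(6,7)[OF F] hom_MAT_D(7)[OF Z(1)] comp_zero[OF ent_hom[OF F]] in
        \<open>auto intro!: Join_all_zero\<close>)
qed

lemma MAT_zero_comp:
  assumes F: "F \<in> Hom M A B" and D: "set D \<subseteq> Obj C"
  shows "MAT_comp C (MAT_zero C D A) F = MAT_zero C D B"
proof -
  have Z: "MAT_zero C D A \<in> Hom M D A" "MAT_zero C D B \<in> Hom M D B"
    using MAT_zero_hom hom_MAT_D(1,2)[OF F] D by blast+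
  show ?thesis
    by (rule MAT_eqI[OF MAT_comp_hom[OF Z(1) F] Z(2)], unfold ent_comp[OF Z(1) F])
      (use hom_MAT_D(6,7)[OF F] hom_MAT_D(6)[OF Z(1)] zero_comp[OF ent_hom[OF F]] in
        \<open>auto intro!: Join_all_zero\<close>)
qed

lemma MAT_rst_zero:
  assumes A: "set A \<subseteq> Obj C" and B: "set B \<subseteq> Obj C"
  shows "MAT_rst C (MAT_zero C A B) = MAT_zero C A A"
proof -
  note Z = MAT_zero_hom[OF A B]
  show ?thesis
  proof (rule MAT_eqI[OF MAT_rst_hom[OF Z] MAT_zero_hom[OF A A]])
    fix i j assume ij: "i < length A" "j < length A"
    then have o: "A ! i \<in> Obj C" using A by auto
    have "rst_row (MAT_zero C A B) i = Zero C (A ! i) (A ! i)"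
      unfolding rst_row_eq[OF Z]
      by (rule Join_all_zero[OF o o]) (use ij B rst_zero[OF o] in \<open>auto simp: subset_code(1)\<close>)
    then show "ent (MAT_rst C (MAT_zero C A B)) i j = ent (MAT_zero C A A) i j"
      using ent_rst[OF Z ij] ij by auto
  qed
qed

sublocale MAT: restriction_category_with_zeroes M
proof
  fix F assume "F \<in> Arr M"
  then show "Dom M F \<in> Obj M" "Cod M F \<in> Obj M" by (auto simp: MAT_arr_def)
qed (auto simp: lists_eq_set intro: MAT_ident_hom MAT_comp_hom MAT_ident_left MAT_ident_right MAT_comp_assoc
    MAT_rst_hom MAT_rst_comp_self MAT_rst_commute MAT_rst_rst_comp MAT_comp_rst
    MAT_zero_hom MAT_comp_zero MAT_zero_comp MAT_rst_zero)

text \<open>For the converse, the entries of \<open>F\<close> inherit from \<open>G\<close> the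
  disjointness from the other columns of \<open>G\<close>, so \<open>rst_row F i\<close> acts on
  \<open>ent G i j\<close> only through \<open>Rst C (ent F i j)\<close>.\<close>

lemma MAT_rle_iff:
  assumes F: "F \<in> Hom M A B" and G: "G \<in> Hom M A B"
  shows "rle M F G \<longleftrightarrow> (\<forall>i<length A. \<forall>j<length B. rle C (ent F i j) (ent G i j))"
proof
  assume le: "rle M F G"
  show "\<forall>i<length A. \<forall>j<length B. rle C (ent F i j) (ent G i j)"
  proof (intro allI impI)
    fix i j assume ij: "i < length A" "j < length B"
    have "ent F i j = rst_row F i \<Zsemi> ent G i j"
      using MAT.rle_eq[OF le] ent_rst_comp[OF F G ij] by simp
    then show "rle C (ent F i j) (ent G i j)"
      using rst_comp_rle[OF ent_hom[OF G ij] rst_row_hom[OF F ij(1)]] rst_rst_row[OF F ij(1)] by simp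
  qed
next
  assume le: "\<forall>i<length A. \<forall>j<length B. rle C (ent F i j) (ent G i j)"
  have "MAT_comp C (MAT_rst C F) G = F"
  proof (rule MAT_eqI[OF MAT_comp_hom[OF MAT_rst_hom[OF F] G] F])
    fix i j assume ij: "i < length A" "j < length B"
    note g = ent_hom[OF G ij] and f = ent_hom[OF F ij]
    have "rst_row F i \<Zsemi> ent G i j = Rst C (ent F i j) \<Zsemi> ent G i j"
      unfolding rst_row_comp[OF F ij(1) g]
    proof (rule Join_delta)
      fix k assume k: "k \<in> {..<length B}" "k \<noteq> j"
      have "perp (ent F i k) (ent G i j)"
        using perp_down[OF ent_perp[OF G ij(1)]] rle_refl[OF g] le ij k by blast
      then show "Rst C (ent F i k) \<Zsemi> ent G i j = Zero C (A ! i) (B ! j)"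
        using perp_rst_comp_zero[OF _ ent_hom[OF F ij(1)] g] k by simp
    qed (use ij comp_hom[OF rst_hom[OF f] g] in auto)
    then show "ent (MAT_comp C (MAT_rst C F) G) i j = ent F i j"
      using ent_rst_comp[OF F G ij] rle_eq le ij by simp
  qed
  then show "rle M F G" using MAT.rleI[OF F G] by simp
qed

end

section \<open>Coproducts of lists\<close>

text \<open>Component \<open>i\<close> of block \<open>k\<close> sits at the flat position
  \<open>offset Ass k + i\<close>; this is the number that \<open>MAT_inj\<close> uses.\<close>

definition offset :: "'a list list \<Rightarrow> nat \<Rightarrow> nat" where
  "offset Ass k = length (concat (take k Ass))"

lemma offset_simps [simp]:
  "offset Ass 0 = 0" "offset (A # Ass) (Suc k) = length A + offset Ass k"
  by (simp_all add: offset_def)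

lemma offset_nth:
  assumes "k < length Ass" "i < length (Ass ! k)"
  shows "offset Ass k + i < length (concat Ass)" "concat Ass ! (offset Ass k + i) = Ass ! k ! i"
proof -
  have "offset Ass k + i < length (concat Ass) \<and> concat Ass ! (offset Ass k + i) = Ass ! k ! i"
    using assms
  proof (induction Ass arbitrary: k)
    case (Cons A Ass)
    then show ?case by (cases k) (auto simp: nth_append add.assoc)
  qed simp
  then show "offset Ass k + i < length (concat Ass)" "concat Ass ! (offset Ass k + i) = Ass ! k ! i"
    by blast+
qed

lemma offset_surj:
  assumes "r < length (concat Ass)"
  obtains k i where "k < length Ass" "i < length (Ass ! k)" "r = offset Ass k + i"
proof -
  have "\<exists>k i. k < length Ass \<and> i < length (Ass ! k) \<and> r = offset Ass k + i"
    using assms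
  proof (induction Ass arbitrary: r)
    case (Cons A Ass)
    show ?case
    proof (cases "r < length A")
      case True
      then show ?thesis by (intro exI[of _ 0] exI[of _ r]) simp
    next
      case False
      then have "r - length A < length (concat Ass)" using Cons.prems by auto
      then obtain k i where "k < length Ass" "i < length (Ass ! k)" "r - length A = offset Ass k + i"
        using Cons.IH by blast
      then show ?thesis using False by (intro exI[of _ "Suc k"] exI[of _ i]) auto
    qed
  qed simp
  then show thesis using that by blast
qed

lemma offset_inj:
  assumes "k < length Ass" "i < length (Ass ! k)" "k' < length Ass" "i' < length (Ass ! k')"
    "offset Ass k + i = offset Ass k' + i'"
  shows "k = k' \<and> i = i'"
  using assms
proof (induction Ass arbitrary: k k')
  case (Cons A Ass)
  then show ?case by (cases k; cases k') auto
qed simp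

text \<open>Inverse of the passage from \<open>(k, i)\<close> to \<open>offset Ass k + i\<close>. It
  is determined for positions inside the concatenated list, by \<open>offset_surj\<close> and
  \<open>offset_inj\<close>, and arbitrary beyond.\<close>

definition block_of :: "'a list list \<Rightarrow> nat \<Rightarrow> nat \<times> nat" where
  "block_of Ass r = (THE (k, i). k < length Ass \<and> i < length (Ass ! k) \<and> r = offset Ass k + i)"

lemma block_of_offset [simp]:
  "\<lbrakk>k < length Ass; i < length (Ass ! k)\<rbrakk> \<Longrightarrow> block_of Ass (offset Ass k + i) = (k, i)"
  unfolding block_of_def by (rule the_equality) (auto dest: offset_inj)

section \<open>Concatenation of lists as coproduct\<close>

context finitely_disjoint_perp_restriction_category
begin

lemma set_concat_obj: "set As \<subseteq> lists (Obj C) \<Longrightarrow> set (concat As) \<subseteq> Obj C"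
  by auto

lemma nth_obj: "\<lbrakk>set As \<subseteq> lists (Obj C); k < length As\<rbrakk> \<Longrightarrow> set (As ! k) \<subseteq> Obj C"
  using nth_mem by fastforce

lemma nth_nth_obj:
  assumes "set As \<subseteq> lists (Obj C)" "k < length As" "i < length (As ! k)" shows "As ! k ! i \<in> Obj C"
  using nth_obj[OF assms(1,2)] nth_mem[OF assms(3)] by blast

lemma MAT_inj_mk:
  "MAT_inj C As k = mk_arr (As ! k) (concat As)
    (\<lambda>i j. if j = offset As k + i then Ident C (As ! k ! i) else Zero C (As ! k ! i) (concat As ! j))"
  by (simp add: MAT_inj_def mk_arr_def offset_def)

lemma ent_inj:
  "\<lbrakk>i < length (As ! k); j < length (concat As)\<rbrakk> \<Longrightarrow> ent (MAT_inj C As k) i j =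
    (if j = offset As k + i then Ident C (As ! k ! i) else Zero C (As ! k ! i) (concat As ! j))"
  by (simp add: MAT_inj_mk)

lemma MAT_inj_hom:
  assumes As: "set As \<subseteq> lists (Obj C)" and k: "k < length As"
  shows "MAT_inj C As k \<in> Hom M (As ! k) (concat As)"
  unfolding MAT_inj_mk
proof (rule mk_arr_hom_monomial[OF nth_obj[OF As k] set_concat_obj[OF As]])
  fix i j assume ij: "i < length (As ! k)" "j < length (concat As)"
  have o: "As ! k ! i \<in> Obj C" "concat As ! j \<in> Obj C"
    using nth_nth_obj[OF As k ij(1)] nth_mem[OF ij(2)] set_concat_obj[OF As] by blast+
  show "(if j = offset As k + i then Ident C (As ! k ! i) else Zero C (As ! k ! i) (concat As ! j))
      \<in> Hom C (As ! k ! i) (concat As ! j)"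
    using ident_hom[OF o(1)] zero_hom[OF o] offset_nth(2)[OF k ij(1)] by simp
qed auto

lemma ent_inj_comp:
  assumes As: "set As \<subseteq> lists (Obj C)" and k: "k < length As" and h: "h \<in> Hom M (concat As) B"
    and i: "i < length (As ! k)" and c: "c < length B"
  shows "ent (MAT_comp C (MAT_inj C As k) h) i c = ent h (offset As k + i) c"
proof -
  note o = offset_nth[OF k i] and I = MAT_inj_hom[OF As k]
  have hh: "ent h (offset As k + i) c \<in> Hom C (As ! k ! i) (B ! c)" using ent_hom[OF h o(1) c] o(2) by simp
  have "ent (MAT_comp C (MAT_inj C As k) h) i c =
      ent (MAT_inj C As k) i (offset As k + i) \<Zsemi> ent h (offset As k + i) c"
    unfolding ent_comp[OF I h i c]
  proof (rule Join_delta)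
    fix j assume j: "j \<in> {..<length (concat As)}" "j \<noteq> offset As k + i"
    then show "ent (MAT_inj C As k) i j \<Zsemi> ent h j c = Zero C (As ! k ! i) (B ! c)"
      using ent_inj[OF i] zero_comp[OF ent_hom[OF h _ c] nth_nth_obj[OF As k i]] by simp
  qed (use o hh ent_inj[OF i o(1)] ident_left[OF hh] in auto)
  then show ?thesis using ent_inj[OF i o(1)] ident_left[OF hh] by simp
qed

lemma MAT_inj_comp_iff:
  assumes As: "set As \<subseteq> lists (Obj C)" and k: "k < length As" and h: "h \<in> Hom M (concat As) B"
    and f: "f \<in> Hom M (As ! k) B"
  shows "MAT_comp C (MAT_inj C As k) h = f \<longleftrightarrow>
    (\<forall>i<length (As ! k). \<forall>c<length B. ent h (offset As k + i) c = ent f i c)"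
  using ent_inj_comp[OF As k h] MAT_eqI[OF MAT_comp_hom[OF MAT_inj_hom[OF As k] h] f] by auto

text \<open>The mediating matrix stacks the given matrices on top of each other. Disjointness is a
  condition within a single row, so stacking preserves it and no compatibility between the
  components arises.\<close>

lemma MAT_sum_universal:
  assumes As: "set As \<subseteq> lists (Obj C)" and B: "set B \<subseteq> Obj C" and "length fs = length As"
    and fs: "\<forall>k < length As. fs ! k \<in> Hom M (As ! k) B"
  shows "\<exists>!h. h \<in> Hom M (concat As) B \<and> (\<forall>k < length As. MAT_comp C (MAT_inj C As k) h = fs ! k)"
proof (rule ex_ex1I)
  let ?h = "mk_arr (concat As) B (\<lambda>r c. ent (fs ! fst (block_of As r)) (snd (block_of As r)) c)"
  have h: "?h \<in> Hom M (concat As) B"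
  proof (rule mk_arr_hom[OF set_concat_obj[OF As] B])
    fix r c assume r: "r < length (concat As)" and c: "c < length B"
    obtain k i where k: "k < length As" "i < length (As ! k)" and r': "r = offset As k + i"
      using offset_surj[OF r] .
    show "ent (fs ! fst (block_of As r)) (snd (block_of As r)) c \<in> Hom C (concat As ! r) (B ! c)"
      unfolding r' using ent_hom[OF fs[rule_format, OF k(1)] k(2) c] k offset_nth(2)[OF k] by simp
  next
    fix r c c' assume r: "r < length (concat As)" and c: "c < length B" "c' < length B" "c \<noteq> c'"
    obtain k i where k: "k < length As" "i < length (As ! k)" and r': "r = offset As k + i"
      using offset_surj[OF r] .
    show "perp (ent (fs ! fst (block_of As r)) (snd (block_of As r)) c)
        (ent (fs ! fst (block_of As r)) (snd (block_of As r)) c')"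
      unfolding r' using ent_perp[OF fs[rule_format, OF k(1)] k(2) c] k by simp
  qed
  have "MAT_comp C (MAT_inj C As k) ?h = fs ! k" if k: "k < length As" for k
    using MAT_inj_comp_iff[OF As k h fs[rule_format, OF k]] k offset_nth(1)[OF k] by simp
  then show "\<exists>h. h \<in> Hom M (concat As) B \<and> (\<forall>k < length As. MAT_comp C (MAT_inj C As k) h = fs ! k)"
    using h by blast
next
  fix h h'
  assume h: "h \<in> Hom M (concat As) B \<and> (\<forall>k < length As. MAT_comp C (MAT_inj C As k) h = fs ! k)"
    and h': "h' \<in> Hom M (concat As) B \<and> (\<forall>k < length As. MAT_comp C (MAT_inj C As k) h' = fs ! k)"
  show "h = h'"
  proof (rule MAT_eqI[of _ "concat As" B])
    fix r c assume r: "r < length (concat As)" and c: "c < length B"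
    obtain k i where k: "k < length As" "i < length (As ! k)" and r': "r = offset As k + i"
      using offset_surj[OF r] .
    show "ent h r c = ent h' r c"
      using ent_inj_comp[OF As k(1) _ k(2) c, of h] ent_inj_comp[OF As k(1) _ k(2) c, of h'] h h' k(1)
      unfolding r' by simp
  qed (use h h' in auto)
qed

lemma MAT_inj_total:
  assumes As: "set As \<subseteq> lists (Obj C)" and k: "k < length As"
  shows "total M (MAT_inj C As k)"
proof -
  note I = MAT_inj_hom[OF As k]
  have "MAT_rst C (MAT_inj C As k) = MAT_ident C (As ! k)"
  proof (rule MAT_eqI[OF MAT_rst_hom[OF I] MAT_ident_hom[OF nth_obj[OF As k]]])
    fix i j assume ij: "i < length (As ! k)" "j < length (As ! k)"
    note o = offset_nth[OF k ij(1)] and ob = nth_nth_obj[OF As k ij(1)]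
    have "rst_row (MAT_inj C As k) i = Rst C (ent (MAT_inj C As k) i (offset As k + i))"
      unfolding rst_row_eq[OF I]
    proof (rule Join_delta)
      fix c assume c: "c \<in> {..<length (concat As)}" "c \<noteq> offset As k + i"
      have "concat As ! c \<in> Obj C" using c set_concat_obj[OF As] nth_mem by blast
      then show "Rst C (ent (MAT_inj C As k) i c) = Zero C (As ! k ! i) (As ! k ! i)"
        using c ent_inj[OF ij(1)] rst_zero[OF ob] by simp
    qed (use o ent_inj[OF ij(1) o(1)] rst_ident[OF ob] ident_hom[OF ob] in auto)
    then show "ent (MAT_rst C (MAT_inj C As k)) i j = ent (MAT_ident C (As ! k)) i j"
      using ent_rst[OF I ij] ij ent_inj[OF ij(1) o(1)] rst_ident[OF ob] by auto
  qed
  then show ?thesis using I hom_MAT_D(3)[OF I] by (simp add: total_def Hom_def)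
qed

sublocale MAT: cocartesian_restriction_category M
  by unfold_locales
    (use MAT_inj_hom MAT_sum_universal MAT_inj_total in \<open>auto simp: lists_eq_set subset_eq\<close>)

lemma Copair_eqI:
  assumes As: "set As \<subseteq> lists (Obj C)" and h: "h \<in> Hom M (concat As) B" and "length fs = length As"
    and fs: "\<And>k. k < length As \<Longrightarrow> fs ! k \<in> Hom M (As ! k) B"
    and e: "\<And>k i c. \<lbrakk>k < length As; i < length (As ! k); c < length B\<rbrakk>
      \<Longrightarrow> ent h (offset As k + i) c = ent (fs ! k) i c"
  shows "Copair M As B fs = h"
  unfolding Copair_def
proof (rule the1_equality)
  show "\<exists>!h. h \<in> Hom M (Sum M As) B \<and> (\<forall>i<length As. Inj M As i \<Zsemi>\<^bsub>M\<^esub> h = fs ! i)"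
    using MAT_sum_universal[OF As hom_MAT_D(2)[OF h] assms(3)] fs by simp
  show "h \<in> Hom M (Sum M As) B \<and> (\<forall>i<length As. Inj M As i \<Zsemi>\<^bsub>M\<^esub> h = fs ! i)"
    using h MAT_inj_comp_iff[OF As _ h fs] e by simp
qed

lemma Copair_MAT:
  assumes As: "set As \<subseteq> lists (Obj C)" and B: "set B \<subseteq> Obj C" and "length fs = length As"
    and fs: "\<And>k. k < length As \<Longrightarrow> fs ! k \<in> Hom M (As ! k) B"
  shows "Copair M As B fs \<in> Hom M (concat As) B"
    and "\<And>k. k < length As \<Longrightarrow> MAT_comp C (MAT_inj C As k) (Copair M As B fs) = fs ! k"
    and "\<And>k i c. \<lbrakk>k < length As; i < length (As ! k); c < length B\<rbrakk>
      \<Longrightarrow> ent (Copair M As B fs) (offset As k + i) c = ent (fs ! k) i c"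
proof -
  have "\<exists>!h. h \<in> Hom M (Sum M As) B \<and> (\<forall>i<length As. Inj M As i \<Zsemi>\<^bsub>M\<^esub> h = fs ! i)"
    using MAT_sum_universal[OF As B assms(3)] fs by simp
  from theI'[OF this] show h: "Copair M As B fs \<in> Hom M (concat As) B"
    and c: "\<And>k. k < length As \<Longrightarrow> MAT_comp C (MAT_inj C As k) (Copair M As B fs) = fs ! k"
    unfolding Copair_def[symmetric] by simp_all
  show "\<And>k i c. \<lbrakk>k < length As; i < length (As ! k); c < length B\<rbrakk>
      \<Longrightarrow> ent (Copair M As B fs) (offset As k + i) c = ent (fs ! k) i c"
    using MAT_inj_comp_iff[OF As _ h fs] c by blast
qed

section \<open>Sums of maps as block diagonal matrices\<close>

context
  fixes As Bs :: "'o list list" and fs :: "('o, 'm) marr list"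
  assumes len: "length fs = length As" "length Bs = length As"
    and fs: "\<And>k. k < length As \<Longrightarrow> fs ! k \<in> Hom M (As ! k) (Bs ! k)"
    and As: "set As \<subseteq> lists (Obj C)" and Bs: "set Bs \<subseteq> lists (Obj C)"
begin

lemma SumMap_Copair:
  "SumMap M fs = Copair M As (concat Bs) (map (\<lambda>k. MAT_comp C (fs ! k) (MAT_inj C Bs k)) [0..<length As])"
proof -
  have "map mdom fs = As" using len hom_MAT_D(3)[OF fs] by (intro nth_equalityI) auto
  moreover have "map mcod fs = Bs" using len hom_MAT_D(4)[OF fs] by (intro nth_equalityI) auto
  ultimately show ?thesis using len by (simp add: SumMap_def)
qed

lemma SumMap_summand_hom:
  "k < length As \<Longrightarrow> MAT_comp C (fs ! k) (MAT_inj C Bs k) \<in> Hom M (As ! k) (concat Bs)"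
  using MAT_comp_hom[OF fs MAT_inj_hom[OF Bs]] len by simp

lemma SumMap_hom: "SumMap M fs \<in> Hom M (concat As) (concat Bs)"
  unfolding SumMap_Copair
  by (rule Copair_MAT(1)[OF As set_concat_obj[OF Bs]]) (auto simp: SumMap_summand_hom)

text \<open>Restricting along injection \<open>k\<close> replaces the sum by \<open>fs ! k\<close>
  followed by an injection, and the latter reads only the rows of \<open>h\<close> in block
  \<open>k\<close>.\<close>

lemma ent_SumMap_comp:
  assumes h: "h \<in> Hom M (concat Bs) D" and k: "k < length As" and i: "i < length (As ! k)" and c: "c <
      length D"
  shows "ent (MAT_comp C (SumMap M fs) h) (offset As k + i) c =
    Join C (As ! k ! i) (D ! c) ((\<lambda>l. ent (fs ! k) i l \<Zsemi> ent h (offset Bs k + l) c) ` {..<length (Bs ! k)})"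
proof -
  have kB: "k < length Bs" using k len by simp
  note I = MAT_inj_hom[OF As k] and J = MAT_inj_hom[OF Bs kB]
  have *: "MAT_comp C (MAT_inj C As k) (SumMap M fs) = MAT_comp C (fs ! k) (MAT_inj C Bs k)"
    unfolding SumMap_Copair
    using Copair_MAT(2)[OF As set_concat_obj[OF Bs], of "map (\<lambda>k. MAT_comp C (fs ! k) (MAT_inj C Bs k))
        [0..<length As]" k]
      SumMap_summand_hom k by simp
  have "ent (MAT_comp C (SumMap M fs) h) (offset As k + i) c =
      ent (MAT_comp C (MAT_inj C As k) (MAT_comp C (SumMap M fs) h)) i c"
    using ent_inj_comp[OF As k MAT_comp_hom[OF SumMap_hom h] i c] by simp
  also have "\<dots> = ent (MAT_comp C (fs ! k) (MAT_comp C (MAT_inj C Bs k) h)) i c"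
    using MAT_comp_assoc[OF I SumMap_hom h] MAT_comp_assoc[OF fs[OF k] J h] * by simp
  also have "\<dots> = Join C (As ! k ! i) (D ! c)
      ((\<lambda>l. ent (fs ! k) i l \<Zsemi> ent h (offset Bs k + l) c) ` {..<length (Bs ! k)})"
    unfolding ent_comp[OF fs[OF k] MAT_comp_hom[OF J h] i c]
    by (rule arg_cong[of _ _ "Join C _ _"], rule image_cong[OF refl]) (use ent_inj_comp[OF Bs kB h _ c] in
        simp)
  finally show ?thesis .
qed

lemma ent_SumMap:
  assumes k: "k < length As" "i < length (As ! k)" and k': "k' < length As" "i' < length (Bs ! k')"
  shows "ent (SumMap M fs) (offset As k + i) (offset Bs k' + i') =
    (if k = k' then ent (fs ! k) i i' else Zero C (As ! k ! i) (Bs ! k' ! i'))"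
proof -
  have kB: "k < length Bs" and kB': "k' < length Bs" using k k' len by auto
  note c = offset_nth[OF kB' k'(2)]
  note J = MAT_inj_hom[OF Bs kB]
  have h: "ent (fs ! k) i l \<in> Hom C (As ! k ! i) (Bs ! k ! l)" if "l < length (Bs ! k)" for l
    using ent_hom[OF fs[OF k(1)] k(2) that] .
  have z: "Zero C (As ! k ! i) (Bs ! k' ! i') \<in> Hom C (As ! k ! i) (Bs ! k' ! i')"
    using zero_hom nth_nth_obj As Bs k k' kB' by simp
  have "ent (SumMap M fs) (offset As k + i) (offset Bs k' + i') =
      ent (MAT_comp C (fs ! k) (MAT_inj C Bs k)) i (offset Bs k' + i')"
    unfolding SumMap_Copair
    using Copair_MAT(3)[OF As set_concat_obj[OF Bs] _ _ k c(1),
        of "map (\<lambda>k. MAT_comp C (fs ! k) (MAT_inj C Bs k)) [0..<length As]"]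
      SumMap_summand_hom k by simp
  also have "\<dots> = Join C (As ! k ! i) (Bs ! k' ! i')
      ((\<lambda>l. ent (fs ! k) i l \<Zsemi> ent (MAT_inj C Bs k) l (offset Bs k' + i')) ` {..<length (Bs ! k)})"
    using ent_comp[OF fs[OF k(1)] J k(2) c(1)] c(2) by simp
  also have "\<dots> = (if k = k' then ent (fs ! k) i i' else Zero C (As ! k ! i) (Bs ! k' ! i'))"
  proof (cases "k = k'")
    case True
    have "Join C (As ! k ! i) (Bs ! k' ! i')
        ((\<lambda>l. ent (fs ! k) i l \<Zsemi> ent (MAT_inj C Bs k) l (offset Bs k' + i')) ` {..<length (Bs ! k)}) =
        ent (fs ! k) i i' \<Zsemi> ent (MAT_inj C Bs k) i' (offset Bs k' + i')"
    proof (rule Join_delta)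
      fix l assume l: "l \<in> {..<length (Bs ! k)}" "l \<noteq> i'"
      then show "ent (fs ! k) i l \<Zsemi> ent (MAT_inj C Bs k) l (offset Bs k' + i') =
          Zero C (As ! k ! i) (Bs ! k' ! i')"
        using ent_inj[OF _ c(1), of l k] True c(2) comp_zero[OF h nth_nth_obj[OF Bs kB' k'(2)]] by simp
    qed (use True k' ent_inj[OF _ c(1), of i' k] ident_right[OF h] h in auto)
    then show ?thesis using True k'(2) ent_inj[OF _ c(1), of i' k] ident_right[OF h] by simp
  next
    case False
    have "Join C (As ! k ! i) (Bs ! k' ! i')
        ((\<lambda>l. ent (fs ! k) i l \<Zsemi> ent (MAT_inj C Bs k) l (offset Bs k' + i')) ` {..<length (Bs ! k)}) =
        Zero C (As ! k ! i) (Bs ! k' ! i')"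
    proof (rule Join_all_zero[OF nth_nth_obj[OF As k] nth_nth_obj[OF Bs kB' k'(2)]])
      fix l assume l: "l \<in> {..<length (Bs ! k)}"
      then have "offset Bs k' + i' \<noteq> offset Bs k + l" using offset_inj[OF kB' k'(2) kB] False by auto
      then show "ent (fs ! k) i l \<Zsemi> ent (MAT_inj C Bs k) l (offset Bs k' + i') =
          Zero C (As ! k ! i) (Bs ! k' ! i')"
        using ent_inj[OF _ c(1), of l k] l c(2) comp_zero[OF h nth_nth_obj[OF Bs kB' k'(2)]] by simp
    qed
    then show ?thesis using False by simp
  qed
  finally show ?thesis .
qed

text \<open>The universal property concerns maps out of a concatenation, so a product with the sum
  as right factor has to be computed from entries: outside block \<open>k\<close> the column of the
  sum is zero.\<close>

lemma ent_comp_SumMap: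
  assumes d: "d \<in> Hom M A (concat As)" and k: "k < length As" and i: "i < length A" and c: "c < length (Bs !
      k)"
  shows "ent (MAT_comp C d (SumMap M fs)) i (offset Bs k + c) =
    Join C (A ! i) (Bs ! k ! c) ((\<lambda>l. ent d i (offset As k + l) \<Zsemi> ent (fs ! k) l c) ` {..<length (As ! k)})"
proof -
  have kB: "k < length Bs" using k len by simp
  note o = offset_nth[OF kB c] and D = perp_family_comp[OF d SumMap_hom i offset_nth(1)[OF kB c]]
  let ?f = "\<lambda>r. ent d i r \<Zsemi> ent (SumMap M fs) r (offset Bs k + c)"
  let ?K = "(\<lambda>l. offset As k + l) ` {..<length (As ! k)}"
  have "ent (MAT_comp C d (SumMap M fs)) i (offset Bs k + c) =
      Join C (A ! i) (Bs ! k ! c) (?f ` {..<length (concat As)})"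
    using ent_comp[OF d SumMap_hom i o(1)] o(2) by simp
  also have "\<dots> = Join C (A ! i) (Bs ! k ! c) (?f ` ?K)"
  proof (rule Join_support)
    show "perp_family (A ! i) (Bs ! k ! c) {..<length (concat As)} ?f" using D o(2) by simp
    show "?K \<subseteq> {..<length (concat As)}" using offset_nth(1)[OF k] by auto
    fix r assume r: "r \<in> {..<length (concat As)} - ?K"
    then obtain k' l where k': "k' < length As" "l < length (As ! k')" and r': "r = offset As k' + l"
      using offset_surj[of r As] by auto
    have "k' \<noteq> k" using r r' k' by auto
    then show "?f r = Zero C (A ! i) (Bs ! k ! c)"
      unfolding r' using ent_SumMap[OF k' k c] offset_nth[OF k'] comp_zero[OF ent_hom[OF d i]]
        nth_nth_obj[OF Bs kB c] by metis
  qed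
  also have "?f ` ?K = (\<lambda>l. ent d i (offset As k + l) \<Zsemi> ent (fs ! k) l c) ` {..<length (As ! k)}"
    using ent_SumMap[OF k _ k c] by (auto simp: image_image intro!: image_cong)
  finally show ?thesis .
qed

end

end

section \<open>Extensivity and the induced interference relation\<close>

context finitely_disjoint_perp_restriction_category
begin

text \<open>The codiagonal stacks identity matrices, so the product merges the columns numbered
  \<open>c\<close> of the \<open>n\<close> blocks of \<open>d\<close>. The merged maps are different
  entries of one row of \<open>d\<close>, hence disjoint.\<close>

lemma ent_comp_Codiag:
  assumes A: "set A \<subseteq> Obj C" and d: "d \<in> Hom M A' (concat (replicate n A))"
    and i: "i < length A'" and c: "c < length A"
  shows "ent (MAT_comp C d (Codiag M n A)) i c =
    Join C (A' ! i) (A ! c) ((\<lambda>k. ent d i (offset (replicate n A) k + c)) ` {..<n})"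
    and "Codiag M n A \<in> Hom M (concat (replicate n A)) A"
    and "perp_family (A' ! i) (A ! c) {..<n} (\<lambda>k. ent d i (offset (replicate n A) k + c))"
proof -
  let ?As = "replicate n A"
  have As: "set ?As \<subseteq> lists (Obj C)" using A by auto
  have id: "replicate n (MAT_ident C A) ! k \<in> Hom M (?As ! k) A" if "k < length ?As" for k
    using that MAT_ident_hom[OF A] by simp
  note N = Copair_MAT[OF As A _ id, simplified]
  show h: "Codiag M n A \<in> Hom M (concat ?As) A" unfolding Codiag_def using N(1) by simp
  have e: "ent (Codiag M n A) (offset ?As k + l) c = (if l =
      c then Ident C (A ! l) else Zero C (A ! l) (A ! c))"
    if "k < n" "l < length A" for k l
    using N(3) that c by (simp add: Codiag_def)
  have cA: "A ! c \<in> Obj C" using A c by auto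
  have A'i: "A' ! i \<in> Obj C" using hom_MAT_D(6)[OF d i] .
  have o: "offset ?As k + c < length (concat ?As)" "concat ?As ! (offset ?As k + c) = A ! c" if "k < n"
      for k
    using offset_nth[of k ?As c] that c by auto
  have dh: "ent d i (offset ?As k + c) \<in> Hom C (A' ! i) (A ! c)" if "k < n" for k
    using ent_hom[OF d i o(1)] o(2) that by simp
  let ?f = "\<lambda>r. ent d i r \<Zsemi> ent (Codiag M n A) r c"
  let ?K = "(\<lambda>k. offset ?As k + c) ` {..<n}"
  show "perp_family (A' ! i) (A ! c) {..<n} (\<lambda>k. ent d i (offset ?As k + c))"
  proof (rule perp_familyI[OF A'i cA])
    fix k k' assume k: "k \<in> {..<n}" "k' \<in> {..<n}" "k \<noteq> k'"
    then have "offset ?As k + c \<noteq> offset ?As k' + c" using offset_inj[of k ?As c k' c] c by auto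
    then show "perp (ent d i (offset ?As k + c)) (ent d i (offset ?As k' + c))"
      using ent_perp[OF d i o(1) o(1)] k by simp
  qed (use dh in auto)
  have "ent (MAT_comp C d (Codiag M n A)) i c = Join C (A' ! i) (A ! c) (?f ` {..<length (concat ?As)})"
    using ent_comp[OF d h i c] .
  also have "\<dots> = Join C (A' ! i) (A ! c) (?f ` ?K)"
  proof (rule Join_support[OF perp_family_comp[OF d h i c]])
    show "?K \<subseteq> {..<length (concat ?As)}" using o(1) by auto
    fix r assume r: "r \<in> {..<length (concat ?As)} - ?K"
    then obtain k l where k: "k < n" "l < length A" and r': "r = offset ?As k + l"
      using offset_surj[of r ?As] by (metis DiffD1 length_replicate lessThan_iff nth_replicate)
    have "l \<noteq> c" using r r' k by auto
    then show "?f r = Zero C (A' ! i) (A ! c)"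
      using e[OF k] r' comp_zero[OF ent_hom[OF d i] cA, of r] r offset_nth[of k ?As l] k by simp
  qed
  also have "?f ` ?K = (\<lambda>k. ent d i (offset ?As k + c)) ` {..<n}"
    unfolding image_image using e c ident_right[OF dh] by (intro image_cong) auto
  finally show "ent (MAT_comp C d (Codiag M n A)) i c =
    Join C (A' ! i) (A ! c) ((\<lambda>k. ent d i (offset ?As k + c)) ` {..<n})" .
qed

text \<open>The part of the domain of definition of row \<open>i\<close> on which \<open>f\<close>
  lands in the summand \<open>Bs ! k\<close>.\<close>

definition rst_block :: "'o list \<Rightarrow> 'o list list \<Rightarrow> ('o, 'm) marr \<Rightarrow> nat \<Rightarrow> nat \<Rightarrow> 'm" where
  "rst_block A Bs f i k =
    Join C (A ! i) (A ! i) ((\<lambda>j. Rst C (ent f i (offset Bs k + j))) ` {..<length (Bs ! k)})"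

text \<open>The explicit matrix of the bracket of \<open>f\<close>: each of its blocks is diagonal,
  and block \<open>k\<close> carries the partial domains \<open>rst_block\<close> for the summand
  \<open>k\<close>.\<close>

definition bracket_mat :: "'o list \<Rightarrow> 'o list list \<Rightarrow> ('o, 'm) marr \<Rightarrow> ('o, 'm) marr" where
  "bracket_mat A Bs f = mk_arr A (concat (replicate (length Bs) A))
    (\<lambda>i r. if snd (block_of (replicate (length Bs) A) r) = i
      then rst_block A Bs f i (fst (block_of (replicate (length Bs) A) r))
      else Zero C (A ! i) (concat (replicate (length Bs) A) ! r))"

context
  fixes A :: "'o list" and Bs :: "'o list list" and f :: "('o, 'm) marr"
  assumes Bs: "set Bs \<subseteq> lists (Obj C)" and f: "f \<in> Hom M A (concat Bs)"
begin

private abbreviation "As \<equiv> replicate (length Bs) A"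

lemma A_obj: "set A \<subseteq> Obj C" "set As \<subseteq> lists (Obj C)"
  using hom_MAT_D(1)[OF f] by auto

lemma As_offset:
  assumes "k < length Bs" "l < length A"
  shows "offset As k + l < length (concat As)" "concat As ! (offset As k + l) = A ! l"
    "block_of As (offset As k + l) = (k, l)"
  using offset_nth[of k As l] block_of_offset[of k As l] assms by auto

lemma As_offset_surj:
  assumes "r < length (concat As)"
  obtains k l where "k < length Bs" "l < length A" "r = offset As k + l"
  using offset_surj[OF assms] by (metis length_replicate nth_replicate)

lemma ent_bracket_mat:
  "\<lbrakk>i < length A; k < length Bs; l < length A\<rbrakk> \<Longrightarrow> ent (bracket_mat A Bs f) i (offset As k + l) =
    (if l = i then rst_block A Bs f i k else Zero C (A ! i) (A ! l))"
  using As_offset[of k l] by (simp add: bracket_mat_def)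

lemma perp_family_rst_block:
  assumes i: "i < length A" and k: "k < length Bs"
  shows "perp_family (A ! i) (A ! i) {..<length (Bs ! k)} (\<lambda>j. Rst C (ent f i (offset Bs k + j)))"
proof (rule perp_familyI)
  fix j j' assume "j \<in> {..<length (Bs ! k)}" "j' \<in> {..<length (Bs ! k)}" "j \<noteq> j'"
  then show "perp (Rst C (ent f i (offset Bs k + j))) (Rst C (ent f i (offset Bs k + j')))"
    using perp_rst[OF ent_perp[OF f i offset_nth(1)[OF k] offset_nth(1)[OF k]]] by simp
qed (use hom_MAT_D(6)[OF f i] rst_hom[OF ent_hom[OF f i offset_nth(1)[OF k]]] in auto)

lemma rst_block_hom:
  "\<lbrakk>i < length A; k < length Bs\<rbrakk> \<Longrightarrow> rst_block A Bs f i k \<in> Hom C (A ! i) (A ! i)"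
  unfolding rst_block_def by (rule Join_hom[OF perp_family_rst_block])

lemma rst_block_perp:
  assumes i: "i < length A" and k: "k < length Bs" "k' < length Bs" "k \<noteq> k'"
  shows "perp (rst_block A Bs f i k) (rst_block A Bs f i k')"
  unfolding rst_block_def
proof (rule perp_Join_Join[OF perp_family_rst_block[OF i k(1)] perp_family_rst_block[OF i k(2)]])
  fix j j' assume j: "j \<in> {..<length (Bs ! k)}" "j' \<in> {..<length (Bs ! k')}"
  then have "offset Bs k + j \<noteq> offset Bs k' + j'" using offset_inj[of k Bs j k' j'] k by auto
  then show "perp (Rst C (ent f i (offset Bs k + j))) (Rst C (ent f i (offset Bs k' + j')))"
    using perp_rst[OF ent_perp[OF f i offset_nth(1)[OF k(1)] offset_nth(1)[OF k(2)]]] j by simp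
qed

lemma bracket_mat_hom: "bracket_mat A Bs f \<in> Hom M A (concat As)"
  unfolding bracket_mat_def
proof (rule mk_arr_hom[OF A_obj(1) set_concat_obj[OF A_obj(2)]])
  fix i r assume i: "i < length A" and "r < length (concat As)"
  then obtain k l where k: "k < length Bs" "l < length A" and r: "r = offset As k + l"
    using As_offset_surj by blast
  show "(if snd (block_of As r) = i then rst_block A Bs f i (fst (block_of As r))
      else Zero C (A ! i) (concat As ! r)) \<in> Hom C (A ! i) (concat As ! r)"
    unfolding r using As_offset[OF k] rst_block_hom[OF i k(1)] zero_hom hom_MAT_D(6)[OF f] i k by auto
next
  fix i r r' assume i: "i < length A" and "r < length (concat As)" "r' < length (concat As)" "r \<noteq> r'"
  then obtain k l k' l' where k: "k < length Bs" "l < length A" and r: "r = offset As k + l"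
    and k': "k' < length Bs" "l' < length A" and r': "r' = offset As k' + l'"
    using As_offset_surj by metis
  have ne: "k \<noteq> k' \<or> l \<noteq> l'" using \<open>r \<noteq> r'\<close> r r' by auto
  have o: "A ! i \<in> Obj C" "A ! l \<in> Obj C" "A ! l' \<in> Obj C" using hom_MAT_D(6)[OF f] i k k' by auto
  show "perp (if snd (block_of As r) = i then rst_block A Bs f i (fst (block_of As r))
      else Zero C (A ! i) (concat As ! r)) (if snd (block_of As r') =
          i then rst_block A Bs f i (fst (block_of As r'))
      else Zero C (A ! i) (concat As ! r'))"
    using As_offset[OF k] As_offset[OF k'] rst_block_perp[OF i k(1) k'(1)] ne r r'
      perp_zero_left[OF rst_block_hom[OF i k'(1)] o(2)] perp_zero_right[OF rst_block_hom[OF i k(1)] o(3)]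
      perp_zero_left[OF zero_hom[OF o(1,3)] o(2)] by auto
qed

text \<open>An entry is fixed by its own restriction and annihilated by the restrictions of the
  other entries in its row, so joining the restrictions over block \<open>k\<close> keeps exactly
  the entries of that block.\<close>

lemma rst_block_comp:
  assumes i: "i < length A" and k: "k < length Bs" and k': "k' < length Bs" "j' < length (Bs ! k')"
  shows "rst_block A Bs f i k \<Zsemi> ent f i (offset Bs k' + j') =
    (if k = k' then ent f i (offset Bs k' + j') else Zero C (A ! i) (Bs ! k' ! j'))"
proof -
  note o = offset_nth[OF k'] and ok = offset_nth(1)[OF k]
  have g: "ent f i (offset Bs k' + j') \<in> Hom C (A ! i) (Bs ! k' ! j')"
    using ent_hom[OF f i o(1)] o(2) by simp
  have z: "Rst C (ent f i (offset Bs k + j)) \<Zsemi> ent f i (offset Bs k' + j') = Zero C (A ! i) (Bs ! k' ! j')"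
    if "j < length (Bs ! k)" "offset Bs k + j \<noteq> offset Bs k' + j'" for j
    using perp_rst_comp_zero[OF ent_perp[OF f i ok o(1)] ent_hom[OF f i ok] g] that by simp
  have eq: "rst_block A Bs f i k \<Zsemi> ent f i (offset Bs k' + j') = Join C (A ! i) (Bs ! k' ! j')
      ((\<lambda>j. Rst C (ent f i (offset Bs k + j)) \<Zsemi> ent f i (offset Bs k' + j')) ` {..<length (Bs ! k)})"
    unfolding rst_block_def by (rule Join_comp[OF perp_family_rst_block[OF i k] g])
  show ?thesis
  proof (cases "k = k'")
    case True
    have "rst_block A Bs f i k \<Zsemi> ent f i (offset Bs k' + j') =
        Rst C (ent f i (offset Bs k + j')) \<Zsemi> ent f i (offset Bs k' + j')"
      unfolding eq by (rule Join_delta) (use True k'(2) z rst_comp_self[OF g] g in auto)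
    then show ?thesis using True rst_comp_self[OF g] by simp
  next
    case False
    have "rst_block A Bs f i k \<Zsemi> ent f i (offset Bs k' + j') = Zero C (A ! i) (Bs ! k' ! j')"
      unfolding eq
    proof (rule Join_all_zero[OF hom_dom[OF g] hom_cod[OF g]])
      fix j assume j: "j \<in> {..<length (Bs ! k)}"
      then show "Rst C (ent f i (offset Bs k + j)) \<Zsemi> ent f i (offset Bs k' + j') =
          Zero C (A ! i) (Bs ! k' ! j')"
        using z offset_inj[OF k _ k', of j] False by auto
    qed
    then show ?thesis using False by simp
  qed
qed

text \<open>Every column belongs to exactly one block, so joining block by block gives the whole
  row. On the diagonal this is the first bracket equation.\<close>

lemma Join_rst_block:
  assumes i: "i < length A"
  shows "Join C (A ! i) (A ! i) ((\<lambda>k. rst_block A Bs f i k) ` {..<length Bs}) = rst_row f i"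
proof -
  have "perp_family (A ! i) (A ! i) {..<length Bs} (\<lambda>k. rst_block A Bs f i k)"
    using rst_block_hom[OF i] rst_block_perp[OF i] hom_MAT_D(6)[OF f i] by (intro perp_familyI) auto
  then have "Join C (A ! i) (A ! i) ((\<lambda>k. rst_block A Bs f i k) ` {..<length Bs}) = Join C (A ! i) (A ! i)
      (\<Union>k\<in>{..<length Bs}. (\<lambda>j. Rst C (ent f i (offset Bs k + j))) ` {..<length (Bs ! k)})"
    unfolding rst_block_def using Join_Join[OF _ perp_family_rst_block[OF i], of "{..<length Bs}"] by simp
  also have "(\<Union>k\<in>{..<length Bs}. (\<lambda>j. Rst C (ent f i (offset Bs k + j))) ` {..<length (Bs ! k)}) =
      (\<lambda>j. Rst C (ent f i j)) ` {..<length (concat Bs)}"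
  proof
    show "(\<lambda>j. Rst C (ent f i j)) ` {..<length (concat Bs)} \<subseteq>
        (\<Union>k\<in>{..<length Bs}. (\<lambda>j. Rst C (ent f i (offset Bs k + j))) ` {..<length (Bs ! k)})"
    proof (rule image_subsetI)
      fix r assume "r \<in> {..<length (concat Bs)}"
      then obtain k j where "k < length Bs" "j < length (Bs ! k)" "r = offset Bs k + j"
        using offset_surj[of r Bs] by auto
      then show "Rst C (ent f i r) \<in> (\<Union>k\<in>{..<length Bs}. (\<lambda>j. Rst C (ent f i (offset Bs k + j))) `
          {..<length (Bs ! k)})"
        by blast
    qed
  qed (use offset_nth(1)[of _ Bs] in auto)
  finally show ?thesis using rst_row_eq[OF f] by simp
qed

lemma replicate_concat_obj: "set (replicate (length Bs) (concat Bs)) \<subseteq> lists (Obj C)"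
  using set_concat_obj[OF Bs] by (simp add: set_replicate_conv_if lists_eq_set)

lemma SumMap_replicate_hom: "SumMap M (replicate (length Bs) f) \<in> Hom M (concat As) (concat (replicate
    (length Bs) (concat Bs)))"
  by (rule SumMap_hom) (use A_obj f hom_MAT_D[OF f] in auto)

lemma SumMap_inj_hom: "SumMap M (map (MAT_inj C Bs) [0..<length Bs]) \<in> Hom M (concat Bs) (concat (replicate
    (length Bs) (concat Bs)))"
  by (rule SumMap_hom) (use Bs hom_MAT_D[OF f] MAT_inj_hom[OF Bs] in auto)

lemma ent_comp_SumMap_replicate:
  assumes d: "d \<in> Hom M A (concat As)" and i: "i < length A" and k: "k < length Bs" and c: "c < length
      (concat Bs)"
  shows "ent (MAT_comp C d (SumMap M (replicate (length Bs) f))) i (offset (replicate (length Bs) (concat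
      Bs)) k + c) =
    Join C (A ! i) (concat Bs ! c) ((\<lambda>l. ent d i (offset As k + l) \<Zsemi> ent f l c) ` {..<length A})"
  using ent_comp_SumMap[of "replicate (length Bs) f" As "replicate (length Bs) (concat Bs)" d A k i c]
    d i k c A_obj f hom_MAT_D(2)[OF f] replicate_concat_obj by simp

text \<open>The sum of the injections places block \<open>k\<close> of \<open>f\<close> at position
  \<open>k\<close> of the \<open>k\<close>-th copy of the whole sum; all other positions in that
  copy are zero.\<close>

lemma ent_comp_SumMap_inj:
  assumes i: "i < length A" and k: "k < length Bs" and c: "k' < length Bs" "j < length (Bs ! k')"
  shows "ent (MAT_comp C f (SumMap M (map (MAT_inj C Bs) [0..<length Bs]))) i
      (offset (replicate (length Bs) (concat Bs)) k + (offset Bs k' + j)) =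
    (if k = k' then ent f i (offset Bs k' + j) else Zero C (A ! i) (Bs ! k' ! j))"
proof -
  note o = offset_nth[OF c] and ok = offset_nth[OF k]
  have h: "ent f i (offset Bs k + l) \<in> Hom C (A ! i) (Bs ! k ! l)" if "l < length (Bs ! k)" for l
    using ent_hom[OF f i ok(1)[OF that]] ok(2)[OF that] by simp
  have e: "ent (MAT_inj C Bs k) l (offset Bs k' + j) =
      (if k = k' \<and> l = j then Ident C (Bs ! k ! l) else Zero C (Bs ! k ! l) (Bs ! k' ! j))"
    if "l < length (Bs ! k)" for l
    using ent_inj[OF that o(1)] o(2) offset_inj[OF c k that] by auto
  have "ent (MAT_comp C f (SumMap M (map (MAT_inj C Bs) [0..<length Bs]))) i
      (offset (replicate (length Bs) (concat Bs)) k + (offset Bs k' + j)) =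
    Join C (A ! i) (Bs ! k' ! j) ((\<lambda>l. ent f i (offset Bs k + l) \<Zsemi> ent (MAT_inj C Bs k) l (offset Bs k' +
        j)) ` {..<length (Bs ! k)})"
    using ent_comp_SumMap[of "map (MAT_inj C Bs) [0..<length Bs]" Bs "replicate (length Bs) (concat Bs)" f A
        k i "offset Bs k' + j"]
      Bs f i k o MAT_inj_hom[OF Bs] replicate_concat_obj by simp
  also have "\<dots> = (if k = k' then ent f i (offset Bs k' + j) else Zero C (A ! i) (Bs ! k' ! j))"
  proof (cases "k = k'")
    case True
    have jk: "j < length (Bs ! k)" using c True by simp
    have "Join C (A ! i) (Bs ! k' ! j) ((\<lambda>l. ent f i (offset Bs k + l) \<Zsemi> ent (MAT_inj C Bs k) l (offset Bs
        k' + j)) ` {..<length (Bs ! k)})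
        = ent f i (offset Bs k + j) \<Zsemi> ent (MAT_inj C Bs k) j (offset Bs k' + j)"
      by (rule Join_delta) (use True jk e h ident_right[OF h] comp_zero[OF h nth_nth_obj[OF Bs c]] in auto)
    then show ?thesis using True jk e ident_right[OF h] by simp
  next
    case False
    have "Join C (A ! i) (Bs ! k' ! j) ((\<lambda>l. ent f i (offset Bs k + l) \<Zsemi> ent (MAT_inj C Bs k) l (offset Bs
        k' + j)) ` {..<length (Bs ! k)})
        = Zero C (A ! i) (Bs ! k' ! j)"
      by (rule Join_all_zero) (use False e comp_zero[OF h nth_nth_obj[OF Bs c]] hom_MAT_D(6)[OF f i]
          nth_nth_obj[OF Bs c] in auto)
    then show ?thesis using False by simp
  qed
  finally show ?thesis .
qed

lemma is_bracket_bracket_mat: "is_bracket M A Bs f (bracket_mat A Bs f)"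
  unfolding is_bracket_def
proof (intro conjI)
  let ?d = "bracket_mat A Bs f"
  note d = bracket_mat_hom
  show "?d \<in> Hom M A (Sum M As)" using d by simp
  have "MAT_rst C f = MAT_comp C ?d (Codiag M (length Bs) A)"
  proof (rule MAT_eqI[OF MAT_rst_hom[OF f]])
    show "MAT_comp C ?d (Codiag M (length Bs) A) \<in> Hom M A A"
    \<comment> \<open>\<open>ent_comp_Codiag\<close> is stated for a given row and column; the empty
      list has neither and is treated separately.\<close>
    proof (cases "A = []")
      case True
      have "Codiag M (length Bs) A \<in> Hom M (concat As) A"
        unfolding Codiag_def
        using Copair_MAT(1)[OF A_obj(2) A_obj(1), of "replicate (length Bs) (MAT_ident C A)"]
            MAT_ident_hom[OF A_obj(1)]
        by simp
      then show ?thesis using MAT_comp_hom[OF d] by blast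
    next
      case False
      then show ?thesis using MAT_comp_hom[OF d ent_comp_Codiag(2)[OF A_obj(1) d, of 0 0]] by simp
    qed
    fix i j assume ij: "i < length A" "j < length A"
    have e: "ent ?d i (offset As k + j) = (if j = i then rst_block A Bs f i k else Zero C (A ! i) (A ! j))"
      if "k < length Bs" for k using ent_bracket_mat ij that by simp
    have "ent (MAT_comp C ?d (Codiag M (length Bs) A)) i j =
        Join C (A ! i) (A ! j) ((\<lambda>k. if j =
            i then rst_block A Bs f i k else Zero C (A ! i) (A ! j)) ` {..<length Bs})"
      unfolding ent_comp_Codiag(1)[OF A_obj(1) d ij]
      by (rule arg_cong[of _ _ "Join C _ _"], rule image_cong[OF refl]) (use e in simp)
    also have "\<dots> = (if i = j then rst_row f i else Zero C (A ! i) (A ! j))"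
      using Join_rst_block[OF ij(1)] Join_all_zero[OF hom_MAT_D(6)[OF f ij(1)] hom_MAT_D(6)[OF f ij(2)], of
          "{..<length Bs}"]
      by auto
    finally show "ent (MAT_rst C f) i j = ent (MAT_comp C ?d (Codiag M (length Bs) A)) i j"
      using ent_rst[OF f ij] by simp
  qed
  then show "Rst M f = ?d \<Zsemi>\<^bsub>M\<^esub> Codiag M (length Bs) A" by simp
  have "MAT_comp C ?d (SumMap M (replicate (length Bs) f)) =
      MAT_comp C f (SumMap M (map (MAT_inj C Bs) [0..<length Bs]))"
  proof (rule MAT_eqI[OF MAT_comp_hom[OF d SumMap_replicate_hom] MAT_comp_hom[OF f SumMap_inj_hom]])
    fix i r assume i: "i < length A" and "r < length (concat (replicate (length Bs) (concat Bs)))"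
    then obtain k c where k: "k < length Bs" and c: "c < length (concat Bs)"
      and r: "r = offset (replicate (length Bs) (concat Bs)) k + c"
      using offset_surj by (metis length_replicate nth_replicate)
    obtain k' j where k': "k' < length Bs" "j < length (Bs ! k')" and c': "c = offset Bs k' + j"
      using offset_surj[OF c] .
    have g: "ent f i c \<in> Hom C (A ! i) (concat Bs ! c)" using ent_hom[OF f i c] .
    have e: "ent ?d i (offset As k + l) = (if l = i then rst_block A Bs f i k else Zero C (A ! i) (A ! l))"
      if "l < length A" for l using ent_bracket_mat i k that by simp
    have "Join C (A ! i) (concat Bs ! c) ((\<lambda>l. ent ?d i (offset As k + l) \<Zsemi> ent f l c) ` {..<length A}) =
        ent ?d i (offset As k + i) \<Zsemi> ent f i c"
      by (rule Join_delta) (use i e comp_hom[OF rst_block_hom[OF i k] g]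
          zero_comp[OF ent_hom[OF f _ c] hom_MAT_D(6)[OF f i]] in auto)
    then show "ent (MAT_comp C ?d (SumMap M (replicate (length Bs) f))) i r =
        ent (MAT_comp C f (SumMap M (map (MAT_inj C Bs) [0..<length Bs]))) i r"
      using ent_comp_SumMap_replicate[OF d i k c] ent_comp_SumMap_inj[OF i k k'] e[OF i]
        rst_block_comp[OF i k k'] by (simp add: r c')
  qed
  then show "?d \<Zsemi>\<^bsub>M\<^esub> SumMap M (replicate (length Bs) f) = f \<Zsemi>\<^bsub>M\<^esub> SumMap M (map (Inj M Bs) [0..<length Bs])"
    by simp
qed

text \<open>By the first bracket equation the entries of \<open>d\<close> off the block diagonals
  lie below zero, and a diagonal entry \<open>x\<close> lies below \<open>rst_row f i\<close>, hence
  is a restriction idempotent. The second equation prescribes how \<open>x\<close> acts on the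
  entries of row \<open>i\<close> of \<open>f\<close>, and \<open>x = x \<Zsemi> rst_row f i\<close>
  recovers \<open>x\<close> from that action.\<close>

lemma is_bracket_unique:
  assumes "is_bracket M A Bs f d" shows "d = bracket_mat A Bs f"
proof -
  have d: "d \<in> Hom M A (concat As)" and d1: "MAT_rst C f = MAT_comp C d (Codiag M (length Bs) A)"
    and d2: "MAT_comp C d (SumMap M (replicate (length Bs) f)) =
      MAT_comp C f (SumMap M (map (MAT_inj C Bs) [0..<length Bs]))"
    using assms by (simp_all add: is_bracket_def)
  show ?thesis
  proof (rule MAT_eqI[OF d bracket_mat_hom])
    fix i r assume i: "i < length A" and "r < length (concat As)"
    then obtain k l where k: "k < length Bs" and l: "l < length A" and r: "r = offset As k + l"
      using As_offset_surj by blast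
    note oi = hom_MAT_D(6)[OF f i]
    have dh: "ent d i (offset As k + m) \<in> Hom C (A ! i) (A ! m)" if "m < length A" for m
      using ent_hom[OF d i] As_offset[OF k that] by metis
    have le: "rle C (ent d i (offset As k + m)) (if i = m then rst_row f i else Zero C (A ! i) (A ! m))"
      if "m < length A" for m
      using Join_rle[OF ent_comp_Codiag(3)[OF A_obj(1) d i that], of k]
        ent_comp_Codiag(1)[OF A_obj(1) d i that] d1 ent_rst[OF f i that] k by simp
    have off: "ent d i (offset As k + m) = Zero C (A ! i) (A ! m)" if "m < length A" "m \<noteq> i" for m
      using le[OF that(1)] rle_zero[OF _ oi hom_MAT_D(6)[OF f that(1)]] that(2) by simp
    define x where "x = ent d i (offset As k + i)"
    have x: "x \<in> Hom C (A ! i) (A ! i)" unfolding x_def by (rule dh[OF i])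
    have xle: "rle C x (rst_row f i)" using le[OF i] by (simp add: x_def)
    have "rle C (rst_row f i) (Ident C (A ! i))"
      using rle_ident_iff[OF rst_row_hom[OF f i]] rst_rst_row[OF f i] by simp
    then have rx: "Rst C x = x" using rle_trans[OF xle] rle_ident_iff[OF x] by simp
    have xf: "x \<Zsemi> ent f i (offset Bs k' + j) =
        (if k = k' then ent f i (offset Bs k' + j) else Zero C (A ! i) (Bs ! k' ! j))"
      if k': "k' < length Bs" "j < length (Bs ! k')" for k' j
    proof -
      note o = offset_nth[OF k']
      have "Join C (A ! i) (concat Bs ! (offset Bs k' + j))
          ((\<lambda>l. ent d i (offset As k + l) \<Zsemi> ent f l (offset Bs k' + j)) ` {..<length A}) =
          ent d i (offset As k + i) \<Zsemi> ent f i (offset Bs k' + j)"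
        by (rule Join_delta) (use i off comp_hom[OF dh[OF i] ent_hom[OF f i o(1)]]
            zero_comp[OF ent_hom[OF f _ o(1)] oi] in auto)
      then show ?thesis
        using ent_comp_SumMap_replicate[OF d i k o(1)] ent_comp_SumMap_inj[OF i k k'] d2
            by (simp add: x_def)
    qed
    have "x = x \<Zsemi> rst_row f i" using rle_eq[OF xle] rx by simp
    also have "\<dots> = Join C (A ! i) (A ! i) ((\<lambda>c. x \<Zsemi> Rst C (ent f i c)) ` {..<length (concat Bs)})"
      unfolding rst_row_eq[OF f] by (rule comp_Join[OF perp_family_ent_rst[OF f i] x])
    also have "\<dots> = Join C (A ! i) (A ! i) ((\<lambda>c. x \<Zsemi> Rst C (ent f i c)) ` (\<lambda>j. offset Bs k + j) ` {..<length
        (Bs ! k)})"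
    proof (rule Join_support[OF perp_family_comp_left[OF perp_family_ent_rst[OF f i] x]])
      show "(\<lambda>j. offset Bs k + j) ` {..<length (Bs ! k)} \<subseteq> {..<length (concat Bs)}"
        using offset_nth(1)[OF k] by auto
      fix c assume c: "c \<in> {..<length (concat Bs)} - (\<lambda>j. offset Bs k + j) ` {..<length (Bs ! k)}"
      then obtain k' j where k': "k' < length Bs" "j < length (Bs ! k')" and c': "c = offset Bs k' + j"
        using offset_surj[of c Bs] by auto
      have "k \<noteq> k'" using c c' k' by auto
      then have "x \<Zsemi> ent f i c = Zero C (A ! i) (Bs ! k' ! j)" using xf[OF k'] c' by simp
      moreover have "x \<Zsemi> Rst C (ent f i c) = Rst C (x \<Zsemi> ent f i c)"
        using rst_rst_comp[OF ent_hom[OF f i] x, of c] rx c by simp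
      ultimately show "x \<Zsemi> Rst C (ent f i c) = Zero C (A ! i) (A ! i)"
        using rst_zero[OF oi nth_nth_obj[OF Bs k']] by simp
    qed
    also have "(\<lambda>c. x \<Zsemi> Rst C (ent f i c)) ` (\<lambda>j. offset Bs k + j) ` {..<length (Bs ! k)} =
        (\<lambda>j. Rst C (ent f i (offset Bs k + j))) ` {..<length (Bs ! k)}"
      unfolding image_image
    proof (rule image_cong[OF refl])
      fix j assume j: "j \<in> {..<length (Bs ! k)}"
      then show "x \<Zsemi> Rst C (ent f i (offset Bs k + j)) = Rst C (ent f i (offset Bs k + j))"
        using rst_rst_comp[OF ent_hom[OF f i offset_nth(1)[OF k]] x, of j] rx xf[OF k, of j] by simp
    qed
    finally have "x = rst_block A Bs f i k" by (simp add: rst_block_def)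
    then show "ent d i r = ent (bracket_mat A Bs f) i r"
      using ent_bracket_mat[OF i k l] off[OF l] by (auto simp: r x_def)
  qed
qed

lemma is_bracket_iff: "is_bracket M A Bs f d \<longleftrightarrow> d = bracket_mat A Bs f"
  using is_bracket_unique is_bracket_bracket_mat by blast

end

sublocale MAT: extensive_restriction_category M
  by unfold_locales (use is_bracket_iff in \<open>auto simp: subset_eq\<close>)

section \<open>The interference relation induced by decisions, in terms of entries\<close>

lemma Copair_pair:
  assumes f: "f \<in> Hom M A D" and g: "g \<in> Hom M B D"
  shows "Copair M [A, B] D [f, g] =
      mk_arr (A @ B) D (\<lambda>i c. if i < length A then ent f i c else ent g (i - length A) c)" (is "_ = ?h")
    and "mk_arr (A @ B) D (\<lambda>i c.
        if i < length A then ent f i c else ent g (i - length A) c) \<in> Hom M (A @ B) D"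
proof -
  show h: "?h \<in> Hom M (A @ B) D"
    by (rule mk_arr_hom)
      (use hom_MAT_D[OF f] hom_MAT_D[OF g] ent_hom[OF f] ent_hom[OF g] ent_perp[OF f] ent_perp[OF g] in
        \<open>auto simp: nth_append\<close>)
  show "Copair M [A, B] D [f, g] = ?h"
  proof (rule Copair_eqI)
    show "set [A, B] \<subseteq> lists (Obj C)" using hom_MAT_D(1)[OF f] hom_MAT_D(1)[OF g] by auto
    show "?h \<in> Hom M (concat [A, B]) D" using h by simp
    fix k assume "k < length [A, B]"
    then have "k = 0 \<or> k = 1" by auto
    then show "[f, g] ! k \<in> Hom M ([A, B] ! k) D" using f g by auto
    fix i c assume "i < length ([A, B] ! k)" "c < length D"
    then show "ent ?h (offset [A, B] k + i) c = ent ([f, g] ! k) i c"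
      using \<open>k = 0 \<or> k = 1\<close> by auto
  qed simp
qed

lemma Inj_inv_hom:
  assumes A: "set A \<subseteq> Obj C" and m: "m < 2"
  shows "Inj_inv M [A, A] m \<in> Hom M (A @ A) A"
proof -
  have "m = 0 \<or> m = 1" using m by auto
  then show ?thesis
    using Copair_pair[OF MAT_ident_hom[OF A] MAT_zero_hom[OF A A]]
      Copair_pair[OF MAT_zero_hom[OF A A] MAT_ident_hom[OF A]] by (auto simp: Inj_inv_def)
qed

text \<open>\<open>Inj_inv\<close> at \<open>m\<close> consists of an identity block in place
  \<open>m\<close> and a zero block, so the product extracts block \<open>m\<close> of the columns
  of \<open>d\<close>.\<close>

lemma ent_comp_Inj_inv:
  assumes A: "set A \<subseteq> Obj C" and d: "d \<in> Hom M D (A @ A)" and m: "m < 2"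
    and i: "i < length D" and c: "c < length A"
  shows "ent (MAT_comp C d (Inj_inv M [A, A] m)) i c = ent d i (offset [A, A] m + c)"
proof -
  let ?fs = "map (\<lambda>k. if k = m then MAT_ident C A else MAT_zero C A A) [0..<2]"
  have As: "set [A, A] \<subseteq> lists (Obj C)" using A by auto
  have nth: "[A, A] ! k = A" if "k < 2" for k using that by (cases k) auto
  have fs: "?fs ! k \<in> Hom M ([A, A] ! k) A" if "k < length [A, A]" for k
    using that nth MAT_ident_hom[OF A] MAT_zero_hom[OF A A] by simp
  have I: "Inj_inv M [A, A] m = Copair M [A, A] A ?fs"
  proof -
    have "m = 0 \<or> m = 1" using m by auto
    then show ?thesis by (auto simp: Inj_inv_def numeral_2_eq_2)
  qed
  note N = Copair_MAT[OF As A _ fs, folded I, simplified]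
  have e: "ent (Inj_inv M [A, A] m) (offset [A, A] k + l) c =
      (if k = m \<and> l = c then Ident C (A ! c) else Zero C (A ! l) (A ! c))"
    if "k < 2" "l < length A" for k l
    using N(3)[of k l c] that c nth by auto
  have o: "offset [A, A] m + c < length (A @ A)" "(A @ A) ! (offset [A, A] m + c) = A ! c"
    using offset_nth[of m "[A, A]" c] m c nth[OF m] by auto
  have h: "ent d i (offset [A, A] m + c) \<in> Hom C (D ! i) (A ! c)" using ent_hom[OF d i o(1)] o(2) by simp
  have cA: "A ! c \<in> Obj C" using A c by auto
  have "ent (MAT_comp C d (Inj_inv M [A, A] m)) i c =
      ent d i (offset [A, A] m + c) \<Zsemi> ent (Inj_inv M [A, A] m) (offset [A, A] m + c) c"
    unfolding ent_comp[OF d N(1) i c]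
  proof (rule Join_delta)
    fix r assume r: "r \<in> {..<length (A @ A)}" "r \<noteq> offset [A, A] m + c"
    then obtain k l where kl: "k < 2" "l < length A" and r': "r = offset [A, A] k + l"
      using offset_surj[of r "[A, A]"] nth
          by (metis append_Nil2 concat.simps length_Cons lessThan_iff list.size(3) numeral_2_eq_2)
    have "\<not> (k = m \<and> l = c)" using r r' by auto
    then have "ent (Inj_inv M [A, A] m) r c = Zero C ((A @ A) ! r) (A ! c)"
      using e[OF kl] r' offset_nth(2)[of k "[A, A]" l] kl nth by auto
    then show "ent d i r \<Zsemi> ent (Inj_inv M [A, A] m) r c = Zero C (D ! i) (A ! c)"
      using comp_zero[OF ent_hom[OF d i] cA, of r] r by simp
  qed (use o e[OF m c] ident_right[OF h] h in auto)
  then show ?thesis using e[OF m c] ident_right[OF h] by simp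
qed

lemma replicate_two: "replicate 2 A = [A, A]"
  by (simp add: numeral_2_eq_2)

text \<open>A decision witnessing the relation must carry the row restrictions of \<open>F\<close>
  and \<open>G\<close> on the diagonals of its two blocks; as entries of one row they are disjoint.
  Conversely, disjoint row restrictions assemble to such a matrix. The later claims about
  \<open>perp_d\<close> reduce to entries through this equivalence.\<close>

lemma perp_d_iff:
  assumes F: "F \<in> Hom M A B" and G: "G \<in> Hom M A D"
  shows "perp_d M F G \<longleftrightarrow> (\<forall>i<length A. \<forall>j<length B. \<forall>k<length D. perp (ent F i j) (ent G i k))"
proof
  note A = hom_MAT_D(1)[OF F]
  assume "perp_d M F G"
  then obtain d where d: "d \<in> Hom M A (A @ A)"
    and dF: "MAT_comp C d (Inj_inv M [A, A] 0) = MAT_rst C F"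
    and dG: "MAT_comp C d (Inj_inv M [A, A] 1) = MAT_rst C G"
    using hom_MAT_D(3)[OF F] by (auto simp: perp_d_def is_decision_def replicate_two)
  show "\<forall>i<length A. \<forall>j<length B. \<forall>k<length D. perp (ent F i j) (ent G i k)"
  proof (intro allI impI)
    fix i j k assume i: "i < length A" and j: "j < length B" and k: "k < length D"
    have 1: "ent d i i = rst_row F i" "ent d i (length A + i) = rst_row G i"
      using ent_comp_Inj_inv[OF A d _ i i, of 0] ent_comp_Inj_inv[OF A d _ i i, of 1]
        dF dG ent_rst[OF F i i] ent_rst[OF G i i] by simp_all
    \<comment> \<open>Columns \<open>i\<close> and \<open>length A + i\<close> are different columns
      of the same row of \<open>d\<close>.\<close>
    then have "perp (rst_row F i) (rst_row G i)"
      using ent_perp[OF d i, of i "length A + i"] i by (cases A) auto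
    moreover have "rle C (Rst C (ent F i j)) (rst_row F i)"
      using Join_rle[OF perp_family_ent_rst[OF F i], of j] j by (simp add: rst_row_eq[OF F])
    moreover have "rle C (Rst C (ent G i k)) (rst_row G i)"
      using Join_rle[OF perp_family_ent_rst[OF G i], of k] k by (simp add: rst_row_eq[OF G])
    ultimately show "perp (ent F i j) (ent G i k)"
      using perp_down perp_rst_iff[OF ent_hom[OF F i j] ent_hom[OF G i k]] by blast
  qed
next
  note A = hom_MAT_D(1)[OF F]
  have As: "set [A, A] \<subseteq> lists (Obj C)" using A by auto
  assume p: "\<forall>i<length A. \<forall>j<length B. \<forall>k<length D. perp (ent F i j) (ent G i k)"
  define e where "e k i = (if k = 0 then rst_row F i else rst_row G i)" for k :: nat and i
  have eh: "e k i \<in> Hom C (A ! i) (A ! i)" "Rst C (e k i) = e k i" if "i < length A" for k i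
    using rst_row_hom[OF F that] rst_row_hom[OF G that] rst_rst_row[OF F that] rst_rst_row[OF G that]
    by (auto simp: e_def)
  have ep: "perp (e k i) (e k' i)" if i: "i < length A" and "k < 2" "k' < 2" "k \<noteq> k'" for k k' i
  proof -
    have "perp (rst_row F i) (rst_row G i)"
      unfolding rst_row_eq[OF F] rst_row_eq[OF G]
      using p i perp_rst by (intro perp_Join_Join[OF perp_family_ent_rst[OF F i] perp_family_ent_rst[OF G
          i]]) blast
    then show ?thesis using that perp_sym by (auto simp: e_def)
  qed
  have nth: "[A, A] ! k = A" if "k < 2" for k using that by (cases k) auto
  let ?b = "block_of [A, A]"
  define d where "d = mk_arr A (A @ A)
    (\<lambda>i r. if snd (?b r) = i then e (fst (?b r)) i else Zero C (A ! i) ((A @ A) ! r))"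
  have surj: "\<exists>k l. k < 2 \<and> l < length A \<and> r = offset [A, A] k + l" if "r < length (A @ A)" for r
    using that offset_surj[of r "[A, A]"] nth
    by (metis append_Nil2 concat.simps length_Cons list.size(3) numeral_2_eq_2)
  have o: "offset [A, A] k + l < length (A @ A)" "(A @ A) ! (offset [A, A] k + l) = A ! l"
    "?b (offset [A, A] k + l) = (k, l)" if "k < 2" "l < length A" for k l
    using offset_nth[of k "[A, A]" l] block_of_offset[of k "[A, A]" l] that nth by auto
  have ob: "A ! i \<in> Obj C" if "i < length A" for i using A that by auto
  have d: "d \<in> Hom M A (A @ A)" unfolding d_def
  proof (rule mk_arr_hom[OF A])
    show "set (A @ A) \<subseteq> Obj C" using A by simp
    fix i r assume i: "i < length A" and "r < length (A @ A)"
    then obtain k l where kl: "k < 2" "l < length A" and r: "r = offset [A, A] k + l" using surj by blast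
    show "(if snd (?b r) = i then e (fst (?b r)) i else Zero C (A ! i) ((A @ A) ! r)) \<in> Hom C (A ! i) ((A @
        A) ! r)"
      unfolding r o[OF kl] using eh[OF i] zero_hom[OF ob[OF i] ob[OF kl(2)]] by auto
  next
    fix i r r' assume i: "i < length A" and "r < length (A @ A)" "r' < length (A @ A)" "r \<noteq> r'"
    then obtain k l k' l' where kl: "k < 2" "l < length A" and r: "r = offset [A, A] k + l"
      and kl': "k' < 2" "l' < length A" and r': "r' = offset [A, A] k' + l'" using surj by metis
    have "k \<noteq> k' \<or> l \<noteq> l'" using \<open>r \<noteq> r'\<close> r r' by auto
    then show "perp (if snd (?b r) = i then e (fst (?b r)) i else Zero C (A ! i) ((A @ A) ! r))
        (if snd (?b r') = i then e (fst (?b r')) i else Zero C (A ! i) ((A @ A) ! r'))"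
      unfolding r r' o[OF kl] o[OF kl'] using ep[OF i kl(1) kl'(1)]
        perp_zero_left[OF eh(1)[OF i] ob[OF kl(2)]] perp_zero_right[OF eh(1)[OF i] ob[OF kl'(2)]]
        perp_zero_left[OF zero_hom[OF ob[OF i] ob[OF kl'(2)]] ob[OF kl(2)]] by auto
  qed
  have de: "ent d i (offset [A, A] k + l) = (if l = i then e k i else Zero C (A ! i) (A ! l))"
    if "i < length A" "k < 2" "l < length A" for i k l
    using that o by (simp add: d_def)
  have d': "d \<in> Hom M A (concat [A, A])" using d by simp
  \<comment> \<open>Both blocks of \<open>d\<close> are diagonal with restriction idempotents as
    entries, so forming the bracket reproduces \<open>d\<close>; this is what makes it a
    decision.\<close>
  have "bracket_mat A [A, A] d = d"
  proof (rule MAT_eqI[of _ A "A @ A"])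
    show "bracket_mat A [A, A] d \<in> Hom M A (A @ A)" using bracket_mat_hom[OF As d'] by simp
    fix i r assume i: "i < length A" and "r < length (A @ A)"
    then obtain k l where kl: "k < 2" "l < length A" and r: "r = offset [A, A] k + l" using surj by blast
    have "rst_block A [A, A] d i k = Rst C (ent d i (offset [A, A] k + i))"
      unfolding rst_block_def nth[OF kl(1)]
      by (rule Join_delta) (use i de[OF i kl(1)] eh[OF i] rst_zero ob in auto)
    then show "ent (bracket_mat A [A, A] d) i r = ent d i r"
      using ent_bracket_mat[OF As d' i, of k l] kl de[OF i kl] de[OF i kl(1) i] eh[OF i] r by simp
  qed (rule d)
  then have dec: "is_decision M 2 A d"
    using d is_bracket_iff[OF As d'] hom_MAT_D(3)[OF d]
    by (simp add: is_decision_def bracket_def replicate_two)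
  have "MAT_comp C d (Inj_inv M [A, A] m) = MAT_rst C H"
    if m: "m < 2" and H: "H \<in> Hom M A E" "\<And>i. e m i = rst_row H i" for m H E
  proof (rule MAT_eqI[OF _ MAT_rst_hom[OF H(1)]])
    show "MAT_comp C d (Inj_inv M [A, A] m) \<in> Hom M A A"
      using MAT_comp_hom[OF d Inj_inv_hom[OF A m]] .
    fix i j assume ij: "i < length A" "j < length A"
    show "ent (MAT_comp C d (Inj_inv M [A, A] m)) i j = ent (MAT_rst C H) i j"
      using ent_comp_Inj_inv[OF A d m ij] de[OF ij(1) m ij(2)] ent_rst[OF H(1) ij] H(2) by auto
  qed
  from this[OF _ F, of 0] this[OF _ G, of 1]
  have "MAT_comp C d (Inj_inv M [A, A] 0) = MAT_rst C F" "MAT_comp C d (Inj_inv M [A, A] 1) = MAT_rst C G"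
    by (simp_all add: e_def)
  then show "perp_d M F G"
    using F G hom_MAT_D(3)[OF F] hom_MAT_D(3)[OF G] dec unfolding perp_d_def by (auto simp: Hom_def)
qed

lemma perp_d_hom:
  assumes "perp_d M F G"
  obtains A B D where "F \<in> Hom M A B" "G \<in> Hom M A D"
  using assms that[of "mdom F" "mcod F" "mcod G"] by (auto simp: perp_d_def Hom_def)

sublocale MAT: perp_restriction_category M "perp_d M"
proof
  show "F \<in> Arr M \<and> G \<in> Arr M \<and> Dom M F = Dom M G" if "perp_d M F G" for F G
    using that by (simp add: perp_d_def)
  show "perp_d M (Ident M A) (Zero M A B)" if AB: "A \<in> Obj M" "B \<in> Obj M" for A B
  proof -
    have s: "set A \<subseteq> Obj C" "set B \<subseteq> Obj C" using AB by auto
    then have o: "A ! i \<in> Obj C" "B ! k \<in> Obj C" if "i < length A" "k < length B" for i k using that by auto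
    show ?thesis
      using perp_d_iff[OF MAT_ident_hom[OF s(1)] MAT_zero_hom[OF s]] perp_zero_right[OF ent_hom[OF
          MAT_ident_hom[OF s(1)]]] o
      by auto
  qed
  show "perp_d M G F" if "perp_d M F G" for F G
    using that perp_d_hom[OF that] perp_d_iff perp_sym by metis
  show "F = Zero M (Dom M F) (Cod M F)" if p: "perp_d M F F" for F
  proof -
    obtain A B where F: "F \<in> Hom M A B" using perp_d_hom[OF p] by blast
    have "F = MAT_zero C A B"
      using perp_d_iff[OF F F] p perp_self ent_hom[OF F]
      by (intro MAT_eqI[OF F MAT_zero_hom[OF hom_MAT_D(1,2)[OF F]]]) (fastforce simp: Hom_def)
    then show ?thesis using hom_MAT_D(3,4)[OF F] by simp
  qed
  show "perp_d M F G" if p: "perp_d M F' G'" and le: "rle M F F'" "rle M G G'" for F F' G G'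
  proof -
    obtain A B D where F': "F' \<in> Hom M A B" and G': "G' \<in> Hom M A D" using perp_d_hom[OF p] .
    then have F: "F \<in> Hom M A B" and G: "G \<in> Hom M A D" using le MAT.rle_hom_iff by blast+
    show ?thesis
      using perp_d_iff[OF F G] perp_d_iff[OF F' G'] MAT_rle_iff[OF F F'] MAT_rle_iff[OF G G'] p le perp_down
      by meson
  qed
  show "perp_d M (Rst M F) (Rst M G)" if p: "perp_d M F G" for F G
  proof -
    obtain A B D where F: "F \<in> Hom M A B" and G: "G \<in> Hom M A D" using perp_d_hom[OF p] .
    have "perp (rst_row F i) (rst_row G i)" if i: "i < length A" for i
      unfolding rst_row_eq[OF F] rst_row_eq[OF G]
      using perp_d_iff[OF F G] p i perp_rst
      by (intro perp_Join_Join[OF perp_family_ent_rst[OF F i] perp_family_ent_rst[OF G i]]) blast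
    then show ?thesis
      using perp_d_iff[OF MAT_rst_hom[OF F] MAT_rst_hom[OF G]] ent_rst[OF F] ent_rst[OF G] hom_MAT_D(6)[OF
          F]
        perp_zero_left perp_zero_right zero_hom rst_row_hom[OF F] rst_row_hom[OF G] by (auto, metis+)
  qed
  fix F G H K K' :: "('o, 'm) marr" and A B D E B' D'
  assume p: "perp_d M F G" and H: "H \<in> Hom M E A" and F: "F \<in> Hom M A B" and G: "G \<in> Hom M A D"
    and K: "K \<in> Hom M B B'" and K': "K' \<in> Hom M D D'"
  note FK = MAT_comp_hom[OF F K] and GK = MAT_comp_hom[OF G K']
  \<comment> \<open>Postcomposition comes first: it yields disjointness for every pair of columns,
    as is needed below when both paths pass through the same index of \<open>A\<close>. For
    different indices the row of \<open>H\<close> is enough.\<close>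
  have 1: "perp (ent (MAT_comp C F K) i j) (ent (MAT_comp C G K') i k)"
    if ijk: "i < length A" "j < length B'" "k < length D'" for i j k
    unfolding ent_comp[OF F K ijk(1,2)] ent_comp[OF G K' ijk(1,3)]
  proof (rule perp_Join_Join[OF perp_family_comp[OF F K ijk(1,2)] perp_family_comp[OF G K' ijk(1,3)]])
    fix l l' assume l: "l \<in> {..<length B}" "l' \<in> {..<length D}"
    then show "perp (ent F i l \<Zsemi> ent K l j) (ent G i l' \<Zsemi> ent K' l' k)"
      using perp_comp_right[OF _ ent_hom[OF F ijk(1)] ent_hom[OF G ijk(1)] ent_hom[OF K _ ijk(2)] ent_hom[OF
          K' _ ijk(3)]]
        perp_d_iff[OF F G] p ijk(1) by simp
  qed
  have "perp_d M (MAT_comp C H (MAT_comp C F K)) (MAT_comp C H (MAT_comp C G K'))"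
    unfolding perp_d_iff[OF MAT_comp_hom[OF H FK] MAT_comp_hom[OF H GK]]
  proof (intro allI impI)
    fix i j k assume ijk: "i < length E" "j < length B'" "k < length D'"
    show "perp (ent (MAT_comp C H (MAT_comp C F K)) i j) (ent (MAT_comp C H (MAT_comp C G K')) i k)"
      unfolding ent_comp[OF H FK ijk(1,2)] ent_comp[OF H GK ijk(1,3)]
    proof (rule perp_Join_Join[OF perp_family_comp[OF H FK ijk(1,2)] perp_family_comp[OF H GK ijk(1,3)]])
      fix l l' assume l: "l \<in> {..<length A}" "l' \<in> {..<length A}"
      show "perp (ent H i l \<Zsemi> ent (MAT_comp C F K) l j) (ent H i l' \<Zsemi> ent (MAT_comp C G K') l' k)"
      proof (cases "l = l'")
        case True
        then show ?thesis
          using perp_comp_left[OF 1 ent_hom[OF FK] ent_hom[OF GK] ent_hom[OF H]] l ijk by simp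
      next
        case False
        then show ?thesis
          using perp_comp_right[OF ent_perp[OF H] ent_hom[OF H] ent_hom[OF H] ent_hom[OF FK] ent_hom[OF GK]]
              l ijk
          by simp
      qed
    qed
  qed
  then show "perp_d M (H \<Zsemi>\<^bsub>M\<^esub> F \<Zsemi>\<^bsub>M\<^esub> K) (H \<Zsemi>\<^bsub>M\<^esub> G \<Zsemi>\<^bsub>M\<^esub> K')"
    using MAT_comp_assoc[OF H F K] MAT_comp_assoc[OF H G K'] by simp
qed

text \<open>The order is entrywise, so the matrix of entrywise joins is the join as soon as its rows
  are disjoint; strength of joins ensures that.\<close>

lemma MAT_is_join:
  assumes F: "F \<in> Hom M A B" and G: "G \<in> Hom M A B" and p: "perp_d M F G"
  shows "is_join M A B {F, G} (mk_arr A B (\<lambda>i j. bjoin C (ent F i j) (ent G i j)))" (is "is_join M A B _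
      ?J")
    and "mk_arr A B (\<lambda>i j. bjoin C (ent F i j) (ent G i j)) \<in> Hom M A B"
proof -
  have p': "perp (ent F i j) (ent G i k)" if "i < length A" "j < length B" "k < length B" for i j k
    using perp_d_iff[OF F G] p that by blast
  show J: "?J \<in> Hom M A B"
  proof (rule mk_arr_hom[OF hom_MAT_D(1,2)[OF F]])
    fix i j j' assume *: "i < length A" "j < length B" "j' < length B" "j \<noteq> j'"
    show "perp (bjoin C (ent F i j) (ent G i j)) (bjoin C (ent F i j') (ent G i j'))"
      by (rule perp_bjoin_bjoin[OF ent_hom[OF F *(1,2)] ent_hom[OF G *(1,2)] p'[OF *(1,2,2)]
            ent_hom[OF F *(1,3)] ent_hom[OF G *(1,3)] p'[OF *(1,3,3)] ent_perp[OF F *] p'[OF *(1,2,3)]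
            perp_sym[OF p'[OF *(1,3,2)]] ent_perp[OF G *]])
  qed (use bjoin_hom[OF ent_hom[OF F] ent_hom[OF G] p'] in auto)
  show "is_join M A B {F, G} ?J"
    unfolding is_join_def
  proof (intro conjI ballI impI)
    show "rle M f ?J" if "f \<in> {F, G}" for f
      using that MAT_rle_iff[OF F J] MAT_rle_iff[OF G J] bjoin_rle1[OF ent_hom[OF F] ent_hom[OF G] p']
        bjoin_rle2[OF ent_hom[OF F] ent_hom[OF G] p'] by auto
    fix h assume h: "h \<in> Hom M A B" and "\<forall>f\<in>{F, G}. rle M f h"
    then have le: "rle C (ent F i j) (ent h i j)" "rle C (ent G i j) (ent h i j)"
        if "i < length A" "j < length B" for i j
      using MAT_rle_iff[OF F h] MAT_rle_iff[OF G h] that by auto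
    show "rle M ?J h"
      unfolding MAT_rle_iff[OF J h]
    proof (intro allI impI)
      fix i j assume ij: "i < length A" "j < length B"
      show "rle C (ent ?J i j) (ent h i j)"
        using disjoint_join_pair[OF ent_hom[OF F ij] ent_hom[OF G ij] p'[OF ij ij(2)]] le[OF ij] ent_hom[OF
            h ij] ij
        by (simp add: disjoint_join_def is_join_def)
    qed
  qed (rule J)
qed

lemma MAT_bjoin:
  assumes "F \<in> Hom M A B" "G \<in> Hom M A B" "perp_d M F G"
  shows "bjoin M F G = mk_arr A B (\<lambda>i j. bjoin C (ent F i j) (ent G i j))"
  using MAT.Join_eq[OF MAT_is_join(1)[OF assms]] hom_MAT_D(3,4)[OF assms(1)] by (simp add: bjoin_def)

end

section \<open>The trace\<close>

lemma mk_arr_cong: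
  "(\<And>i j. \<lbrakk>i < length A; j < length B\<rbrakk> \<Longrightarrow> f i j = g i j) \<Longrightarrow> mk_arr A B f = mk_arr A B g"
  unfolding mk_arr_def by (auto intro!: eq_matI)

lemma split_index:
  assumes "\<not> i < length A" "i < length (A @ B)"
  obtains i' where "i = length A + i'" "i' < length B"
proof
  show "i = length A + (i - length A)" "i - length A < length B" using assms by auto
qed

section \<open>Entries of binary sums, injections and associators\<close>

context finitely_disjoint_perp_restriction_category
begin

lemma mk_arr_ent:
  assumes "F \<in> Hom M A B" shows "mk_arr A B (\<lambda>i j. ent F i j) = F"
  using assms by (cases F) (auto simp: hom_MAT_iff mk_arr_def intro!: eq_matI)

lemma pair_obj: "\<lbrakk>set A \<subseteq> Obj C; set B \<subseteq> Obj C\<rbrakk> \<Longrightarrow> set [A, B] \<subseteq> lists (Obj C)"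
  by auto

lemma inj_pair:
  assumes A: "set A \<subseteq> Obj C" and B: "set B \<subseteq> Obj C"
  shows "MAT_inj C [A, B] 0 \<in> Hom M A (A @ B)" "MAT_inj C [A, B] 1 \<in> Hom M B (A @ B)"
    and "\<And>i j. \<lbrakk>i < length A; j < length A + length B\<rbrakk> \<Longrightarrow> ent (MAT_inj C [A, B] 0) i j =
      (if j = i then Ident C (A ! i) else Zero C (A ! i) ((A @ B) ! j))"
    and "\<And>i j. \<lbrakk>i < length B; j < length A + length B\<rbrakk> \<Longrightarrow> ent (MAT_inj C [A, B] 1) i j =
      (if j = length A + i then Ident C (B ! i) else Zero C (B ! i) ((A @ B) ! j))"
  using MAT_inj_hom[OF pair_obj[OF A B], of 0] MAT_inj_hom[OF pair_obj[OF A B], of 1]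
    ent_inj[of _ "[A, B]" 0] ent_inj[of _ "[A, B]" 1] by auto

lemma ent_inj_pair_comp:
  assumes A: "set A \<subseteq> Obj C" and B: "set B \<subseteq> Obj C" and h: "h \<in> Hom M (A @ B) D" and c: "c < length D"
  shows "i < length A \<Longrightarrow> ent (MAT_comp C (MAT_inj C [A, B] 0) h) i c = ent h i c"
    and "i < length B \<Longrightarrow> ent (MAT_comp C (MAT_inj C [A, B] 1) h) i c = ent h (length A + i) c"
  using ent_inj_comp[OF pair_obj[OF A B], of 0 h D i c] ent_inj_comp[OF pair_obj[OF A B], of 1 h D i c] h c
  by auto

text \<open>Concatenation is strictly associative, so the canonical comparison is an identity
  matrix. Associators thereby disappear from vanishing and superposing.\<close>

lemma Assoc_MAT:
  assumes X: "set X \<subseteq> Obj C" and Y: "set Y \<subseteq> Obj C" and Z: "set Z \<subseteq> Obj C"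
  shows "Assoc M X Y Z = MAT_ident C (X @ Y @ Z)"
proof -
  have YZ: "set (Y @ Z) \<subseteq> Obj C" and XYZ: "set (X @ Y @ Z) \<subseteq> Obj C" using X Y Z by auto
  note i = inj_pair[OF X YZ] and j = inj_pair[OF Y Z]
  note ji = MAT_comp_hom[OF j(1) i(2)] MAT_comp_hom[OF j(2) i(2)]
  note c1 = Copair_pair[OF i(1) ji(1)]
  note c2 = Copair_pair[OF c1(2) ji(2)]
  have "Assoc M X Y Z = Copair M [X @ Y, Z] (X @ Y @ Z) [Copair M [X, Y] (X @ Y @ Z) [MAT_inj C [X, Y @ Z]
      0,
      MAT_comp C (MAT_inj C [Y, Z] 0) (MAT_inj C [X, Y @ Z] 1)], MAT_comp C (MAT_inj C [Y, Z] 1) (MAT_inj C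
          [X, Y @ Z] 1)]"
    by (simp add: Assoc_def Let_def)
  also have "\<dots> = MAT_ident C (X @ Y @ Z)"
    unfolding c1(1) c2(1)
  proof (rule MAT_eqI[OF _ MAT_ident_hom[OF XYZ]])
    fix r c assume rc: "r < length (X @ Y @ Z)" "c < length (X @ Y @ Z)"
    show "ent (mk_arr ((X @ Y) @ Z) (X @ Y @ Z) (\<lambda>i c. if i < length (X @ Y)
        then ent (mk_arr (X @ Y) (X @ Y @ Z) (\<lambda>i c. if i < length X then ent (MAT_inj C [X, Y @ Z] 0) i c
          else ent (MAT_comp C (MAT_inj C [Y, Z] 0) (MAT_inj C [X, Y @ Z] 1)) (i - length X) c)) i c
        else ent (MAT_comp C (MAT_inj C [Y, Z] 1) (MAT_inj C [X, Y @ Z] 1)) (i - length (X @ Y)) c)) r c =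
      ent (MAT_ident C (X @ Y @ Z)) r c"
      using rc i(3)[of r c] i(4)[of "r - length X" c] ent_inj_pair_comp[OF Y Z i(2), of c]
      by (auto simp: nth_append)
  qed (use c2(2) in simp)
  finally show ?thesis .
qed

lemma Assoc_inv_MAT:
  assumes X: "set X \<subseteq> Obj C" and Y: "set Y \<subseteq> Obj C" and Z: "set Z \<subseteq> Obj C"
  shows "Assoc_inv M X Y Z = MAT_ident C (X @ Y @ Z)"
proof -
  have XY: "set (X @ Y) \<subseteq> Obj C" and XYZ: "set (X @ Y @ Z) \<subseteq> Obj C" using X Y Z by auto
  note i = inj_pair[OF XY Z] and j = inj_pair[OF X Y]
  note ji = MAT_comp_hom[OF j(1) i(1)] MAT_comp_hom[OF j(2) i(1)]
  note c1 = Copair_pair[OF ji(2) i(2)]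
  note c2 = Copair_pair[OF ji(1) c1(2)]
  have "Assoc_inv M X Y Z = Copair M [X, Y @ Z] ((X @ Y) @ Z) [MAT_comp C (MAT_inj C [X, Y] 0) (MAT_inj C [X
      @ Y, Z] 0),
      Copair M [Y, Z] ((X @ Y) @ Z) [MAT_comp C (MAT_inj C [X, Y] 1) (MAT_inj C [X @ Y, Z] 0), MAT_inj C [X
          @ Y, Z] 1]]"
    by (simp add: Assoc_inv_def Let_def)
  also have "\<dots> = MAT_ident C (X @ Y @ Z)"
    unfolding c1(1) c2(1)
  proof (rule MAT_eqI[OF _ MAT_ident_hom[OF XYZ]])
    fix r c assume rc: "r < length (X @ Y @ Z)" "c < length (X @ Y @ Z)"
    show "ent (mk_arr (X @ Y @ Z) ((X @ Y) @ Z) (\<lambda>i c. if i < length X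
        then ent (MAT_comp C (MAT_inj C [X, Y] 0) (MAT_inj C [X @ Y, Z] 0)) i c
        else ent (mk_arr (Y @ Z) ((X @ Y) @ Z) (\<lambda>i c. if i < length Y
          then ent (MAT_comp C (MAT_inj C [X, Y] 1) (MAT_inj C [X @ Y, Z] 0)) i c
          else ent (MAT_inj C [X @ Y, Z] 1) (i - length Y) c)) (i - length X) c)) r c =
      ent (MAT_ident C (X @ Y @ Z)) r c"
      using rc i(3)[of r c] i(4)[of "r - length X - length Y" c] ent_inj_pair_comp[OF X Y i(1), of c]
      by (auto simp: nth_append)
  qed (use c2(2) in simp)
  finally show ?thesis .
qed

lemma pair_summands:
  assumes f: "f \<in> Hom M A B" and g: "g \<in> Hom M D E"
  shows "length [f, g] = length [A, D]" "length [B, E] = length [A, D]"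
    "\<And>k. k < length [A, D] \<Longrightarrow> [f, g] ! k \<in> Hom M ([A, D] ! k) ([B, E] ! k)"
    "set [A, D] \<subseteq> lists (Obj C)" "set [B, E] \<subseteq> lists (Obj C)"
  using f g hom_MAT_D(1,2)[OF f] hom_MAT_D(1,2)[OF g] by (auto simp: less_Suc_eq)

lemma SumMap_pair_hom:
  assumes f: "f \<in> Hom M A B" and g: "g \<in> Hom M D E"
  shows "SumMap M [f, g] \<in> Hom M (A @ D) (B @ E)"
  using SumMap_hom[OF pair_summands[OF f g]] by simp

lemma SumMap_pair:
  assumes f: "f \<in> Hom M A B" and g: "g \<in> Hom M D E"
  shows "\<And>i j. \<lbrakk>i < length A; j < length B\<rbrakk> \<Longrightarrow> ent (SumMap M [f, g]) i j = ent f i j"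
    and "\<And>i j. \<lbrakk>i < length A; j < length E\<rbrakk> \<Longrightarrow> ent (SumMap M [f, g]) i (length B + j) =
        Zero C (A ! i) (E ! j)"
    and "\<And>i j. \<lbrakk>i < length D; j < length B\<rbrakk> \<Longrightarrow> ent (SumMap M [f, g]) (length A + i) j =
        Zero C (D ! i) (B ! j)"
    and "\<And>i j. \<lbrakk>i < length D; j < length E\<rbrakk> \<Longrightarrow> ent (SumMap M [f, g]) (length A + i) (length B + j) =
        ent g i j"
    and "\<And>h H i c. \<lbrakk>h \<in> Hom M H (A @ D); i < length H; c < length B\<rbrakk> \<Longrightarrow>
        ent (MAT_comp C h (SumMap M [f, g])) i c =
      Join C (H ! i) (B ! c) ((\<lambda>l. ent h i l \<Zsemi> ent f l c) ` {..<length A})"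
    and "\<And>h H i c. \<lbrakk>h \<in> Hom M H (A @ D); i < length H; c < length E\<rbrakk> \<Longrightarrow>
        ent (MAT_comp C h (SumMap M [f, g])) i (length B + c) =
      Join C (H ! i) (E ! c) ((\<lambda>l. ent h i (length A + l) \<Zsemi> ent g l c) ` {..<length D})"
    and "\<And>h H i c. \<lbrakk>h \<in> Hom M (B @ E) H; i < length A; c < length H\<rbrakk> \<Longrightarrow>
        ent (MAT_comp C (SumMap M [f, g]) h) i c =
      Join C (A ! i) (H ! c) ((\<lambda>l. ent f i l \<Zsemi> ent h l c) ` {..<length B})"
    and "\<And>h H i c. \<lbrakk>h \<in> Hom M (B @ E) H; i < length D; c < length H\<rbrakk> \<Longrightarrow>
        ent (MAT_comp C (SumMap M [f, g]) h) (length A + i) c =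
      Join C (D ! i) (H ! c) ((\<lambda>l. ent g i l \<Zsemi> ent h (length B + l) c) ` {..<length E})"
proof -
  note p = pair_summands[OF f g]
  note S = ent_SumMap[OF p]
  show "\<And>i j. \<lbrakk>i < length A; j < length B\<rbrakk> \<Longrightarrow> ent (SumMap M [f, g]) i j = ent f i j"
    using S[of 0 _ 0] by simp
  show "\<And>i j. \<lbrakk>i < length A; j < length E\<rbrakk> \<Longrightarrow> ent (SumMap M [f, g]) i (length B + j) =
      Zero C (A ! i) (E ! j)"
    using S[of 0 _ 1] by simp
  show "\<And>i j. \<lbrakk>i < length D; j < length B\<rbrakk> \<Longrightarrow> ent (SumMap M [f, g]) (length A + i) j =
      Zero C (D ! i) (B ! j)"
    using S[of 1 _ 0] by simp
  show "\<And>i j. \<lbrakk>i < length D; j < length E\<rbrakk> \<Longrightarrow> ent (SumMap M [f, g]) (length A + i) (length B + j) =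
      ent g i j"
    using S[of 1 _ 1] by simp
  note R = ent_comp_SumMap[OF p] and L = ent_SumMap_comp[OF p]
  show "\<And>h H i c. \<lbrakk>h \<in> Hom M H (A @ D); i < length H; c < length B\<rbrakk> \<Longrightarrow>
      ent (MAT_comp C h (SumMap M [f, g])) i c =
      Join C (H ! i) (B ! c) ((\<lambda>l. ent h i l \<Zsemi> ent f l c) ` {..<length A})"
    using R[of _ _ 0] by simp
  show "\<And>h H i c. \<lbrakk>h \<in> Hom M H (A @ D); i < length H; c < length E\<rbrakk> \<Longrightarrow>
      ent (MAT_comp C h (SumMap M [f, g])) i (length B + c) =
      Join C (H ! i) (E ! c) ((\<lambda>l. ent h i (length A + l) \<Zsemi> ent g l c) ` {..<length D})"
    using R[of _ _ 1] by simp
  show "\<And>h H i c. \<lbrakk>h \<in> Hom M (B @ E) H; i < length A; c < length H\<rbrakk> \<Longrightarrow>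
      ent (MAT_comp C (SumMap M [f, g]) h) i c =
      Join C (A ! i) (H ! c) ((\<lambda>l. ent f i l \<Zsemi> ent h l c) ` {..<length B})"
    using L[of _ _ 0] by simp
  show "\<And>h H i c. \<lbrakk>h \<in> Hom M (B @ E) H; i < length D; c < length H\<rbrakk> \<Longrightarrow>
      ent (MAT_comp C (SumMap M [f, g]) h) (length A + i) c =
      Join C (D ! i) (H ! c) ((\<lambda>l. ent g i l \<Zsemi> ent h (length B + l) c) ` {..<length E})"
    using L[of _ _ 1] by simp
qed

lemma Join_comp_ident:
  assumes "\<And>l. l < length A \<Longrightarrow> h l \<in> Hom C P (A ! l)" "c < length A" "set A \<subseteq> Obj C"
  shows "Join C P (A ! c) ((\<lambda>l. h l \<Zsemi> ent (MAT_ident C A) l c) ` {..<length A}) = h c"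
proof -
  have o: "A ! c \<in> Obj C" using assms by auto
  have "Join C P (A ! c) ((\<lambda>l. h l \<Zsemi> ent (MAT_ident C A) l c) ` {..<length A}) =
      h c \<Zsemi> ent (MAT_ident C A) c c"
    by (rule Join_delta) (use assms o ident_right[OF assms(1)] comp_zero[OF assms(1) o] in auto)
  then show ?thesis using assms ident_right[OF assms(1)] by simp
qed

lemma Join_ident_comp:
  assumes "\<And>l. l < length A \<Longrightarrow> h l \<in> Hom C (A ! l) P" "c < length A" "set A \<subseteq> Obj C"
  shows "Join C (A ! c) P ((\<lambda>l. ent (MAT_ident C A) c l \<Zsemi> h l) ` {..<length A}) = h c"
proof -
  have o: "A ! c \<in> Obj C" using assms by auto
  have "Join C (A ! c) P ((\<lambda>l. ent (MAT_ident C A) c l \<Zsemi> h l) ` {..<length A}) =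
      ent (MAT_ident C A) c c \<Zsemi> h c"
    by (rule Join_delta) (use assms o ident_left[OF assms(1)] zero_comp[OF assms(1) o] in auto)
  then show ?thesis using assms ident_left[OF assms(1)] by simp
qed

lemma ent_comp_sum_ident:
  assumes h: "h \<in> Hom M H (A @ D)"
  shows "\<And>k X i c. \<lbrakk>k \<in> Hom M A X; i < length H; c < length X\<rbrakk> \<Longrightarrow>
      ent (MAT_comp C h (SumMap M [k, MAT_ident C D])) i c =
      Join C (H ! i) (X ! c) ((\<lambda>l. ent h i l \<Zsemi> ent k l c) ` {..<length A})"
    and "\<And>k X i c. \<lbrakk>k \<in> Hom M A X; i < length H; c < length D\<rbrakk> \<Longrightarrow>
      ent (MAT_comp C h (SumMap M [k, MAT_ident C D])) i (length X + c) = ent h i (length A + c)"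
    and "\<And>k X i c. \<lbrakk>k \<in> Hom M D X; i < length H; c < length A\<rbrakk> \<Longrightarrow>
      ent (MAT_comp C h (SumMap M [MAT_ident C A, k])) i c = ent h i c"
    and "\<And>k X i c. \<lbrakk>k \<in> Hom M D X; i < length H; c < length X\<rbrakk> \<Longrightarrow>
      ent (MAT_comp C h (SumMap M [MAT_ident C A, k])) i (length A + c) =
      Join C (H ! i) (X ! c) ((\<lambda>l. ent h i (length A + l) \<Zsemi> ent k l c) ` {..<length D})"
proof -
  have A: "set A \<subseteq> Obj C" and D: "set D \<subseteq> Obj C" using hom_MAT_D(2)[OF h] by auto
  note iA = MAT_ident_hom[OF A] and iD = MAT_ident_hom[OF D]
  have hA: "ent h i l \<in> Hom C (H ! i) (A ! l)" if "i < length H" "l < length A" for i l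
    using ent_hom[OF h that(1), of l] that by (simp add: nth_append)
  have hD: "ent h i (length A + l) \<in> Hom C (H ! i) (D ! l)" if "i < length H" "l < length D" for i l
    using ent_hom[OF h that(1), of "length A + l"] that by simp
  fix k X i c
  show "\<lbrakk>k \<in> Hom M A X; i < length H; c < length X\<rbrakk> \<Longrightarrow> ent (MAT_comp C h (SumMap M [k, MAT_ident C D])) i c =
      Join C (H ! i) (X ! c) ((\<lambda>l. ent h i l \<Zsemi> ent k l c) ` {..<length A})"
    using SumMap_pair(5)[OF _ iD h] by blast
  show "\<lbrakk>k \<in> Hom M A X; i < length H; c < length D\<rbrakk> \<Longrightarrow>
      ent (MAT_comp C h (SumMap M [k, MAT_ident C D])) i (length X + c) = ent h i (length A + c)"
    using SumMap_pair(6)[OF _ iD h, of k X i c] Join_comp_ident[OF hD _ D, of i c] by simp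
  show "\<lbrakk>k \<in> Hom M D X; i < length H; c < length A\<rbrakk> \<Longrightarrow>
      ent (MAT_comp C h (SumMap M [MAT_ident C A, k])) i c = ent h i c"
    using SumMap_pair(5)[OF iA _ h, of k X i c] Join_comp_ident[OF hA _ A, of i c] by simp
  show "\<lbrakk>k \<in> Hom M D X; i < length H; c < length X\<rbrakk> \<Longrightarrow>
      ent (MAT_comp C h (SumMap M [MAT_ident C A, k])) i (length A + c) =
      Join C (H ! i) (X ! c) ((\<lambda>l. ent h i (length A + l) \<Zsemi> ent k l c) ` {..<length D})"
    using SumMap_pair(6)[OF iA _ h] by blast
qed

lemma ent_sum_ident_comp:
  assumes h: "h \<in> Hom M (A @ D) H"
  shows "\<And>k X i c. \<lbrakk>k \<in> Hom M X A; i < length X; c < length H\<rbrakk> \<Longrightarrow>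
      ent (MAT_comp C (SumMap M [k, MAT_ident C D]) h) i c =
      Join C (X ! i) (H ! c) ((\<lambda>l. ent k i l \<Zsemi> ent h l c) ` {..<length A})"
    and "\<And>k X i c. \<lbrakk>k \<in> Hom M X A; i < length D; c < length H\<rbrakk> \<Longrightarrow>
      ent (MAT_comp C (SumMap M [k, MAT_ident C D]) h) (length X + i) c = ent h (length A + i) c"
    and "\<And>k X i c. \<lbrakk>k \<in> Hom M X D; i < length A; c < length H\<rbrakk> \<Longrightarrow>
      ent (MAT_comp C (SumMap M [MAT_ident C A, k]) h) i c = ent h i c"
    and "\<And>k X i c. \<lbrakk>k \<in> Hom M X D; i < length X; c < length H\<rbrakk> \<Longrightarrow>
      ent (MAT_comp C (SumMap M [MAT_ident C A, k]) h) (length A + i) c =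
      Join C (X ! i) (H ! c) ((\<lambda>l. ent k i l \<Zsemi> ent h (length A + l) c) ` {..<length D})"
proof -
  have A: "set A \<subseteq> Obj C" and D: "set D \<subseteq> Obj C" using hom_MAT_D(1)[OF h] by auto
  note iA = MAT_ident_hom[OF A] and iD = MAT_ident_hom[OF D]
  have hA: "ent h l c \<in> Hom C (A ! l) (H ! c)" if "l < length A" "c < length H" for c l
    using ent_hom[OF h, of l c] that by (simp add: nth_append)
  have hD: "ent h (length A + l) c \<in> Hom C (D ! l) (H ! c)" if "l < length D" "c < length H" for c l
    using ent_hom[OF h, of "length A + l" c] that by simp
  fix k X i c
  show "\<lbrakk>k \<in> Hom M X A; i < length X; c < length H\<rbrakk> \<Longrightarrow> ent (MAT_comp C (SumMap M [k, MAT_ident C D]) h) i c =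
      Join C (X ! i) (H ! c) ((\<lambda>l. ent k i l \<Zsemi> ent h l c) ` {..<length A})"
    using SumMap_pair(7)[OF _ iD h] by blast
  show "\<lbrakk>k \<in> Hom M X A; i < length D; c < length H\<rbrakk> \<Longrightarrow>
      ent (MAT_comp C (SumMap M [k, MAT_ident C D]) h) (length X + i) c = ent h (length A + i) c"
    using SumMap_pair(8)[OF _ iD h, of k X i c] Join_ident_comp[OF hD _ D, of c i] by simp
  show "\<lbrakk>k \<in> Hom M X D; i < length A; c < length H\<rbrakk> \<Longrightarrow>
      ent (MAT_comp C (SumMap M [MAT_ident C A, k]) h) i c = ent h i c"
    using SumMap_pair(7)[OF iA _ h, of k X i c] Join_ident_comp[OF hA _ A, of c i] by simp
  show "\<lbrakk>k \<in> Hom M X D; i < length X; c < length H\<rbrakk> \<Longrightarrow>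
      ent (MAT_comp C (SumMap M [MAT_ident C A, k]) h) (length A + i) c =
      Join C (X ! i) (H ! c) ((\<lambda>l. ent k i l \<Zsemi> ent h (length A + l) c) ` {..<length D})"
    using SumMap_pair(8)[OF iA _ h] by blast
qed

end

section \<open>The trace as iterated elimination, and its axioms\<close>

context finitely_disjoint_itegory
begin

text \<open>\<open>MAT_trace1\<close> deletes row and column 0 and renumbers, whereas
  \<open>eliminate\<close> keeps positions. Reindexing by \<open>Suc\<close> turns the pivots of the
  smaller matrix into the remaining pivots of the original one.\<close>

lemma MAT_trace_eq:
  "F \<in> Hom M (X @ A) (X @ B) \<Longrightarrow> MAT_trace C wand X A' B' F =
    mk_arr A B (\<lambda>i j. eliminates [0..<length X] (\<lambda>i j. ent F i j) (length X + i) (length X + j))"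
proof (induction X arbitrary: F)
  case Nil
  then show ?case using mk_arr_ent[of F A B] by simp
next
  case (Cons x X)
  let ?F = "\<lambda>i j. ent F i j" and ?n = "length X"
  note F = Cons.prems
  have rd: "row_disjoint ((!) (x # X @ A)) ((!) (x # X @ B)) {..<length (x # X @ A)} ({..<length (x # X @
      B)} - {0}) (eliminate 0 ?F)"
    using row_disjoint_eliminate[OF hom_MAT_D(5)[OF F], of 0] by simp
  have eq: "MAT_trace1 C wand F = mk_arr (X @ A) (X @ B) (\<lambda>i j. eliminate 0 ?F (Suc i) (Suc j))"
    using hom_MAT_D(3,4)[OF F] by (simp add: MAT_trace1_def mk_arr_def eliminate_def)
  have F1: "MAT_trace1 C wand F \<in> Hom M (X @ A) (X @ B)"
    unfolding eq
  proof (rule mk_arr_hom)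
    show "eliminate 0 ?F (Suc i) (Suc j) \<in> Hom C ((X @ A) ! i) ((X @ B) ! j)"
      if "i < length (X @ A)" "j < length (X @ B)" for i j
      using row_disjoint_hom[OF rd, of "Suc i" "Suc j"] that by simp
    show "perp (eliminate 0 ?F (Suc i) (Suc j)) (eliminate 0 ?F (Suc i) (Suc j'))"
      if "i < length (X @ A)" "j < length (X @ B)" "j' < length (X @ B)" "j \<noteq> j'" for i j j'
      using row_disjoint_perp[OF rd, of "Suc i" "Suc j" "Suc j'"] that by simp
  qed (use hom_MAT_D(1,2)[OF F] in auto)
  have "eliminates [0..<?n] (\<lambda>i j. ent (MAT_trace1 C wand F) i j) (?n + i) (?n + j) =
      eliminates [0..<Suc ?n] ?F (Suc ?n + i) (Suc ?n + j)" if "i < length A" "j < length B" for i j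
  proof -
    have "eliminates [0..<?n] (\<lambda>i j. ent (MAT_trace1 C wand F) i j) (?n + i) (?n + j) =
        eliminates [0..<?n] (\<lambda>i j. eliminate 0 ?F (Suc i) (Suc j)) (?n + i) (?n + j)"
      by (rule eliminates_cong[where I = "{..<length (X @ A)}" and J = "{..<length (X @ B)}"])
        (use that in \<open>auto simp: eq\<close>)
    also have "\<dots> = eliminates (map Suc [0..<?n]) (eliminate 0 ?F) (Suc (?n + i)) (Suc (?n + j))"
      using eliminates_reindex[of "[0..<?n]" Suc Suc "eliminate 0 ?F"] by simp
    also have "\<dots> = eliminates (0 # map Suc [0..<?n]) ?F (Suc ?n + i) (Suc ?n + j)" by simp
    also have "0 # map Suc [0..<?n] = [0..<Suc ?n]" by (simp add: map_Suc_upt upt_conv_Cons del: upt_Suc)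
    finally show ?thesis .
  qed
  then show ?case using Cons.IH[OF F1] by (auto intro!: mk_arr_cong simp del: upt_Suc)
qed

lemma MAT_trace_hom:
  assumes F: "F \<in> Hom M (X @ A) (X @ B)"
  shows "MAT_trace C wand X A' B' F \<in> Hom M A B"
  unfolding MAT_trace_eq[OF F]
proof -
  let ?n = "length X"
  have rd: "row_disjoint ((!) (X @ A)) ((!) (X @ B)) {..<length (X @ A)} ({..<length (X @ B)} - set
      [0..<?n])
      (eliminates [0..<?n] (\<lambda>i j. ent F i j))"
    by (rule row_disjoint_eliminates[OF hom_MAT_D(5)[OF F]]) (auto simp: nth_append)
  show "mk_arr A B (\<lambda>i j. eliminates [0..<?n] (\<lambda>i j. ent F i j) (?n + i) (?n + j)) \<in> Hom M A B"
  proof (rule mk_arr_hom)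
    show "eliminates [0..<?n] (\<lambda>i j. ent F i j) (?n + i) (?n + j) \<in> Hom C (A ! i) (B ! j)"
      if "i < length A" "j < length B" for i j
      using row_disjoint_hom[OF rd, of "?n + i" "?n + j"] that by simp
    show "perp (eliminates [0..<?n] (\<lambda>i j. ent F i j) (?n + i) (?n + j))
        (eliminates [0..<?n] (\<lambda>i j. ent F i j) (?n + i) (?n + j'))"
      if "i < length A" "j < length B" "j' < length B" "j \<noteq> j'" for i j j'
      using row_disjoint_perp[OF rd, of "?n + i" "?n + j" "?n + j'"] that by simp
  qed (use hom_MAT_D(1,2)[OF F] in auto)
qed

lemma ent_trace:
  "\<lbrakk>F \<in> Hom M (X @ A) (X @ B); i < length A; j < length B\<rbrakk> \<Longrightarrow> ent (MAT_trace C wand X A' B' F) i j =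
    eliminates [0..<length X] (\<lambda>i j. ent F i j) (length X + i) (length X + j)"
  by (simp add: MAT_trace_eq)

lemma MAT_trace_append: "MAT_trace C wand (X @ Y) A B F =
    MAT_trace C wand Y A B (MAT_trace C wand X A' B' F)"
  by (induction X arbitrary: F) auto

lemma nth_shared: "x \<in> set [0..<length X] \<Longrightarrow> (X @ A) ! x = (X @ B) ! x"
  by (simp add: nth_append)

text \<open>One half of tightening. Composing with the sum of an identity and \<open>h\<close>
  leaves the pivot columns alone and replaces the others by combinations, which is the situation of
  \<open>eliminates_right_linear\<close>.\<close>

lemma MAT_trace_comp_right:
  assumes F: "F \<in> Hom M (X @ A) (X @ B)" and h: "h \<in> Hom M B B'"
  shows "MAT_trace C wand X A B' (MAT_comp C F (SumMap M [MAT_ident C X, h])) =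
      MAT_comp C (MAT_trace C wand X A B F) h"
proof -
  let ?n = "length X" and ?F' = "MAT_comp C F (SumMap M [MAT_ident C X, h])"
  have X: "set X \<subseteq> Obj C" using hom_MAT_D(1)[OF F] by simp
  have F': "?F' \<in> Hom M (X @ A) (X @ B')"
      by (rule MAT_comp_hom[OF F SumMap_pair_hom[OF MAT_ident_hom[OF X] h]])
  note T = MAT_trace_hom[OF F]
  show ?thesis
  proof (rule MAT_eqI[OF MAT_trace_hom[OF F'] MAT_comp_hom[OF T h]])
    fix i j assume ij: "i < length A" "j < length B'"
    let ?L = "(\<lambda>l. ?n + l) ` {..<length B}"
    have "eliminates [0..<?n] (\<lambda>i j. ent ?F' i j) (?n + i) (?n + j) =
      Join C ((X @ A) ! (?n + i)) (B' ! j) ((\<lambda>l. eliminates [0..<?n] (\<lambda>i j. ent F i j) (?n + i) l \<Zsemi> ent h (l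
          - ?n) j) ` ?L)"
    proof (rule eliminates_right_linear[OF hom_MAT_D(5)[OF F]])
      show "ent ?F' i x = ent F i x" if "i \<in> {..<length (X @ A)}" "x \<in> set [0..<?n]" for i x
        using ent_comp_sum_ident(3)[OF F h] that by simp
      show "ent ?F' i (?n + j) = Join C ((X @ A) ! i) (B' ! j) ((\<lambda>l. ent F i l \<Zsemi> ent h (l - ?n) j) ` ?L)"
        if "i \<in> {..<length (X @ A)}" for i
        using ent_comp_sum_ident(4)[OF F h _ ij(2), of i] that by (simp add: image_image)
      show "B' ! j \<in> Obj C" using hom_MAT_D(7)[OF h ij(2)] .
      show "ent h (l - ?n) j \<in> Hom C ((X @ B) ! l) (B' ! j)" if "l \<in> ?L" for l
        using ent_hom[OF h _ ij(2)] that by auto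
    qed (use ij nth_shared in auto)
    then show "ent (MAT_trace C wand X A B' ?F') i j = ent (MAT_comp C (MAT_trace C wand X A B F) h) i j"
      using ent_trace[OF F' ij] ent_comp[OF T h ij] ent_trace[OF F ij(1)] by (simp add: image_image)
  qed
qed

text \<open>The other half of tightening, with rows in place of columns and
  \<open>eliminates_left_linear\<close>.\<close>

lemma MAT_trace_comp_left:
  assumes F: "F \<in> Hom M (X @ A) (X @ B)" and g: "g \<in> Hom M A' A"
  shows "MAT_trace C wand X A' B (MAT_comp C (SumMap M [MAT_ident C X, g]) F) =
      MAT_comp C g (MAT_trace C wand X A B F)"
proof -
  let ?n = "length X" and ?F' = "MAT_comp C (SumMap M [MAT_ident C X, g]) F"
  have X: "set X \<subseteq> Obj C" using hom_MAT_D(1)[OF F] by simp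
  have F': "?F' \<in> Hom M (X @ A') (X @ B)"
      by (rule MAT_comp_hom[OF SumMap_pair_hom[OF MAT_ident_hom[OF X] g] F])
  note T = MAT_trace_hom[OF F]
  show ?thesis
  proof (rule MAT_eqI[OF MAT_trace_hom[OF F'] MAT_comp_hom[OF g T]])
    fix i j assume ij: "i < length A'" "j < length B"
    let ?L = "(\<lambda>l. ?n + l) ` {..<length A}"
    have "eliminates [0..<?n] (\<lambda>i j. ent ?F' i j) (?n + i) (?n + j) =
      Join C (A' ! i) ((X @ B) ! (?n + j)) ((\<lambda>l. ent g i (l - ?n) \<Zsemi> eliminates [0..<?n] (\<lambda>i j. ent F i j) l
          (?n + j)) ` ?L)"
    proof (rule eliminates_left_linear[OF hom_MAT_D(5)[OF F]])
      show "ent ?F' x j = ent F x j" if "x \<in> set [0..<?n]" "j \<in> {..<length (X @ B)}" for x j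
        using ent_sum_ident_comp(3)[OF F g] that by simp
      show "ent ?F' (?n + i) j = Join C (A' ! i) ((X @ B) ! j) ((\<lambda>l. ent g i (l - ?n) \<Zsemi> ent F l j) ` ?L)"
        if "j \<in> {..<length (X @ B)}" for j
        using ent_sum_ident_comp(4)[OF F g ij(1), of j] that by (simp add: image_image)
      show "A' ! i \<in> Obj C" using hom_MAT_D(6)[OF g ij(1)] .
      show "ent g i (l - ?n) \<in> Hom C (A' ! i) ((X @ A) ! l)" if "l \<in> ?L" for l
        using ent_hom[OF g ij(1)] that by auto
      show "perp (ent g i (l - ?n)) (ent g i (l' - ?n))" if "l \<in> ?L" "l' \<in> ?L" "l \<noteq> l'" for l l'
        using ent_perp[OF g ij(1)] that by auto
    qed (use ij nth_shared in auto)
    then show "ent (MAT_trace C wand X A' B ?F') i j = ent (MAT_comp C g (MAT_trace C wand X A B F)) i j"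
      using ent_trace[OF F' ij] ent_comp[OF g T ij] ent_trace[OF F _ ij(2)] by (simp add: image_image)
  qed
qed

text \<open>Rows coming from \<open>g\<close> vanish in the pivot columns and columns coming from
  \<open>g\<close> vanish in the pivot rows. So elimination changes only the block from
  \<open>A\<close> to \<open>B\<close>, and there it sees nothing but \<open>f\<close>.\<close>

lemma MAT_trace_superpose:
  assumes f: "f \<in> Hom M (X @ A) (X @ B)" and g: "g \<in> Hom M D E"
  shows "MAT_trace C wand X (A @ D) (B @ E) (SumMap M [f, g]) = SumMap M [MAT_trace C wand X A B f, g]"
proof -
  let ?n = "length X" and ?S = "\<lambda>i j. ent (SumMap M [f, g]) i j"
  note T = MAT_trace_hom[OF f, of A B]
  have S: "SumMap M [f, g] \<in> Hom M (X @ A @ D) (X @ B @ E)" using SumMap_pair_hom[OF f g] by simp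
  note P = SumMap_pair[OF f g] and PT = SumMap_pair[OF T g] and R = hom_MAT_D(5)[OF S]
  show ?thesis
  proof (rule MAT_eqI[OF MAT_trace_hom[OF S] SumMap_pair_hom[OF T g]])
    fix i j assume ij: "i < length (A @ D)" "j < length (B @ E)"
    have zr: "eliminates [0..<?n] ?S (?n + i) (?n + j) = ?S (?n + i) (?n + j)" if ni: "\<not> i < length A"
    proof (rule eliminates_zero_row[OF R])
      obtain i' where i': "i = length A + i'" "i' < length D" using split_index[OF ni ij(1)] .
      show "?S (?n + i) x = Zero C ((X @ A @ D) ! (?n + i)) ((X @ B @ E) ! x)" if "x \<in> set [0..<?n]" for x
        using P(3)[OF i'(2), of x] that i' by (simp add: nth_append add.assoc)
    qed (use ij nth_shared in auto)
    have zc: "eliminates [0..<?n] ?S (?n + i) (?n + j) = ?S (?n + i) (?n + j)" if nj: "\<not> j < length B"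
    proof (rule eliminates_zero_column[OF R])
      obtain j' where j': "j = length B + j'" "j' < length E" using split_index[OF nj ij(2)] .
      show "?S x (?n + j) = Zero C ((X @ A @ D) ! x) ((X @ B @ E) ! (?n + j))" if "x \<in> set [0..<?n]" for x
        using P(2)[of x j'] that j' by (simp add: nth_append add.assoc)
    qed (use ij nth_shared in auto)
    have "eliminates [0..<?n] ?S (?n + i) (?n + j) = ent (SumMap M [MAT_trace C wand X A B f, g]) i j"
    proof (cases "i < length A")
      case True
      note i = this
      show ?thesis
      proof (cases "j < length B")
        case True
        have "eliminates [0..<?n] ?S (?n + i) (?n + j) =
            eliminates [0..<?n] (\<lambda>i j. ent f i j) (?n + i) (?n + j)"
          by (rule eliminates_cong[where I = "{..<length (X @ A)}" and J = "{..<length (X @ B)}"])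
            (use i True P(1) in auto)
        then show ?thesis using PT(1)[OF i True] ent_trace[OF f i True] by simp
      next
        case False
        obtain j' where j': "j = length B + j'" "j' < length E" using split_index[OF False ij(2)] .
        then show ?thesis using zc[OF False] P(2)[of "?n + i" j'] PT(2)[OF i j'(2)] i
            by (simp add: add.assoc)
      qed
    next
      case False
      note i = this
      obtain i' where i': "i = length A + i'" "i' < length D" using split_index[OF False ij(1)] .
      show ?thesis
      proof (cases "j < length B")
        case True
        then show ?thesis using zr[OF i] P(3)[OF i'(2), of "?n + j"] PT(3)[OF i'(2) True] i'
            by (simp add: add.assoc)
      next
        case False
        obtain j' where j': "j = length B + j'" "j' < length E" using split_index[OF False ij(2)] .
        then show ?thesis using zr[OF i] P(4)[OF i'(2) j'(2)] PT(4)[OF i'(2) j'(2)] i'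
            by (simp add: add.assoc)
      qed
    qed
    then show "ent (MAT_trace C wand X (A @ D) (B @ E) (SumMap M [f, g])) i j =
        ent (SumMap M [MAT_trace C wand X A B f, g]) i j"
      using ent_trace[OF S ij] by simp
  qed
qed

text \<open>The symmetry has zero diagonal blocks and identities off the diagonal, so the trace is
  zero joined with a product of two identities.\<close>

lemma MAT_trace_yank:
  assumes X: "set X \<subseteq> Obj C"
  shows "MAT_trace C wand X X X (Symm M X X) = MAT_ident C X"
proof -
  let ?n = "length X" and ?S = "\<lambda>i j. ent (Symm M X X) i j"
  note I = inj_pair[OF X X] and C = Copair_pair[OF inj_pair(2,1)[OF X X]]
  have eq: "Symm M X X = mk_arr (X @ X) (X @ X) (\<lambda>i c. if i < ?n then ent (MAT_inj C [X, X] 1) i c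
      else ent (MAT_inj C [X, X] 0) (i - ?n) c)"
    using C(1) by (simp add: Symm_def)
  have S: "Symm M X X \<in> Hom M (X @ X) (X @ X)" using C(2) eq by simp
  have o: "X ! i \<in> Obj C" if "i < ?n" for i using X that by auto
  show ?thesis
  proof (rule MAT_eqI[OF MAT_trace_hom[OF S] MAT_ident_hom[OF X]])
    fix i j assume ij: "i < ?n" "j < ?n"
    have "eliminates [0..<?n] ?S (?n + i) (?n + j) = bjoin C (?S (?n + i) (?n + j))
        (Join C ((X @ X) ! (?n + i)) ((X @ X) ! (?n + j)) ((\<lambda>x. ?S (?n + i) x \<Zsemi> ?S x (?n + j)) ` set
            [0..<?n]))"
      by (rule eliminates_zero_block[OF hom_MAT_D(5)[OF S]])
        (use ij nth_shared[of _ X X X] I(4) in \<open>auto simp: eq nth_append\<close>)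
    also have "(\<lambda>x. ?S (?n + i) x \<Zsemi> ?S x (?n + j)) ` set [0..<?n] =
        (\<lambda>x. ent (MAT_ident C X) i x \<Zsemi> ent (MAT_ident C X) x j) ` {..<?n}"
      using ij I(3)[of i] I(4)[of _ "?n + j"] by (auto simp: eq nth_append intro!: image_cong)
    also have "?S (?n + i) (?n + j) = Zero C (X ! i) (X ! j)" using ij I(3)[of i "?n + j"] by (simp add: eq)
    finally have "eliminates [0..<?n] ?S (?n + i) (?n + j) =
        bjoin C (Zero C (X ! i) (X ! j)) (ent (MAT_ident C X) i j)"
      using Join_ident_comp[OF ent_hom[OF MAT_ident_hom[OF X] _ ij(2)] ij(1) X] by simp
    also have "\<dots> = ent (MAT_ident C X) i j" by (rule bjoin_zero_left[OF ent_hom[OF MAT_ident_hom[OF X] ij]])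
    finally show "ent (MAT_trace C wand X X X (Symm M X X)) i j = ent (MAT_ident C X) i j"
      using ent_trace[OF S ij] by simp
  qed
qed

text \<open>Both sides are iterated eliminations of one matrix with rows \<open>X' + X + A\<close> and columns
  \<open>X' + X + B\<close> whose diagonal blocks at \<open>X'\<close> and \<open>X\<close> vanish: eliminating \<open>X'\<close> first leaves
  \<open>f (k + 1)\<close>, eliminating \<open>X\<close> first leaves \<open>(k + 1) f\<close>.\<close>

lemma MAT_trace_slide:
  assumes f: "f \<in> Hom M (X @ A) (X' @ B)" and k: "k \<in> Hom M X' X"
  shows "MAT_trace C wand X A B (MAT_comp C f (SumMap M [k, MAT_ident C B])) =
    MAT_trace C wand X' A B (MAT_comp C (SumMap M [k, MAT_ident C A]) f)"
proof -
  let ?n = "length X" and ?n' = "length X'" and ?a = "length A" and ?b = "length B"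
  let ?R = "(!) (X' @ X @ A)" and ?Q = "(!) (X' @ X @ B)"
  let ?I = "{..<?n' + ?n + ?a}" and ?J = "{..<?n' + ?n + ?b}"
  have X: "set X \<subseteq> Obj C" and X': "set X' \<subseteq> Obj C" and A: "set A \<subseteq> Obj C" and B: "set B \<subseteq> Obj C"
    using hom_MAT_D(1,2)[OF f] by auto
  \<comment> \<open>\<open>\<phi>\<close> translates a column of \<open>X'\<close> or
    \<open>B\<close> in the big matrix into a column of \<open>f\<close>, closing the gap of width
    \<open>?n\<close> that the columns of \<open>X\<close> occupy.\<close>
  define \<phi> where "\<phi> j = (if j < ?n' then j else j - ?n)" for j
  \<comment> \<open>The only blocks not declared zero are \<open>k\<close> from \<open>X'\<close> to
    \<open>X\<close> and \<open>f\<close> from \<open>X + A\<close> to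
    \<open>X' + B\<close>.\<close>
  define H where "H i j = (if i < ?n' then (if ?n' \<le> j \<and> j < ?n' + ?n then ent k i (j - ?n') else Zero C (?R
      i) (?Q j))
    else (if ?n' \<le> j \<and> j < ?n' + ?n then Zero C (?R i) (?Q j) else ent f (i - ?n') (\<phi> j)))" for i j
  have oR: "?R i \<in> Obj C" if "i \<in> ?I" for i
  proof -
    have "?R i \<in> set (X' @ X @ A)" using that by (intro nth_mem) simp
    then show ?thesis using X X' A by auto
  qed
  have oQ: "?Q j \<in> Obj C" if "j \<in> ?J" for j
  proof -
    have "?Q j \<in> set (X' @ X @ B)" using that by (intro nth_mem) simp
    then show ?thesis using X X' B by auto
  qed
  have R': "?R i = (X @ A) ! (i - ?n')" if "\<not> i < ?n'" for i using that by (simp add: nth_append)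
  have Q': "?Q j = (X' @ B) ! \<phi> j" if "\<not> (?n' \<le> j \<and> j < ?n' + ?n)" for j
    using that by (auto simp: nth_append \<phi>_def intro: arg_cong[of _ _ "(!) B"])
  have \<phi>: "\<phi> j < ?n' + ?b" if "j \<in> ?J" "\<not> (?n' \<le> j \<and> j < ?n' + ?n)" for j
    using that by (auto simp: \<phi>_def)
  have kh: "ent k i (j - ?n') \<in> Hom C (?R i) (?Q j)" if "i < ?n'" "?n' \<le> j" "j < ?n' + ?n" for i j
  proof -
    have "j - ?n' < ?n" using that by auto
    then show ?thesis using ent_hom[OF k that(1), of "j - ?n'"] that by (simp add: nth_append)
  qed
  have fh: "ent f (i - ?n') (\<phi> j) \<in> Hom C (?R i) (?Q j)"
    if "i \<in> ?I" "\<not> i < ?n'" "j \<in> ?J" "\<not> (?n' \<le> j \<and> j < ?n' + ?n)" for i j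
    using ent_hom[OF f, of "i - ?n'" "\<phi> j"] that R'[OF that(2)] Q'[OF that(4)] \<phi>[OF that(3,4)] by auto
  have Hh: "H i j \<in> Hom C (?R i) (?Q j)" if "i \<in> ?I" "j \<in> ?J" for i j
    using kh[of i j] fh[OF that(1) _ that(2)] zero_hom[OF oR[OF that(1)] oQ[OF that(2)]]
        by (simp add: H_def)
  have H0: "H i j = Zero C (?R i) (?Q j)" if "(i < ?n') \<noteq> (?n' \<le> j \<and> j < ?n' + ?n)" for i j
    using that by (auto simp: H_def)
  have Hp: "perp (H i j) (H i j')" if i: "i \<in> ?I" and j: "j \<in> ?J" "j' \<in> ?J" "j \<noteq> j'" for i j j'
  proof -
    consider (z) "H i j = Zero C (?R i) (?Q j)" | (z') "H i j' = Zero C (?R i) (?Q j')"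
      | (k) "i < ?n'" "?n' \<le> j" "j < ?n' + ?n" "?n' \<le> j'" "j' < ?n' + ?n"
      | (f) "\<not> i < ?n'" "\<not> (?n' \<le> j \<and> j < ?n' + ?n)" "\<not> (?n' \<le> j' \<and> j' < ?n' + ?n)"
      using H0[of i j] H0[of i j'] by blast
    then show ?thesis
    proof cases
      case z
      then show ?thesis using perp_zero_left[OF Hh[OF i j(2)] oQ[OF j(1)]] by simp
    next
      case z'
      then show ?thesis using perp_zero_right[OF Hh[OF i j(1)] oQ[OF j(2)]] by simp
    next
      case k
      then show ?thesis using ent_perp[OF \<open>k \<in> Hom M X' X\<close> k(1), of "j - ?n'" "j' - ?n'"] j(3)
        by (auto simp: H_def)
    next
      case f
      have "\<phi> j \<noteq> \<phi> j'" using f j(3) by (auto simp: \<phi>_def split: if_splits)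
      moreover have "i - ?n' < length (X @ A)" using f i by auto
      ultimately have "perp (ent f (i - ?n') (\<phi> j)) (ent f (i - ?n') (\<phi> j'))"
        using ent_perp[OF \<open>f \<in> Hom M (X @ A) (X' @ B)\<close>, of "i - ?n'" "\<phi> j" "\<phi> j'"] \<phi>[OF j(1) f(2)] \<phi>[OF j(2)
            f(3)] by simp
      moreover have "H i j = ent f (i - ?n') (\<phi> j)" "H i j' = ent f (i - ?n') (\<phi> j')"
        unfolding H_def using f by auto
      ultimately show ?thesis by simp
    qed
  qed
  have H: "row_disjoint ?R ?Q ?I ?J H" using Hh Hp unfolding row_disjoint_def by blast
  \<comment> \<open>Row and column objects agree on the pivots \<open>X' + X\<close>, as elimination
    requires; only the final blocks \<open>A\<close> and \<open>B\<close> differ.\<close>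
  have RQ: "?R x = ?Q x" if "x < ?n' + ?n" for x
    using that nth_append_left[of x "X' @ X" A] nth_append_left[of x "X' @ X" B] by simp
  let ?F1 = "MAT_comp C f (SumMap M [k, MAT_ident C B])" and ?F2 =
      "MAT_comp C (SumMap M [k, MAT_ident C A]) f"
  have F1: "?F1 \<in> Hom M (X @ A) (X @ B)"
      by (rule MAT_comp_hom[OF f SumMap_pair_hom[OF k MAT_ident_hom[OF B]]])
  have F2: "?F2 \<in> Hom M (X' @ A) (X' @ B)"
      by (rule MAT_comp_hom[OF SumMap_pair_hom[OF k MAT_ident_hom[OF A]] f])
  \<comment> \<open>The block from \<open>X'\<close> to itself vanishes, so eliminating
    \<open>X'\<close> merely adds the products of the \<open>X'\<close> columns of \<open>f\<close>
    with \<open>k\<close>. These land in the columns of \<open>X\<close>, where \<open>H\<close> was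
    zero; the columns of \<open>B\<close> keep the entries of \<open>f\<close>.\<close>
  have e1: "eliminates [0..<?n'] H (?n' + i) (?n' + j) = ent ?F1 i j" if ij: "i < ?n + ?a" "j < ?n + ?b"
      for i j
  proof -
    have I: "?n' + i \<in> ?I" and J: "?n' + j \<in> ?J" using ij by auto
    have z: "eliminates [0..<?n'] H (?n' + i) (?n' + j) = bjoin C (H (?n' + i) (?n' + j))
        (Join C (?R (?n' + i)) (?Q (?n' + j)) ((\<lambda>x. H (?n' + i) x \<Zsemi> H x (?n' + j)) ` set [0..<?n']))"
      by (rule eliminates_zero_block[OF H _ _ _ RQ I J]) (auto simp: H_def)
    have Rr: "?R (?n' + i) = (X @ A) ! i" by simp
    have fi: "ent f i x \<in> Hom C ((X @ A) ! i) (X' ! x)" if "x < ?n'" for x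
      using ent_hom[OF f, of i x] ij(1) that by (simp add: nth_append)
    show ?thesis
    proof (cases "j < ?n")
      case True
      have "(\<lambda>x. H (?n' + i) x \<Zsemi> H x (?n' + j)) ` set [0..<?n'] = (\<lambda>x. ent f i x \<Zsemi> ent k x j) ` {..<?n'}"
        using True by (intro image_cong) (auto simp: H_def \<phi>_def)
      moreover have "H (?n' + i) (?n' + j) = Zero C ((X @ A) ! i) (X ! j)"
        using True by (simp add: H_def nth_append)
      moreover have "?Q (?n' + j) = X ! j" using True by (simp add: nth_append)
      moreover have "ent ?F1 i j = Join C ((X @ A) ! i) (X ! j) ((\<lambda>x. ent f i x \<Zsemi> ent k x j) ` {..<?n'})"
        using ent_comp_sum_ident(1)[OF f k _ True, of i] ij(1) by simp
      moreover have "ent ?F1 i j \<in> Hom C ((X @ A) ! i) (X ! j)"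
        using ent_hom[OF F1, of i j] ij True by (simp add: nth_append)
      ultimately show ?thesis using z Rr bjoin_zero_left by simp
    next
      case False
      then obtain j' where j': "j = ?n + j'" "j' < ?b" using split_index[of j X B] ij(2) by auto
      have "Join C (?R (?n' + i)) (?Q (?n' + j)) ((\<lambda>x. H (?n' + i) x \<Zsemi> H x (?n' + j)) ` set [0..<?n']) =
          Zero C (?R (?n' + i)) (?Q (?n' + j))"
      proof (rule Join_all_zero[OF oR[OF I] oQ[OF J]])
        fix x assume x: "x \<in> set [0..<?n']"
        have "H x (?n' + j) = Zero C (?Q x) (?Q (?n' + j))" using x False RQ[of x] by (simp add: H_def)
        then show "H (?n' + i) x \<Zsemi> H x (?n' + j) = Zero C (?R (?n' + i)) (?Q (?n' + j))"
          using comp_zero[OF Hh[OF I] oQ[OF J], of x] x by simp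
      qed
      moreover have "H (?n' + i) (?n' + j) = ent f i (?n' + j')" using j' by (simp add: H_def \<phi>_def)
      moreover have "ent ?F1 i j = ent f i (?n' + j')"
          using ent_comp_sum_ident(2)[OF f k _ j'(2), of i] ij(1) j' by simp
      ultimately show ?thesis using z bjoin_zero_right[OF Hh[OF I J]] by simp
    qed
  qed
  \<comment> \<open>\<open>\<rho>\<close> gives the position of an index of \<open>X' + A\<close> or
    \<open>X' + B\<close> in the big matrix, leaping over \<open>X\<close>.\<close>
  define \<rho> where "\<rho> i = (if i < ?n' then i else i + ?n)" for i
  have e2: "eliminates [?n'..<?n' + ?n] H (\<rho> i) (\<rho> j) = ent ?F2 i j" if ij: "i < ?n' + ?a" "j < ?n' + ?b"
      for i j
  proof -
    have I: "\<rho> i \<in> ?I" and J: "\<rho> j \<in> ?J" and nj: "\<rho> j \<notin> set [?n'..<?n' + ?n]"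
      using ij by (auto simp: \<rho>_def)
    have z: "eliminates [?n'..<?n' + ?n] H (\<rho> i) (\<rho> j) = bjoin C (H (\<rho> i) (\<rho> j))
        (Join C (?R (\<rho> i)) (?Q (\<rho> j)) ((\<lambda>x. H (\<rho> i) x \<Zsemi> H x (\<rho> j)) ` set [?n'..<?n' + ?n]))"
      by (rule eliminates_zero_block[OF H _ _ _ RQ I J nj]) (auto simp: H_def)
    have \<phi>\<rho>: "\<phi> (\<rho> j) = j" by (simp add: \<phi>_def \<rho>_def)
    have Qj: "?Q (\<rho> j) = (X' @ B) ! j" using Q'[of "\<rho> j"] nj \<phi>\<rho> by auto
    have set: "set [?n'..<?n' + ?n] = (\<lambda>l. ?n' + l) ` {..<?n}"
      by (simp add: image_add_atLeastLessThan lessThan_atLeast0 add.commute del: atLeast0LessThan)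
    show ?thesis
    proof (cases "i < ?n'")
      case True
      have Ri: "?R (\<rho> i) = X' ! i" using True by (simp add: \<rho>_def nth_append)
      have H0: "H (\<rho> i) (\<rho> j) = Zero C (X' ! i) ((X' @ B) ! j)"
        using True nj Ri Qj by (auto simp: H_def \<rho>_def)
      have "(\<lambda>x. H (\<rho> i) x \<Zsemi> H x (\<rho> j)) ` set [?n'..<?n' + ?n] = (\<lambda>l. ent k i l \<Zsemi> ent f l j) ` {..<?n}"
        unfolding set image_image
      proof (rule image_cong[OF refl])
        fix l assume l: "l \<in> {..<?n}"
        have "H (\<rho> i) (?n' + l) = ent k i l" using True l by (simp add: H_def \<rho>_def)
        moreover have "H (?n' + l) (\<rho> j) = ent f l j" using nj \<phi>\<rho> unfolding H_def by auto
        ultimately show "H (\<rho> i) (?n' + l) \<Zsemi> H (?n' + l) (\<rho> j) = ent k i l \<Zsemi> ent f l j" by simp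
      qed
      moreover have "ent ?F2 i j = Join C (X' ! i) ((X' @ B) ! j) ((\<lambda>l. ent k i l \<Zsemi> ent f l j) ` {..<?n})"
        using ent_sum_ident_comp(1)[OF f k True] ij(2) by simp
      moreover have "ent ?F2 i j \<in> Hom C (X' ! i) ((X' @ B) ! j)"
        using ent_hom[OF F2, of i j] ij True by (simp add: nth_append)
      ultimately show ?thesis using z Ri Qj H0 bjoin_zero_left by simp
    next
      case False
      then obtain i' where i': "i = ?n' + i'" "i' < ?a" using split_index[of i X' A] ij(1) by auto
      have "Join C (?R (\<rho> i)) (?Q (\<rho> j)) ((\<lambda>x. H (\<rho> i) x \<Zsemi> H x (\<rho> j)) ` set [?n'..<?n' + ?n]) =
          Zero C (?R (\<rho> i)) (?Q (\<rho> j))"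
      proof (rule Join_all_zero[OF oR[OF I] oQ[OF J]])
        fix x assume x: "x \<in> set [?n'..<?n' + ?n]"
        have "H (\<rho> i) x = Zero C (?R (\<rho> i)) (?R x)" using x False RQ[of x] by (simp add: H_def \<rho>_def)
        then show "H (\<rho> i) x \<Zsemi> H x (\<rho> j) = Zero C (?R (\<rho> i)) (?Q (\<rho> j))"
          using zero_comp[OF Hh[OF _ J] oR[OF I], of x] x by simp
      qed
      moreover have "H (\<rho> i) (\<rho> j) = ent f (?n + i') j"
      proof -
        have "\<rho> i - ?n' = ?n + i'" "\<not> \<rho> i < ?n'" using i' by (auto simp: \<rho>_def)
        then show ?thesis using nj \<phi>\<rho> unfolding H_def by auto
      qed
      moreover have "ent ?F2 i j = ent f (?n + i') j"
          using ent_sum_ident_comp(2)[OF f k i'(2), of j] ij(2) i' by simp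
      ultimately show ?thesis using z bjoin_zero_right[OF Hh[OF I J]] by simp
    qed
  qed
  show ?thesis
  proof (rule MAT_eqI[OF MAT_trace_hom[OF F1] MAT_trace_hom[OF F2]])
    fix i j assume ij: "i < ?a" "j < ?b"
    let ?r = "?n' + ?n + i" and ?c = "?n' + ?n + j"
    \<comment> \<open>Each trace is rewritten as an elimination at positions of the big matrix
      \<open>H\<close>; \<open>eliminates_swap\<close> then exchanges the two groups of
      pivots.\<close>
    have "ent (MAT_trace C wand X A B ?F1) i j =
        eliminates [0..<?n] (\<lambda>i j. eliminates [0..<?n'] H (?n' + i) (?n' + j)) (?n + i) (?n + j)"
      unfolding ent_trace[OF F1 ij]
      by (rule eliminates_cong[where I = "{..<?n + ?a}" and J = "{..<?n + ?b}"]) (use e1 ij in auto)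
    also have "\<dots> = eliminates (map (\<lambda>i. ?n' + i) [0..<?n]) (eliminates [0..<?n'] H) ?r ?c"
      using eliminates_reindex[of "[0..<?n]" "\<lambda>i. ?n' + i" "\<lambda>i. ?n' + i" "eliminates [0..<?n'] H"]
      by (simp add: add.assoc)
    also have "map (\<lambda>i. ?n' + i) [0..<?n] = [?n'..<?n' + ?n]"
      using map_add_upt[of ?n' ?n] by (simp add: add.commute)
    also have "eliminates [?n'..<?n' + ?n] (eliminates [0..<?n'] H) ?r ?c =
        eliminates ([0..<?n'] @ [?n'..<?n' + ?n]) H ?r ?c"
      by (simp add: eliminates_append)
    also have "\<dots> = eliminates ([?n'..<?n' + ?n] @ [0..<?n']) H ?r ?c"
      by (rule eliminates_swap[OF H _ _ _ RQ]) (use ij in auto)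
    also have "\<dots> = eliminates [0..<?n'] (eliminates [?n'..<?n' + ?n] H) (\<rho> (?n' + i)) (\<rho> (?n' + j))"
      by (simp add: eliminates_append \<rho>_def add.commute add.left_commute)
    also have "\<dots> = eliminates [0..<?n'] (\<lambda>i j. eliminates [?n'..<?n' + ?n] H (\<rho> i) (\<rho> j)) (?n' + i) (?n' +
        j)"
    proof -
      have "map \<rho> [0..<?n'] = [0..<?n']" by (intro map_idI) (simp add: \<rho>_def)
      then show ?thesis
        using eliminates_reindex[of "[0..<?n']" \<rho> \<rho> "eliminates [?n'..<?n' + ?n] H"] by simp
    qed
    also have "\<dots> = ent (MAT_trace C wand X' A B ?F2) i j"
      unfolding ent_trace[OF F2 ij]
      by (rule eliminates_cong[where I = "{..<?n' + ?a}" and J = "{..<?n' + ?b}"]) (use e2 ij in auto)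
    finally show "ent (MAT_trace C wand X A B ?F1) i j = ent (MAT_trace C wand X' A B ?F2) i j" .
  qed
qed

lemma MAT_traced: "traced_extensive_restriction_category M (MAT_trace C wand)"
proof unfold_locales
  fix X A B f assume "X \<in> Obj M" "A \<in> Obj M" "B \<in> Obj M" "f \<in> Hom M (X \<oplus>\<^sub>o\<^bsub>M\<^esub> A) (X \<oplus>\<^sub>o\<^bsub>M\<^esub> B)"
  then have f: "f \<in> Hom M (X @ A) (X @ B)" by simp
  show "MAT_trace C wand X A B f \<in> Hom M A B" by (rule MAT_trace_hom[OF f])
  show "MAT_trace C wand X A' B' ((Ident M X \<oplus>\<^sub>m\<^bsub>M\<^esub> g) \<Zsemi>\<^bsub>M\<^esub> f \<Zsemi>\<^bsub>M\<^esub> (Ident M X \<oplus>\<^sub>m\<^bsub>M\<^esub> h)) =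
      g \<Zsemi>\<^bsub>M\<^esub> MAT_trace C wand X A B f \<Zsemi>\<^bsub>M\<^esub> h"
    if g: "g \<in> Hom M A' A" and h: "h \<in> Hom M B B'" for g h A' B'
  proof -
    have X: "set X \<subseteq> Obj C" using hom_MAT_D(1)[OF f] by simp
    have "MAT_comp C (SumMap M [MAT_ident C X, g]) f \<in> Hom M (X @ A') (X @ B)"
      by (rule MAT_comp_hom[OF SumMap_pair_hom[OF MAT_ident_hom[OF X] g] f])
    from MAT_trace_comp_right[OF this h] MAT_trace_comp_left[OF f g] show ?thesis by simp
  qed
  show "MAT_trace C wand X (A \<oplus>\<^sub>o\<^bsub>M\<^esub> D) (B \<oplus>\<^sub>o\<^bsub>M\<^esub> E) (Assoc_inv M X A D \<Zsemi>\<^bsub>M\<^esub> (f \<oplus>\<^sub>m\<^bsub>M\<^esub> g) \<Zsemi>\<^bsub>M\<^esub> Assoc M X B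
      E) =
      MAT_trace C wand X A B f \<oplus>\<^sub>m\<^bsub>M\<^esub> g" if g: "g \<in> Hom M D E" for g D E
  proof -
    have S: "SumMap M [f, g] \<in> Hom M (X @ A @ D) (X @ B @ E)" using SumMap_pair_hom[OF f g] by simp
    have "Assoc_inv M X A D = MAT_ident C (X @ A @ D)" "Assoc M X B E = MAT_ident C (X @ B @ E)"
      using hom_MAT_D(1,2)[OF f] hom_MAT_D(1,2)[OF g] by (auto intro!: Assoc_inv_MAT Assoc_MAT)
    then show ?thesis
      using MAT_trace_superpose[OF f g] MAT_ident_left[OF S] MAT_ident_right[OF S] by simp
  qed
next
  fix X X' A B f k
  assume "f \<in> Hom M (X \<oplus>\<^sub>o\<^bsub>M\<^esub> A) (X' \<oplus>\<^sub>o\<^bsub>M\<^esub> B)" "k \<in> Hom M X' X"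
  then show "MAT_trace C wand X A B (f \<Zsemi>\<^bsub>M\<^esub> (k \<oplus>\<^sub>m\<^bsub>M\<^esub> Ident M B)) =
      MAT_trace C wand X' A B ((k \<oplus>\<^sub>m\<^bsub>M\<^esub> Ident M A) \<Zsemi>\<^bsub>M\<^esub> f)"
    using MAT_trace_slide by simp
next
  fix X Y A B f
  assume XYAB: "X \<in> Obj M" "Y \<in> Obj M" "A \<in> Obj M" "B \<in> Obj M"
    and "f \<in> Hom M ((X \<oplus>\<^sub>o\<^bsub>M\<^esub> Y) \<oplus>\<^sub>o\<^bsub>M\<^esub> A) ((X \<oplus>\<^sub>o\<^bsub>M\<^esub> Y) \<oplus>\<^sub>o\<^bsub>M\<^esub> B)"
  then have f: "f \<in> Hom M (X @ Y @ A) (X @ Y @ B)" by simp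
  have "Assoc_inv M X Y A = MAT_ident C (X @ Y @ A)" "Assoc M X Y B = MAT_ident C (X @ Y @ B)"
    using XYAB by (auto intro!: Assoc_inv_MAT Assoc_MAT)
  then show "MAT_trace C wand (X \<oplus>\<^sub>o\<^bsub>M\<^esub> Y) A B f = MAT_trace C wand Y A B
      (MAT_trace C wand X (Y \<oplus>\<^sub>o\<^bsub>M\<^esub> A) (Y \<oplus>\<^sub>o\<^bsub>M\<^esub> B) (Assoc_inv M X Y A \<Zsemi>\<^bsub>M\<^esub> f \<Zsemi>\<^bsub>M\<^esub> Assoc M X Y B))"
    using MAT_trace_append[of X Y A B f "Y @ A" "Y @ B"] MAT_ident_left[OF f] MAT_ident_right[OF f] by simp
next
  fix X assume "X \<in> Obj M"
  then show "MAT_trace C wand X X X (Symm M X X) = Ident M X" using MAT_trace_yank by auto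
qed

end

section \<open>The induced Kleene wand\<close>

context finitely_disjoint_perp_restriction_category
begin

lemma MAT_block_mk:
  assumes "F \<in> Hom M A B" "G \<in> Hom M A E" "H \<in> Hom M D B" "K \<in> Hom M D E"
  shows "MAT_block F G H K = mk_arr (A @ D) (B @ E) (\<lambda>i j. if i < length A
    then (if j < length B then ent F i j else ent G i (j - length B))
    else (if j < length B then ent H (i - length A) j else ent K (i - length A) (j - length B)))"
  using assms by (auto simp: MAT_block_def mk_arr_def hom_MAT_iff intro!: eq_matI)

lemma MAT_block_hom:
  assumes F: "F \<in> Hom M A B" and G: "G \<in> Hom M A E" and H: "H \<in> Hom M D B" and K: "K \<in> Hom M D E"
    and FG: "perp_d M F G" and HK: "perp_d M H K"
  shows "MAT_block F G H K \<in> Hom M (A @ D) (B @ E)"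
  unfolding MAT_block_mk[OF F G H K]
proof (rule mk_arr_hom)
  fix i j assume ij: "i < length (A @ D)" "j < length (B @ E)"
  have "i - length A < length D" if "\<not> i < length A" using that ij by auto
  moreover have "j - length B < length E" if "\<not> j < length B" using that ij by auto
  ultimately show "(if i < length A then (if j < length B then ent F i j else ent G i (j - length B))
      else (if j < length B then ent H (i - length A) j else ent K (i - length A) (j - length B)))
      \<in> Hom C ((A @ D) ! i) ((B @ E) ! j)"
    using ent_hom[OF F] ent_hom[OF G] ent_hom[OF H] ent_hom[OF K] by (simp add: nth_append)
next
  fix i j j' assume ij: "i < length (A @ D)" "j < length (B @ E)" "j' < length (B @ E)" "j \<noteq> j'"
  have i: "i - length A < length D" if "\<not> i < length A" using that ij by auto
  have j: "j - length B < length E" if "\<not> j < length B" using that ij by auto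
  have j': "j' - length B < length E" if "\<not> j' < length B" using that ij by auto
  have pF: "perp (ent F i l) (ent G i l')" "perp (ent G i l') (ent F i l)"
    if "i < length A" "l < length B" "l' < length E" for i l l'
    using perp_d_iff[OF F G] FG that perp_sym by blast+
  have pH: "perp (ent H i l) (ent K i l')" "perp (ent K i l') (ent H i l)"
    if "i < length D" "l < length B" "l' < length E" for i l l'
    using perp_d_iff[OF H K] HK that perp_sym by blast+
  have "j - length B \<noteq> j' - length B" if "\<not> j < length B" "\<not> j' < length B" using that ij(4) by auto
  then show "perp (if i < length A then (if j < length B then ent F i j else ent G i (j - length B))
      else (if j < length B then ent H (i - length A) j else ent K (i - length A) (j - length B)))
    (if i < length A then (if j' < length B then ent F i j' else ent G i (j' - length B))
      else (if j' < length B then ent H (i - length A) j' else ent K (i - length A) (j' - length B)))"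
    using i j j' pF pH ij(4) ent_perp[OF F, of i j j'] ent_perp[OF G, of i "j - length B" "j' - length B"]
      ent_perp[OF H, of "i - length A" j j'] ent_perp[OF K, of "i - length A" "j - length B" "j' - length
          B"]
    by simp
qed (use hom_MAT_D(1,2)[OF F] hom_MAT_D(1,2)[OF K] in auto)

lemma ent_block:
  assumes "F \<in> Hom M A B" "G \<in> Hom M A E" "H \<in> Hom M D B" "K \<in> Hom M D E"
  shows "\<And>i j. \<lbrakk>i < length A; j < length B\<rbrakk> \<Longrightarrow> ent (MAT_block F G H K) i j = ent F i j"
    "\<And>i j. \<lbrakk>i < length A; j < length E\<rbrakk> \<Longrightarrow> ent (MAT_block F G H K) i (length B + j) = ent G i j"
    "\<And>i j. \<lbrakk>i < length D; j < length B\<rbrakk> \<Longrightarrow> ent (MAT_block F G H K) (length A + i) j = ent H i j"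
    "\<And>i j. \<lbrakk>i < length D; j < length E\<rbrakk> \<Longrightarrow> ent (MAT_block F G H K) (length A + i) (length B + j) = ent K i j"
  by (simp_all add: MAT_block_mk[OF assms])

lemma MAT_block_eqI:
  assumes L: "L \<in> Hom M (A @ D) (B @ E)" and F: "F \<in> Hom M A B" "G \<in> Hom M A E" "H \<in> Hom M D B" "K \<in> Hom M D
      E"
    and "\<And>i j. \<lbrakk>i < length A; j < length B\<rbrakk> \<Longrightarrow> ent L i j = ent F i j"
    and "\<And>i j. \<lbrakk>i < length A; j < length E\<rbrakk> \<Longrightarrow> ent L i (length B + j) = ent G i j"
    and "\<And>i j. \<lbrakk>i < length D; j < length B\<rbrakk> \<Longrightarrow> ent L (length A + i) j = ent H i j"
    and "\<And>i j. \<lbrakk>i < length D; j < length E\<rbrakk> \<Longrightarrow> ent L (length A + i) (length B + j) = ent K i j"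
  shows "L = MAT_block F G H K"
proof -
  have "mk_arr (A @ D) (B @ E) (\<lambda>i j. ent L i j) = MAT_block F G H K"
    unfolding MAT_block_mk[OF F]
  proof (rule mk_arr_cong)
    fix i j assume i: "i < length (A @ D)" and j: "j < length (B @ E)"
    show "ent L i j = (if i < length A then (if j < length B then ent F i j else ent G i (j - length B))
      else (if j < length B then ent H (i - length A) j else ent K (i - length A) (j - length B)))"
    proof (cases "i < length A"; cases "j < length B")
      assume "i < length A" "\<not> j < length B"
      moreover obtain j' where "j = length B + j'" "j' < length E"
          using split_index[OF \<open>\<not> j < length B\<close> j] .
      ultimately show ?thesis using assms(7) by simp
    next
      assume "\<not> i < length A" "j < length B"
      moreover obtain i' where "i = length A + i'" "i' < length D"
          using split_index[OF \<open>\<not> i < length A\<close> i] .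
      ultimately show ?thesis using assms(8) by simp
    next
      assume "\<not> i < length A" "\<not> j < length B"
      moreover obtain i' where "i = length A + i'" "i' < length D"
          using split_index[OF \<open>\<not> i < length A\<close> i] .
      moreover obtain j' where "j = length B + j'" "j' < length E"
          using split_index[OF \<open>\<not> j < length B\<close> j] .
      ultimately show ?thesis using assms(9) by simp
    qed (use assms(6) in simp)
  qed
  then show ?thesis using mk_arr_ent[OF L] by simp
qed

lemma MAT_block_comp_sum:
  assumes F: "F \<in> Hom M A B" and G: "G \<in> Hom M A E" and H: "H \<in> Hom M D B" and K: "K \<in> Hom M D E"
    and p: "perp_d M F G" "perp_d M H K" and k: "k \<in> Hom M B B'" and h: "h \<in> Hom M E E'"
  shows "MAT_comp C (MAT_block F G H K) (SumMap M [k, h]) =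
    MAT_block (MAT_comp C F k) (MAT_comp C G h) (MAT_comp C H k) (MAT_comp C K h)"
proof -
  note L = MAT_block_hom[OF F G H K p] and e = ent_block[OF F G H K] and S = SumMap_pair[OF k h]
  show ?thesis
  proof (rule MAT_block_eqI[OF MAT_comp_hom[OF L SumMap_pair_hom[OF k h]] MAT_comp_hom[OF F k]
      MAT_comp_hom[OF G h]
        MAT_comp_hom[OF H k] MAT_comp_hom[OF K h]])
    fix i j assume ij: "i < length A" "j < length B'"
    show "ent (MAT_comp C (MAT_block F G H K) (SumMap M [k, h])) i j = ent (MAT_comp C F k) i j"
      using S(5)[OF L, of i j] ent_comp[OF F k ij] e(1)[OF ij(1)] ij by (simp add: nth_append)
  next
    fix i j assume ij: "i < length A" "j < length E'"
    show "ent (MAT_comp C (MAT_block F G H K) (SumMap M [k, h])) i (length B' + j) =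
        ent (MAT_comp C G h) i j"
      using S(6)[OF L, of i j] ent_comp[OF G h ij] e(2)[OF ij(1)] ij by (simp add: nth_append)
  next
    fix i j assume ij: "i < length D" "j < length B'"
    show "ent (MAT_comp C (MAT_block F G H K) (SumMap M [k, h])) (length A + i) j =
        ent (MAT_comp C H k) i j"
      using S(5)[OF L, of "length A + i" j] ent_comp[OF H k ij] e(3)[OF ij(1)] ij by simp
  next
    fix i j assume ij: "i < length D" "j < length E'"
    show "ent (MAT_comp C (MAT_block F G H K) (SumMap M [k, h])) (length A + i) (length B' + j) =
        ent (MAT_comp C K h) i j"
      using S(6)[OF L, of "length A + i" j] ent_comp[OF K h ij] e(4)[OF ij(1)] ij by simp
  qed
qed

lemma MAT_sum_comp_block:
  assumes F: "F \<in> Hom M A B" and G: "G \<in> Hom M A E" and H: "H \<in> Hom M D B" and K: "K \<in> Hom M D E"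
    and p: "perp_d M F G" "perp_d M H K" and k: "k \<in> Hom M A' A" and h: "h \<in> Hom M D' D"
  shows "MAT_comp C (SumMap M [k, h]) (MAT_block F G H K) =
    MAT_block (MAT_comp C k F) (MAT_comp C k G) (MAT_comp C h H) (MAT_comp C h K)"
proof -
  note L = MAT_block_hom[OF F G H K p] and e = ent_block[OF F G H K] and S = SumMap_pair[OF k h]
  show ?thesis
  proof (rule MAT_block_eqI[OF MAT_comp_hom[OF SumMap_pair_hom[OF k h] L] MAT_comp_hom[OF k F]
      MAT_comp_hom[OF k G]
        MAT_comp_hom[OF h H] MAT_comp_hom[OF h K]])
    fix i j assume ij: "i < length A'" "j < length B"
    show "ent (MAT_comp C (SumMap M [k, h]) (MAT_block F G H K)) i j = ent (MAT_comp C k F) i j"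
      using S(7)[OF L, of i j] ent_comp[OF k F ij] e(1)[OF _ ij(2)] ij by (simp add: nth_append)
  next
    fix i j assume ij: "i < length A'" "j < length E"
    show "ent (MAT_comp C (SumMap M [k, h]) (MAT_block F G H K)) i (length B + j) =
        ent (MAT_comp C k G) i j"
      using S(7)[OF L, of i "length B + j"] ent_comp[OF k G ij] e(2)[OF _ ij(2)] ij by simp
  next
    fix i j assume ij: "i < length D'" "j < length B"
    show "ent (MAT_comp C (SumMap M [k, h]) (MAT_block F G H K)) (length A' + i) j =
        ent (MAT_comp C h H) i j"
      using S(8)[OF L, of i j] ent_comp[OF h H ij] e(3)[OF _ ij(2)] ij by (simp add: nth_append)
  next
    fix i j assume ij: "i < length D'" "j < length E"
    show "ent (MAT_comp C (SumMap M [k, h]) (MAT_block F G H K)) (length A' + i) (length B + j) =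
        ent (MAT_comp C h K) i j"
      using S(8)[OF L, of i "length B + j"] ent_comp[OF h K ij] e(4)[OF _ ij(2)] ij by simp
  qed
qed

end

section \<open>The wand laws for matrices\<close>

context finitely_disjoint_itegory
begin

lemma MAT_wand_eq:
  "\<lbrakk>F \<in> Hom M X X; G \<in> Hom M X A\<rbrakk> \<Longrightarrow> MAT_wand C wand F G = MAT_trace C wand X X A (MAT_block F G F G)"
  using hom_MAT_D(3)[of F X X] hom_MAT_D(4)[of G X A] by (simp add: MAT_wand_def)

lemma MAT_wand_hom:
  assumes "F \<in> Hom M X X" "G \<in> Hom M X A" "perp_d M F G"
  shows "MAT_wand C wand F G \<in> Hom M X A"
  unfolding MAT_wand_eq[OF assms(1,2)]
  by (rule MAT_trace_hom[OF MAT_block_hom[OF assms(1,2,1,2,3,3)]])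

text \<open>The matrix \<open>[F G]\<close> as a function to which elimination applies directly,
  without the second copy of the rows that \<open>MAT_block\<close> carries.\<close>

definition row_pair :: "'o list \<Rightarrow> ('o, 'm) marr \<Rightarrow> ('o, 'm) marr \<Rightarrow> nat \<Rightarrow> nat \<Rightarrow> 'm" where
  "row_pair X F G i j = (if j < length X then ent F i j else ent G i (j - length X))"

lemma row_disjoint_row_pair:
  assumes "F \<in> Hom M X X" "G \<in> Hom M X A" "perp_d M F G"
  shows "row_disjoint ((!) X) ((!) (X @ A)) {..<length X} {..<length X + length A} (row_pair X F G)"
proof -
  have "row_disjoint ((!) (X @ X)) ((!) (X @ A)) {..<length X} {..<length X + length A} (ent (MAT_block F G
      F G))"
    by (rule row_disjoint_subset[OF hom_MAT_D(5)[OF MAT_block_hom[OF assms(1,2,1,2,3,3)]]]) auto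
  then show ?thesis
    by (auto simp: row_disjoint_def MAT_block_mk[OF assms(1,2,1,2)] row_pair_def nth_append)
qed

text \<open>The block matrix contains each row of \<open>[F G]\<close> twice. Folding the second
  copy onto the first is a renaming of rows that fixes the pivots, and since eliminated rows are
  kept, the result is read off in the pivot rows themselves.\<close>

lemma ent_wand:
  assumes F: "F \<in> Hom M X X" and G: "G \<in> Hom M X A" and p: "perp_d M F G"
    and ij: "i < length X" "j < length A"
  shows "ent (MAT_wand C wand F G) i j = eliminates [0..<length X] (row_pair X F G) i (length X + j)"
proof -
  let ?n = "length X"
  let ?\<rho> = "\<lambda>i. if i < ?n then i else i - ?n"
  note L = MAT_block_hom[OF F G F G p p]
  have "ent (MAT_wand C wand F G) i j =
      eliminates [0..<?n] (\<lambda>i j. ent (MAT_block F G F G) i j) (?n + i) (?n + j)"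
    unfolding MAT_wand_eq[OF F G] by (rule ent_trace[OF L ij])
  also have "\<dots> = eliminates [0..<?n] (\<lambda>i j. row_pair X F G (?\<rho> i) j) (?n + i) (?n + j)"
    by (rule eliminates_cong[where I = "{..<length (X @ X)}" and J = "{..<length (X @ A)}"])
      (use ij in \<open>auto simp: MAT_block_mk[OF F G F G] row_pair_def\<close>)
  also have "\<dots> = eliminates (map ?\<rho> [0..<?n]) (row_pair X F G) (?\<rho> (?n + i)) (?n + j)"
    using eliminates_reindex[of "[0..<?n]" ?\<rho> "\<lambda>j. j" "row_pair X F G"] by simp
  also have "map ?\<rho> [0..<?n] = [0..<?n]" by (intro map_idI) simp
  finally show ?thesis by simp
qed

text \<open>The fixed-point equation is \<open>eliminates_solution\<close> for the matrix
  \<open>[F G]\<close>.\<close>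

lemma MAT_wand_iterate:
  assumes F: "F \<in> Hom M X X" and G: "G \<in> Hom M X A" and p: "perp_d M F G"
  shows "bjoin M G (MAT_comp C F (MAT_wand C wand F G)) = MAT_wand C wand F G"
proof -
  let ?n = "length X"
  note W = MAT_wand_hom[OF F G p]
  note FW = MAT_comp_hom[OF F W]
  have p': "perp_d M G (MAT_comp C F (MAT_wand C wand F G))"
    using MAT.perp_sym[OF MAT.perp_comp1[OF p F G W]] by simp
  have "bjoin C (ent G i j) (ent (MAT_comp C F (MAT_wand C wand F G)) i j) = ent (MAT_wand C wand F G) i j"
    if ij: "i < ?n" "j < length A" for i j
  proof -
    have "eliminates [0..<?n] (row_pair X F G) i (?n + j) = bjoin C (row_pair X F G i (?n + j))
        (Join C (X ! i) ((X @ A) ! (?n + j))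
          ((\<lambda>x. row_pair X F G i x \<Zsemi> eliminates [0..<?n] (row_pair X F G) x (?n + j)) ` set [0..<?n]))"
      by (rule eliminates_solution[OF row_disjoint_row_pair[OF F G p]]) (use ij in \<open>auto simp: nth_append\<close>)
    moreover have "(\<lambda>x. row_pair X F G i x \<Zsemi> eliminates [0..<?n] (row_pair X F G) x (?n + j)) ` set [0..<?n]
        =
        (\<lambda>x. ent F i x \<Zsemi> ent (MAT_wand C wand F G) x j) ` {..<?n}"
      using ent_wand[OF F G p _ ij(2)] by (intro image_cong) (auto simp: row_pair_def)
    moreover have "row_pair X F G i (?n + j) = ent G i j" by (simp add: row_pair_def)
    ultimately show ?thesis using ent_wand[OF F G p ij] ent_comp[OF F W ij] by simp
  qed
  then show ?thesis
    unfolding MAT_bjoin[OF G FW p'] by (subst mk_arr_ent[OF W, symmetric]) (rule mk_arr_cong)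
qed

text \<open>Tightening: the second block column of the matrix absorbs \<open>h\<close>, while the
  first is composed with an identity.\<close>

lemma MAT_wand_natural:
  assumes F: "F \<in> Hom M X X" and G: "G \<in> Hom M X A" and p: "perp_d M F G" and h: "h \<in> Hom M A B"
  shows "MAT_comp C (MAT_wand C wand F G) h = MAT_wand C wand F (MAT_comp C G h)"
proof -
  have X: "set X \<subseteq> Obj C" using hom_MAT_D(1)[OF F] .
  show ?thesis
    using MAT_trace_comp_right[OF MAT_block_hom[OF F G F G p p] h]
      MAT_block_comp_sum[OF F G F G p p MAT_ident_hom[OF X] h] MAT_ident_right[OF F]
    by (simp add: MAT_wand_eq[OF F G] MAT_wand_eq[OF F MAT_comp_hom[OF G h]])
qed

text \<open>The map \<open>k\<close> is slid around the matrix \<open>?f\<close> from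
  \<open>X + Y\<close> to \<open>Y + A\<close>. Composed in front, it produces the block matrix of
  the left-hand wand; composed behind, it produces the block matrix of the right-hand wand with
  \<open>k\<close> in front of its lower rows, and tightening moves that \<open>k\<close> out of the
  trace.\<close>

lemma MAT_wand_dinatural:
  assumes F: "F \<in> Hom M X Y" and G: "G \<in> Hom M X A" and k: "k \<in> Hom M Y X" and p: "perp_d M F G"
  shows "MAT_wand C wand (MAT_comp C k F) (MAT_comp C k G) =
      MAT_comp C k (MAT_wand C wand (MAT_comp C F k) G)"
proof -
  have Y: "set Y \<subseteq> Obj C" and A: "set A \<subseteq> Obj C" and X: "set X \<subseteq> Obj C"
    using hom_MAT_D(1,2)[OF F] hom_MAT_D(2)[OF G] by auto
  note iA = MAT_ident_hom[OF A] and iY = MAT_ident_hom[OF Y] and iX = MAT_ident_hom[OF X]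
  note kF = MAT_comp_hom[OF k F] and kG = MAT_comp_hom[OF k G] and Fk = MAT_comp_hom[OF F k]
  have pk: "perp_d M (MAT_comp C k F) (MAT_comp C k G)" using MAT.perp_comp_left[OF p F G k] by simp
  have pF: "perp_d M (MAT_comp C F k) G" using MAT.perp_comp1[OF p F G k] by simp
  let ?f = "MAT_block F G (MAT_comp C k F) (MAT_comp C k G)"
  note f = MAT_block_hom[OF F G kF kG p pk]
  have "MAT_wand C wand (MAT_comp C k F) (MAT_comp C k G) =
      MAT_trace C wand Y Y A (MAT_comp C (SumMap M [k, MAT_ident C Y]) ?f)"
    using MAT_sum_comp_block[OF F G kF kG p pk k iY] MAT_ident_left[OF kF] MAT_ident_left[OF kG]
    by (simp add: MAT_wand_eq[OF kF kG])
  also have "\<dots> = MAT_trace C wand X Y A (MAT_comp C ?f (SumMap M [k, MAT_ident C A]))"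
    by (rule MAT_trace_slide[OF f k, symmetric])
  also have "MAT_comp C ?f (SumMap M [k, MAT_ident C A]) =
      MAT_comp C (SumMap M [MAT_ident C X, k]) (MAT_block (MAT_comp C F k) G (MAT_comp C F k) G)"
    using MAT_block_comp_sum[OF F G kF kG p pk k iA] MAT_sum_comp_block[OF Fk G Fk G pF pF iX k]
      MAT_ident_right[OF G] MAT_ident_right[OF kG] MAT_ident_left[OF Fk] MAT_ident_left[OF G]
          MAT_comp_assoc[OF k F k]
    by simp
  also have "MAT_trace C wand X Y A \<dots> = MAT_comp C k (MAT_wand C wand (MAT_comp C F k) G)"
    using MAT_trace_comp_left[OF MAT_block_hom[OF Fk G Fk G pF pF] k] by (simp add: MAT_wand_eq[OF Fk G])
  finally show ?thesis .
qed

text \<open>Sliding the codiagonal around the loop turns the trace of \<open>F \<squnion> F'\<close> over \<open>X\<close> into a trace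
  over \<open>X + X\<close>, which vanishing splits into two successive traces.\<close>

lemma MAT_wand_diagonal:
  assumes F: "F \<in> Hom M X X" and F': "F' \<in> Hom M X X" and G: "G \<in> Hom M X A"
    and p: "perp_d M F F'" and q: "perp_d M (bjoin M F F') G"
  shows "perp_d M (MAT_wand C wand F F') (MAT_wand C wand F G)"
    and "MAT_wand C wand (bjoin M F F') G = MAT_wand C wand (MAT_wand C wand F F') (MAT_wand C wand F G)"
proof -
  let ?n = "length X"
  have X: "set X \<subseteq> Obj C" and A: "set A \<subseteq> Obj C" using hom_MAT_D(1)[OF F] hom_MAT_D(2)[OF G] .
  note J = MAT_is_join(2)[OF F F' p, folded MAT_bjoin[OF F F' p]]
  have le: "rle M F (bjoin M F F')" "rle M F' (bjoin M F F')"
    using MAT_is_join(1)[OF F F' p, folded MAT_bjoin[OF F F' p]] by (auto simp: is_join_def)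
  have FG: "perp_d M F G" and F'G: "perp_d M F' G"
    using MAT.perp_down[OF q _ MAT.rle_refl[OF G]] le by blast+
  \<comment> \<open>\<open>P\<close> is \<open>[F F']\<close> read as an arrow from \<open>X\<close>
    to \<open>X + X\<close>. Followed by the codiagonal it is the join of \<open>F\<close> and
    \<open>F'\<close>, and the codiagonal is what gets slid.\<close>
  define P where "P = mk_arr X (X @ X) (row_pair X F F')"
  have P: "P \<in> Hom M X (X @ X)"
    unfolding P_def
    by (rule mk_arr_hom) (use X row_disjoint_hom[OF row_disjoint_row_pair[OF F F' p]]
        row_disjoint_perp[OF row_disjoint_row_pair[OF F F' p]] in auto)
  have eP: "ent P i j = row_pair X F F' i j" if "i < ?n" "j < ?n + ?n" for i j
    using that by (simp add: P_def)
  have PG: "perp_d M P G"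
    unfolding perp_d_iff[OF P G]
  proof (intro allI impI)
    fix i j k assume ijk: "i < ?n" "j < length (X @ X)" "k < length A"
    then have "j - ?n < ?n" if "\<not> j < ?n" using that by auto
    then show "perp (ent P i j) (ent G i k)"
      using ijk perp_d_iff[OF F G] perp_d_iff[OF F' G] FG F'G by (simp add: eP row_pair_def)
  qed
  let ?N = "Codiag M 2 X"
  have N: "?N \<in> Hom M (X @ X) X" "?N = mk_arr (X @ X) X (\<lambda>i c.
      if i < ?n then ent (MAT_ident C X) i c else ent (MAT_ident C X) (i - ?n) c)"
    using Copair_pair[OF MAT_ident_hom[OF X] MAT_ident_hom[OF X]]
        by (simp_all add: Codiag_def replicate_two)
  have PN: "MAT_comp C P ?N = bjoin M F F'"
  proof (rule MAT_eqI[OF MAT_comp_hom[OF P N(1)] J])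
    fix i c assume ic: "i < ?n" "c < ?n"
    have P2: "P \<in> Hom M X (concat (replicate 2 X))" using P by (simp add: replicate_two)
    have "ent (MAT_comp C P ?N) i c = Join C (X ! i) (X ! c) {ent F i c, ent F' i c}"
      using ent_comp_Codiag(1)[OF X P2 ic] eP[OF ic(1), of c] eP[OF ic(1), of "?n + c"] ic
      by (simp add: replicate_two row_pair_def lessThan_Suc numeral_2_eq_2 insert_commute)
    also have "\<dots> = bjoin C (ent F i c) (ent F' i c)"
      using ent_hom[OF F ic] by (simp add: bjoin_def Hom_def)
    finally show "ent (MAT_comp C P ?N) i c = ent (bjoin M F F') i c"
      using MAT_bjoin[OF F F' p] ic by simp
  qed
  let ?f = "MAT_block P G P G"
  note f = MAT_block_hom[OF P G P G PG PG]
  let ?K = "MAT_comp C (SumMap M [?N, MAT_ident C X]) ?f"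
  have K: "?K \<in> Hom M (X @ X @ X) (X @ X @ A)"
    using MAT_comp_hom[OF SumMap_pair_hom[OF N(1) MAT_ident_hom[OF X]] f] by simp
  \<comment> \<open>Every row of \<open>?K\<close> is one of the rows of \<open>[F F' G]\<close>,
    and each of these occurs three times. \<open>Q\<close> holds the rows once, and
    \<open>\<rho>\<close> tells which of them a given position repeats.\<close>
  define Q where "Q i j = (if j < ?n then ent F i j else
      if j < ?n + ?n then ent F' i (j - ?n) else ent G i (j - ?n - ?n))" for i j
  define \<rho> where "\<rho> i = (if i < ?n then i else if i < ?n + ?n then i - ?n else i - ?n - ?n)" for i
  have fQ: "ent ?f i c = Q (if i < ?n then i else i - ?n) c" if "i < ?n + ?n" "c < ?n + ?n + length A"
      for i c
    using that by (auto simp: MAT_block_mk[OF P G P G] Q_def eP row_pair_def)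
  have eK: "ent ?K i c = Q (\<rho> i) c" if i: "i < ?n + ?n + ?n" and c: "c < ?n + ?n + length A" for i c
  proof (cases "i < ?n + ?n")
    case True
    let ?i = "if i < ?n then i else i - ?n"
    have i': "?i < ?n" using True by auto
    have "ent ?K i c = Join C ((X @ X) ! i) (((X @ X) @ A) ! c) ((\<lambda>l. ent ?N i l \<Zsemi> ent ?f l c) ` {..<?n})"
      using ent_sum_ident_comp(1)[OF f N(1), of i c] True c by simp
    also have "(\<lambda>l. ent ?N i l \<Zsemi> ent ?f l c) ` {..<?n} =
        (\<lambda>l. ent (MAT_ident C X) ?i l \<Zsemi> ent ?f l c) ` {..<?n}"
      using True by (intro image_cong) (auto simp: N(2))
    also have "(X @ X) ! i = X ! ?i" using True by (auto simp: nth_append)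
    also have "Join C (X ! ?i) (((X @ X) @ A) ! c) ((\<lambda>l. ent (MAT_ident C X) ?i l \<Zsemi> ent ?f l c) ` {..<?n}) =
        ent ?f ?i c"
    proof (rule Join_ident_comp[OF _ i' X])
      show "ent ?f l c \<in> Hom C (X ! l) (((X @ X) @ A) ! c)" if "l < ?n" for l
        using ent_hom[OF f, of l c] that c by (simp add: nth_append)
    qed
    also have "\<dots> = Q (\<rho> i) c" using fQ[of ?i c] i' c True by (simp add: \<rho>_def)
    finally show ?thesis .
  next
    case False
    then obtain i' where i': "i = length (X @ X) + i'" "i' < ?n" using split_index[of i "X @ X" X] i by auto
    then show ?thesis
      using ent_sum_ident_comp(2)[OF f N(1) i'(2), of c] fQ[of "?n + i'" c] c by (simp add: \<rho>_def)
  qed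
  let ?T = "MAT_trace C wand X X A ?K"
  have T: "?T \<in> Hom M (X @ X) (X @ A)" by (rule MAT_trace_hom[OF K])
  have eT: "ent ?T i j = eliminates [0..<?n] Q (\<rho> (?n + i)) (?n + j)"
      if ij: "i < ?n + ?n" "j < ?n + length A" for i j
  proof -
    have "ent ?T i j = eliminates [0..<?n] (\<lambda>i j. ent ?K i j) (?n + i) (?n + j)"
      using ent_trace[OF K, of i j] ij by simp
    also have "\<dots> = eliminates [0..<?n] (\<lambda>i j. Q (\<rho> i) j) (?n + i) (?n + j)"
      by (rule eliminates_cong[where I = "{..<?n + ?n + ?n}" and J =
          "{..<?n + ?n + length A}"]) (use eK ij in auto)
    also have "\<dots> = eliminates (map \<rho> [0..<?n]) Q (\<rho> (?n + i)) (?n + j)"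
      using eliminates_reindex[of "[0..<?n]" \<rho> "\<lambda>j. j" Q] by (simp add: \<rho>_def)
    also have "map \<rho> [0..<?n] = [0..<?n]" by (intro map_idI) (simp add: \<rho>_def)
    finally show ?thesis .
  qed
  have w1: "ent (MAT_wand C wand F F') i j = eliminates [0..<?n] Q i (?n + j)" if ij: "i < ?n" "j < ?n"
      for i j
    unfolding ent_wand[OF F F' p ij]
    by (rule eliminates_cong[where I = "{..<?n}" and J =
        "{..<?n + ?n}"]) (use ij in \<open>auto simp: Q_def row_pair_def\<close>)
  have w2: "ent (MAT_wand C wand F G) i j = eliminates [0..<?n] Q i (?n + ?n + j)"
      if ij: "i < ?n" "j < length A" for i j
  proof -
    \<comment> \<open>\<open>?\<kappa>\<close> leaps over the columns of \<open>F'\<close>, so that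
      the eliminated rows of \<open>Q\<close> contain the wand of \<open>F\<close> and
      \<open>G\<close> next to that of \<open>F\<close> and \<open>F'\<close>.\<close>
    let ?\<kappa> = "\<lambda>j. if j < ?n then j else ?n + j"
    have "row_pair X F G = (\<lambda>i j. Q i (?\<kappa> j))" by (intro ext) (auto simp: row_pair_def Q_def)
    then show ?thesis
      unfolding ent_wand[OF F G FG ij] using eliminates_reindex[of "[0..<?n]" "\<lambda>i. i" ?\<kappa> Q]
          by (simp add: add.assoc)
  qed
  note W1 = MAT_wand_hom[OF F F' p] and W2 = MAT_wand_hom[OF F G FG]
  have T1: "ent ?T i j = ent (MAT_wand C wand F F') i j" "ent ?T (?n + i) j =
      ent (MAT_wand C wand F F') i j"
    if "i < ?n" "j < ?n" for i j
    using eT[of i j] eT[of "?n + i" j] w1[OF that] that by (simp_all add: \<rho>_def)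
  have T2: "ent ?T i (?n + j) = ent (MAT_wand C wand F G) i j" "ent ?T (?n + i) (?n + j) =
      ent (MAT_wand C wand F G) i j"
    if "i < ?n" "j < length A" for i j
    using eT[of i "?n + j"] eT[of "?n + i" "?n + j"] w2[OF that] that by (simp_all add: \<rho>_def add.assoc)
  \<comment> \<open>Both wands are read off from the same rows of the arrow \<open>?T\<close>, whose
    rows are disjoint.\<close>
  show pW: "perp_d M (MAT_wand C wand F F') (MAT_wand C wand F G)"
    unfolding perp_d_iff[OF W1 W2]
  proof (intro allI impI)
    fix i j k assume "i < ?n" "j < ?n" "k < length A"
    then show "perp (ent (MAT_wand C wand F F') i j) (ent (MAT_wand C wand F G) i k)"
      using ent_perp[OF T, of i j "?n + k"] T1(1)[of i j] T2(1)[of i k] by simp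
  qed
  have "MAT_wand C wand (bjoin M F F') G =
      MAT_trace C wand X X A (MAT_comp C ?f (SumMap M [?N, MAT_ident C A]))"
    using MAT_block_comp_sum[OF P G P G PG PG N(1) MAT_ident_hom[OF A]] PN MAT_ident_right[OF G]
    by (simp add: MAT_wand_eq[OF J G])
  also have "\<dots> = MAT_trace C wand (X @ X) X A ?K" by (rule MAT_trace_slide[OF f N(1)])
  also have "\<dots> = MAT_trace C wand X X A ?T" by (rule MAT_trace_append)
  also have "?T = MAT_block (MAT_wand C wand F F') (MAT_wand C wand F G) (MAT_wand C wand F F') (MAT_wand C
      wand F G)"
    by (rule MAT_block_eqI[OF T W1 W2 W1 W2]) (use T1 T2 in auto)
  finally show "MAT_wand C wand (bjoin M F F') G =
      MAT_wand C wand (MAT_wand C wand F F') (MAT_wand C wand F G)"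
    by (simp add: MAT_wand_eq[OF W1 W2])
qed

lemma MAT_itegory: "perp_itegory M (perp_d M) (MAT_wand C wand)"
proof unfold_locales
  show "\<exists>j. is_join M A B {f, g} j" if "f \<in> Hom M A B" "g \<in> Hom M A B" "perp_d M f g" for f g A B
    using MAT_is_join(1)[OF that] by blast
qed (simp_all add: MAT_wand_hom MAT_wand_iterate MAT_wand_natural MAT_wand_dinatural MAT_wand_diagonal)

section \<open>The embedding of single maps as one-entry matrices\<close>

lemma MAT_embed_mk: "f \<in> Hom C A B \<Longrightarrow> MAT_embed C f = mk_arr [A] [B] (\<lambda>_ _. f)"
  by (simp add: MAT_embed_def mk_arr_def Hom_def case_prod_unfold)

lemma MAT_embed_hom:
  assumes "f \<in> Hom C A B" shows "MAT_embed C f \<in> Hom M [A] [B]"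
  unfolding MAT_embed_mk[OF assms] by (rule mk_arr_hom) (use assms hom_dom hom_cod in auto)

lemma MAT_embed_functor: "is_functor C M MAT_embed_obj (MAT_embed C)"
  unfolding is_functor_def MAT_embed_obj_def
proof (intro conjI ballI allI)
  show "MAT_embed C (Ident C A) = Ident M [A]" if A: "A \<in> Obj C" for A
  proof -
    have "MAT_embed C (Ident C A) = MAT_ident C [A]"
      using MAT_embed_mk[OF ident_hom[OF A]] MAT_ident_hom[of "[A]"] MAT_embed_hom[OF ident_hom[OF A]] A
      by (intro MAT_eqI[of _ "[A]" "[A]"]) auto
    then show ?thesis by simp
  qed
  fix A B E f g assume f: "f \<in> Hom C A B" and g: "g \<in> Hom C B E"
  note F = MAT_embed_hom[OF f] and G = MAT_embed_hom[OF g] and fg = comp_hom[OF f g]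
  have "MAT_embed C (f \<Zsemi> g) = MAT_comp C (MAT_embed C f) (MAT_embed C g)"
  proof (rule MAT_eqI[OF MAT_embed_hom[OF fg] MAT_comp_hom[OF F G]])
    fix i j assume "i < length [A]" "j < length [E]"
    then have ij: "i = 0" "j = 0" by auto
    show "ent (MAT_embed C (f \<Zsemi> g)) i j = ent (MAT_comp C (MAT_embed C f) (MAT_embed C g)) i j"
      using ent_comp[OF F G, of 0 0] Join_eq[OF is_join_single[OF fg]]
      by (simp add: ij MAT_embed_mk[OF f] MAT_embed_mk[OF g] MAT_embed_mk[OF fg] lessThan_Suc)
  qed
  then show "MAT_embed C (f \<Zsemi> g) = MAT_embed C f \<Zsemi>\<^bsub>M\<^esub> MAT_embed C g" by simp
qed (use MAT_embed_hom in auto)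

text \<open>Over a one-element list the trace is a single elimination, with entry
  \<open>g \<squnion> f (f \<circledast> g)\<close>; the iteration axiom of the given wand contracts
  it to \<open>f \<circledast> g\<close>.\<close>

lemma MAT_embed_wand:
  assumes f: "f \<in> Hom C X X" and g: "g \<in> Hom C X A" and p: "perp f g"
  shows "perp_d M (MAT_embed C f) (MAT_embed C g)"
    and "MAT_embed C (wand f g) = MAT_wand C wand (MAT_embed C f) (MAT_embed C g)"
proof -
  note F = MAT_embed_hom[OF f] and G = MAT_embed_hom[OF g] and w = wand_hom[OF f g p]
  show P: "perp_d M (MAT_embed C f) (MAT_embed C g)"
    unfolding perp_d_iff[OF F G] using p by (simp add: MAT_embed_mk[OF f] MAT_embed_mk[OF g])
  show "MAT_embed C (wand f g) = MAT_wand C wand (MAT_embed C f) (MAT_embed C g)"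
  proof (rule MAT_eqI[OF MAT_embed_hom[OF w] MAT_wand_hom[OF F G P]])
    fix i j assume "i < length [X]" "j < length [A]"
    then have ij: "i = 0" "j = 0" by auto
    show "ent (MAT_embed C (wand f g)) i j = ent (MAT_wand C wand (MAT_embed C f) (MAT_embed C g)) i j"
      using ent_wand[OF F G P, of 0 0] wand_iterate[OF f g p]
      by (simp add: ij eliminate_def row_pair_def MAT_embed_mk[OF f] MAT_embed_mk[OF g] MAT_embed_mk[OF w])
  qed
qed

end

theorem proposition9p15:
  fixes \<X> :: "('o, 'm, 'z) rcategory_scheme"
    and perp :: "'m \<Rightarrow> 'm \<Rightarrow> bool"
    and wand :: "'m \<Rightarrow> 'm \<Rightarrow> 'm"
  assumes "finitely_disjoint_perp_restriction_category \<X> perp"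
    and "perp_itegory \<X> perp wand"
  shows "traced_extensive_restriction_category (MAT \<X> perp) (MAT_trace \<X> wand) \<and>
    perp_itegory (MAT \<X> perp) (perp_d (MAT \<X> perp)) (MAT_wand \<X> wand) \<and>
    is_functor \<X> (MAT \<X> perp) MAT_embed_obj (MAT_embed \<X>) \<and>
    (\<forall>X A f g. f \<in> Hom \<X> X X \<longrightarrow> g \<in> Hom \<X> X A \<longrightarrow> perp f g \<longrightarrow>
       perp_d (MAT \<X> perp) (MAT_embed \<X> f) (MAT_embed \<X> g) \<and>
       MAT_embed \<X> (wand f g) = MAT_wand \<X> wand (MAT_embed \<X> f) (MAT_embed \<X> g))"
proof -
  interpret finitely_disjoint_itegory \<X> perp wand
    using assms by (rule finitely_disjoint_itegory.intro)
  show ?thesis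
    using MAT_traced MAT_itegory MAT_embed_functor MAT_embed_wand by blast
qed

end
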